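(* Let $\mathfrak g$ be a complex finite-dimensional simple Lie algebra and suppose $k\neq -h^\vee$. Then the image of any nonzero singular vector $v$ of $V^k(\mathfrak g)$ in the Zhu $C_2$-algebra $R_{V^k(\mathfrak g)}=V^k(\mathfrak g)/C_2(V^k(\mathfrak g))$ is nonzero.
   Context: $h^\vee$ is the dual Coxeter number. $\widehat{\mathfrak g}=\mathfrak g[t,t^{-1}]\oplus\mathbb C K$ with $[x(m),y(n)]=[x,y](m+n)+m(x|y)\delta_{m+n,0}K$ ($x(m)=x\otimes t^m$, $(\cdot|\cdot)$ the normalized invariant form $\frac1{2h^\vee}\times$Killing form). $V^k(\mathfrak g)=U(\widehat{\mathfrak g})\otimes_{U(\mathfrak g[t]\oplus\mathbb CK)}\mathbb C_k$ is the universal affine vertex algebra at level $k$, and $C_2(V)=\mathrm{span}\{a_{(-2)}b\}$; for $V^k(\mathfrak g)$ one has $C_2(V^k(\mathfrak g))=t^{-2}\mathfrak g[t^{-1}]V^k(\mathfrak g)$ and $R_{V^k(\mathfrak g)}\cong\mathbb C[\mathfrak g^*]$. Fix a triangular decomposition $\mathfrak g=\mathfrak n_-\oplus\mathfrak h\oplus\mathfrak n_+$ with positive roots $\Delta_+$, root vectors $e_\alpha$, and highest root $\theta$, lowest root vector $f_\theta$. A singular vector of a $\mathfrak g[t]$-module $M$ is $m\in M$ with $e_\alpha(0)m=0$ for all $\alpha\in\Delta_+$ and $f_\theta(1)m=0$. *)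

theory Defs
  imports Complex_Main
begin

definition lie_algebra :: "(complex \<Rightarrow> 'g::ab_group_add \<Rightarrow> 'g) \<Rightarrow> ('g \<Rightarrow> 'g \<Rightarrow> 'g) \<Rightarrow> bool" where
  "lie_algebra sc br \<longleftrightarrow> vector_space sc
     \<and> (\<forall>x y z. br (x + y) z = br x z + br y z)
     \<and> (\<forall>c x z. br (sc c x) z = sc c (br x z))
     \<and> (\<forall>x. br x x = 0)
     \<and> (\<forall>x y z. br x (br y z) + br y (br z x) + br z (br x y) = 0)"

definition is_basis :: "(complex \<Rightarrow> 'g::ab_group_add \<Rightarrow> 'g) \<Rightarrow> 'g set \<Rightarrow> bool" where
  "is_basis sc B \<longleftrightarrow> finite B \<and> module.independent sc B \<and> module.span sc B = UNIV"

definition fin_dim :: "(complex \<Rightarrow> 'g::ab_group_add \<Rightarrow> 'g) \<Rightarrow> bool" where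
  "fin_dim sc \<longleftrightarrow> (\<exists>B. is_basis sc B)"

definition lie_ideal :: "(complex \<Rightarrow> 'g::ab_group_add \<Rightarrow> 'g) \<Rightarrow> ('g \<Rightarrow> 'g \<Rightarrow> 'g) \<Rightarrow> 'g set \<Rightarrow> bool" where
  "lie_ideal sc br I \<longleftrightarrow> module.subspace sc I \<and> (\<forall>x\<in>I. \<forall>y. br y x \<in> I)"

definition simple_lie :: "(complex \<Rightarrow> 'g::ab_group_add \<Rightarrow> 'g) \<Rightarrow> ('g \<Rightarrow> 'g \<Rightarrow> 'g) \<Rightarrow> bool" where
  "simple_lie sc br \<longleftrightarrow> (\<exists>x y. br x y \<noteq> 0)
     \<and> (\<forall>I. lie_ideal sc br I \<longrightarrow> I = {0} \<or> I = UNIV)"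

definition trace_end :: "(complex \<Rightarrow> 'g::ab_group_add \<Rightarrow> 'g) \<Rightarrow> ('g \<Rightarrow> 'g) \<Rightarrow> complex" where
  "trace_end sc f = (let B = (SOME B. is_basis sc B) in
     \<Sum>b\<in>B. module.representation sc B (f b) b)"

definition killing :: "(complex \<Rightarrow> 'g::ab_group_add \<Rightarrow> 'g) \<Rightarrow> ('g \<Rightarrow> 'g \<Rightarrow> 'g) \<Rightarrow> 'g \<Rightarrow> 'g \<Rightarrow> complex" where
  "killing sc br x y = trace_end sc (\<lambda>z. br x (br y z))"

definition ad_semisimple :: "(complex \<Rightarrow> 'g::ab_group_add \<Rightarrow> 'g) \<Rightarrow> ('g \<Rightarrow> 'g \<Rightarrow> 'g) \<Rightarrow> 'g \<Rightarrow> bool" where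
  "ad_semisimple sc br x \<longleftrightarrow> module.span sc {v. \<exists>c. br x v = sc c v} = UNIV"

text \<open>Toral subalgebra: abelian subalgebra of ad-semisimple elements.
 A Cartan subalgebra of a semisimple Lie algebra is a maximal toral subalgebra.\<close>
definition toral :: "(complex \<Rightarrow> 'g::ab_group_add \<Rightarrow> 'g) \<Rightarrow> ('g \<Rightarrow> 'g \<Rightarrow> 'g) \<Rightarrow> 'g set \<Rightarrow> bool" where
  "toral sc br H \<longleftrightarrow> module.subspace sc H \<and> (\<forall>x\<in>H. \<forall>y\<in>H. br x y = 0)
     \<and> (\<forall>x\<in>H. ad_semisimple sc br x)"

definition cartan :: "(complex \<Rightarrow> 'g::ab_group_add \<Rightarrow> 'g) \<Rightarrow> ('g \<Rightarrow> 'g \<Rightarrow> 'g) \<Rightarrow> 'g set \<Rightarrow> bool" where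
  "cartan sc br H \<longleftrightarrow> toral sc br H \<and> (\<forall>H'. toral sc br H' \<and> H \<subseteq> H' \<longrightarrow> H' = H)"

definition hdual :: "(complex \<Rightarrow> 'g::ab_group_add \<Rightarrow> 'g) \<Rightarrow> 'g set \<Rightarrow> ('g \<Rightarrow> complex) set" where
  "hdual sc H = {\<alpha>. (\<forall>x\<in>H. \<forall>y\<in>H. \<alpha> (x + y) = \<alpha> x + \<alpha> y)
     \<and> (\<forall>c. \<forall>x\<in>H. \<alpha> (sc c x) = c * \<alpha> x) \<and> (\<forall>z. z \<notin> H \<longrightarrow> \<alpha> z = 0)}"

definition root_space :: "('g::ab_group_add \<Rightarrow> 'g \<Rightarrow> 'g) \<Rightarrow> (complex \<Rightarrow> 'g \<Rightarrow> 'g) \<Rightarrow> 'g set \<Rightarrow> ('g \<Rightarrow> complex) \<Rightarrow> 'g set" where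
  "root_space br sc H \<alpha> = {x. \<forall>y\<in>H. br y x = sc (\<alpha> y) x}"

definition roots :: "(complex \<Rightarrow> 'g::ab_group_add \<Rightarrow> 'g) \<Rightarrow> ('g \<Rightarrow> 'g \<Rightarrow> 'g) \<Rightarrow> 'g set \<Rightarrow> ('g \<Rightarrow> complex) set" where
  "roots sc br H = {\<alpha> \<in> hdual sc H. \<alpha> \<noteq> (\<lambda>_. 0) \<and> root_space br sc H \<alpha> \<noteq> {0}}"

definition fneg :: "('g \<Rightarrow> complex) \<Rightarrow> ('g \<Rightarrow> complex)" where
  "fneg \<alpha> = (\<lambda>z. - \<alpha> z)"

definition fadd :: "('g \<Rightarrow> complex) \<Rightarrow> ('g \<Rightarrow> complex) \<Rightarrow> ('g \<Rightarrow> complex)" where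
  "fadd \<alpha> \<beta> = (\<lambda>z. \<alpha> z + \<beta> z)"

text \<open>Positive system (Bourbaki VI.1.7 Prop. 20): a closed subset P of the roots with
 the roots the disjoint union of P and -P.\<close>
definition pos_system :: "(complex \<Rightarrow> 'g::ab_group_add \<Rightarrow> 'g) \<Rightarrow> ('g \<Rightarrow> 'g \<Rightarrow> 'g) \<Rightarrow> 'g set \<Rightarrow> ('g \<Rightarrow> complex) set \<Rightarrow> bool" where
  "pos_system sc br H P \<longleftrightarrow> P \<subseteq> roots sc br H
     \<and> (\<forall>\<alpha>\<in>roots sc br H. (\<alpha> \<in> P) \<noteq> (fneg \<alpha> \<in> P))
     \<and> (\<forall>\<alpha>\<in>P. \<forall>\<beta>\<in>P. fadd \<alpha> \<beta> \<in> roots sc br H \<longrightarrow> fadd \<alpha> \<beta> \<in> P)"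

text \<open>Highest root: the (unique, g simple) maximal positive root.\<close>
definition highest_root :: "(complex \<Rightarrow> 'g::ab_group_add \<Rightarrow> 'g) \<Rightarrow> ('g \<Rightarrow> 'g \<Rightarrow> 'g) \<Rightarrow> 'g set \<Rightarrow> ('g \<Rightarrow> complex) set \<Rightarrow> ('g \<Rightarrow> complex) \<Rightarrow> bool" where
  "highest_root sc br H P \<theta> \<longleftrightarrow> \<theta> \<in> P \<and> (\<forall>\<alpha>\<in>P. fadd \<theta> \<alpha> \<notin> roots sc br H)"

definition coroot :: "(complex \<Rightarrow> 'g::ab_group_add \<Rightarrow> 'g) \<Rightarrow> ('g \<Rightarrow> 'g \<Rightarrow> 'g) \<Rightarrow> 'g set \<Rightarrow> ('g \<Rightarrow> complex) \<Rightarrow> 'g" where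
  "coroot sc br H \<theta> = (THE t. t \<in> H \<and> \<theta> t = 2 \<and>
      (\<exists>x\<in>root_space br sc H \<theta>. \<exists>y\<in>root_space br sc H (fneg \<theta>). t = br x y))"

text \<open>Normalization: the normalized form satisfies (theta|theta) = 2, equivalently
 (h_theta|h_theta) = 2 for the coroot h_theta; since it equals Killing/(2 h^vee),
 h^vee = Killing(h_theta,h_theta)/4.\<close>
definition dual_coxeter :: "(complex \<Rightarrow> 'g::ab_group_add \<Rightarrow> 'g) \<Rightarrow> ('g \<Rightarrow> 'g \<Rightarrow> 'g) \<Rightarrow> 'g set \<Rightarrow> ('g \<Rightarrow> complex) \<Rightarrow> complex" where
  "dual_coxeter sc br H \<theta> = killing sc br (coroot sc br H \<theta>) (coroot sc br H \<theta>) / 4"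

definition nform :: "(complex \<Rightarrow> 'g::ab_group_add \<Rightarrow> 'g) \<Rightarrow> ('g \<Rightarrow> 'g \<Rightarrow> 'g) \<Rightarrow> 'g set \<Rightarrow> ('g \<Rightarrow> complex) \<Rightarrow> 'g \<Rightarrow> 'g \<Rightarrow> complex" where
  "nform sc br H \<theta> x y = killing sc br x y / (2 * dual_coxeter sc br H \<theta>)"

text \<open>Generators of the tensor algebra of g^: Some (x,m) stands for x(m) = x \<otimes> t^m,
 None stands for the central element K.  Elements of the tensor algebra are
 finitely supported functions from words to complex numbers.\<close>

type_synonym 'g gen = "('g \<times> int) option"
type_synonym 'g tens = "'g gen list \<Rightarrow> complex"

definition fin_supp :: "'g tens set" where
  "fin_supp = {f. finite {w. f w \<noteq> 0}}"

definition mono :: "'g gen list \<Rightarrow> 'g tens" where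
  "mono w = (\<lambda>z. if z = w then 1 else 0)"

definition tadd :: "'g tens \<Rightarrow> 'g tens \<Rightarrow> 'g tens" where
  "tadd f g = (\<lambda>z. f z + g z)"

definition tsc :: "complex \<Rightarrow> 'g tens \<Rightarrow> 'g tens" where
  "tsc c f = (\<lambda>z. c * f z)"

definition tsub :: "'g tens \<Rightarrow> 'g tens \<Rightarrow> 'g tens" where
  "tsub f g = (\<lambda>z. f z - g z)"

definition lmul :: "'g gen list \<Rightarrow> 'g tens \<Rightarrow> 'g tens" where
  "lmul u f = (\<lambda>z. if take (length u) z = u then f (drop (length u) z) else 0)"

definition rmul :: "'g tens \<Rightarrow> 'g gen list \<Rightarrow> 'g tens" where
  "rmul f w = (\<lambda>z. if drop (length z - length w) z = w then f (take (length z - length w) z) else 0)"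

text \<open>Defining relations of U(g^): linearity of x |-> x(m), the bracket
 [x(m),y(n)] = [x,y](m+n) + m (x|y) delta_{m+n,0} K, and centrality of K.\<close>
definition uhat_rels :: "(complex \<Rightarrow> 'g::ab_group_add \<Rightarrow> 'g) \<Rightarrow> ('g \<Rightarrow> 'g \<Rightarrow> 'g) \<Rightarrow> ('g \<Rightarrow> 'g \<Rightarrow> complex) \<Rightarrow> 'g tens set" where
  "uhat_rels sc br frm =
     {tsub (tsub (mono [Some (x + y, m)]) (mono [Some (x, m)])) (mono [Some (y, m)]) | x y m. True}
   \<union> {tsub (mono [Some (sc c x, m)]) (tsc c (mono [Some (x, m)])) | c x m. True}
   \<union> {tsub (tsub (tsub (mono [Some (x, m), Some (y, n)]) (mono [Some (y, n), Some (x, m)]))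
             (mono [Some (br x y, m + n)]))
          (tsc (if m + n = 0 then of_int m * frm x y else 0) (mono [None])) | x y m n. True}
   \<union> {tsub (mono [None, a]) (mono [a, None]) | a. True}"

definition vac_gens :: "complex \<Rightarrow> 'g tens set" where
  "vac_gens k = {mono [Some (x, m)] | x m. m \<ge> 0} \<union> {tsub (mono [None]) (tsc k (mono []))}"

text \<open>The left ideal I_Lie + T(g^)(g[t] + C(K - k)) of T(g^); V^k(g) = T(g^)/vac_ideal.\<close>
inductive_set vac_ideal :: "(complex \<Rightarrow> 'g::ab_group_add \<Rightarrow> 'g) \<Rightarrow> ('g \<Rightarrow> 'g \<Rightarrow> 'g) \<Rightarrow> ('g \<Rightarrow> 'g \<Rightarrow> complex) \<Rightarrow> complex \<Rightarrow> 'g tens set"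
  for sc br frm k where
  rel: "r \<in> uhat_rels sc br frm \<Longrightarrow> lmul u (rmul r w) \<in> vac_ideal sc br frm k"
| vac: "j \<in> vac_gens k \<Longrightarrow> lmul u j \<in> vac_ideal sc br frm k"
| zero: "(\<lambda>_. 0) \<in> vac_ideal sc br frm k"
| add: "f \<in> vac_ideal sc br frm k \<Longrightarrow> g \<in> vac_ideal sc br frm k \<Longrightarrow> tadd f g \<in> vac_ideal sc br frm k"
| scal: "f \<in> vac_ideal sc br frm k \<Longrightarrow> tsc c f \<in> vac_ideal sc br frm k"

text \<open>Preimage in T(g^) of C_2(V^k(g)) = t^{-2} g[t^{-1}] V^k(g):
 the span of the ideal and of all x(-n) f with n >= 2.\<close>
inductive_set c2_preimage :: "(complex \<Rightarrow> 'g::ab_group_add \<Rightarrow> 'g) \<Rightarrow> ('g \<Rightarrow> 'g \<Rightarrow> 'g) \<Rightarrow> ('g \<Rightarrow> 'g \<Rightarrow> complex) \<Rightarrow> complex \<Rightarrow> 'g tens set"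
  for sc br frm k where
  base: "f \<in> vac_ideal sc br frm k \<Longrightarrow> f \<in> c2_preimage sc br frm k"
| mode: "n \<ge> 2 \<Longrightarrow> f \<in> fin_supp \<Longrightarrow> lmul [Some (x, - n)] f \<in> c2_preimage sc br frm k"
| add: "f \<in> c2_preimage sc br frm k \<Longrightarrow> g \<in> c2_preimage sc br frm k \<Longrightarrow> tadd f g \<in> c2_preimage sc br frm k"
| scal: "f \<in> c2_preimage sc br frm k \<Longrightarrow> tsc c f \<in> c2_preimage sc br frm k"

end

(*
  Write L for the algebra t^-1 g[t^-1].  The linear functionals on V^k(g) are the functions on words in
  L that are multilinear and compatible with the bracket.  They form a commutative ring under the
  shuffle product, filtered by the number of letters, and current modes act on them from the right.
  Products of the functionals tr(ad a ad w_1 ... ad w_r), restricted to a fixed total weight, span the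
  associated graded ring; this replaces the PBW theorem.

  Let v be singular with image zero in R, let r be the PBW degree of v, and let y be a regular element
  of the Cartan subalgebra H.  Among all vectors in the g-module generated by v choose one whose
  symbol contains the largest power n of the dual variable eta of y(-1).  Applying x(m) with m >= 0
  turns the other letters that pair with [y, x] into y(-1), so by maximality the coefficient of eta^n
  depends only on the H-directions.  On these the Sugawara relation
  (k + h) L_{-1} v = sum_i x_i(-1) x^i(0) v has zero right-hand side, because H is abelian, while the
  translation operator L_{-1} is injective on the variables of weight at least two.  Hence only eta^r
  can occur, and that is a function on R.
*)
theory Submission
  imports Defs "HOL-Computational_Algebra.Fundamental_Theorem_Algebra"
begin

section \<open>Traces and the Jordan decomposition\<close>

text \<open>The vacuum module is given as a quotient of a tensor algebra with no basis at hand, so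
  the degree or symbol of a vector cannot be read off. Dually both are concrete: a vector becomes
  the evaluation \<open>E\<close> on the ring \<open>F\<close>, its degree is the largest r for
  which \<open>E\<close> is nonzero somewhere on \<open>low r\<close> within \<open>F\<close>, and
  its symbol is \<open>E\<close> on products in that degree. Nothing is lost: a linear functional
  separating v from the ideal is itself given by an element of \<open>F\<close>. Of singularity the
  argument keeps x(m) v = 0 for all x and all m >= 1, which is stable under g, because the extremal
  vector is sought in the whole g-module of v. Regularity of y gives g = H + [y, g] with H the
  centralizer of y, so every variable either arises from \<eta> by some z(m) or lies along H. The
  structure theory needed (nondegenerate Killing form, self-centralizing Cartan subalgebra,
  one-dimensional root spaces) rests on one device: conjugating the eigenvalues of ad h turns a
  vanishing trace into a vanishing sum of squares.\<close>

locale fd_space = finite_dimensional_vector_space sc Bs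
  for sc :: "complex \<Rightarrow> 'g::ab_group_add \<Rightarrow> 'g" and Bs :: "'g set"
begin

abbreviation "lin \<equiv> Vector_Spaces.linear sc sc"
abbreviation "tr \<equiv> trace_end sc"

lemma linI:
  assumes "\<And>x y. f (x + y) = f x + f y" "\<And>c x. f (sc c x) = sc c (f x)"
  shows "lin f"
  using assms by (auto simp: Vector_Spaces.linear_iff vector_space_axioms)

lemma lin_add: "lin f \<Longrightarrow> f (x + y) = f x + f y"
  and lin_scale: "lin f \<Longrightarrow> f (sc c x) = sc c (f x)"
  unfolding Vector_Spaces.linear_iff by blast+

lemma lin_0: "lin f \<Longrightarrow> f 0 = 0"
  using lin_scale[of f 0 0] by simp

lemma lin_diff: "lin f \<Longrightarrow> f (x - y) = f x - f y"
  using lin_add[of f "x - y" y] by simp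

lemma lin_sum: "lin f \<Longrightarrow> f (\<Sum>i\<in>A. g i) = (\<Sum>i\<in>A. f (g i))"
  by (induction A rule: infinite_finite_induct) (auto simp: lin_0 lin_add)

lemma lin_comp: "lin f \<Longrightarrow> lin g \<Longrightarrow> lin (\<lambda>x. f (g x))"
  by (auto intro!: linI simp: lin_add lin_scale)

lemma lin_add_fun: "lin f \<Longrightarrow> lin g \<Longrightarrow> lin (\<lambda>x. f x + g x)"
  by (auto intro!: linI simp: lin_add lin_scale scale_right_distrib algebra_simps)

lemma lin_diff_fun: "lin f \<Longrightarrow> lin g \<Longrightarrow> lin (\<lambda>x. f x - g x)"
  by (auto intro!: linI simp: lin_add lin_scale scale_right_diff_distrib algebra_simps)

lemma lin_scale_fun: "lin f \<Longrightarrow> lin (\<lambda>x. sc c (f x))"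
  by (auto intro!: linI simp: lin_add lin_scale scale_right_distrib mult.commute)

lemma lin_self_scale: "lin (sc c)"
  by (auto intro!: linI simp: scale_right_distrib mult.commute)

lemma lin_funpow: "lin f \<Longrightarrow> lin (f ^^ n)"
  by (induction n) (auto intro!: linI simp: lin_add lin_scale)

lemma lin_eqI:
  assumes "lin f" "lin g" "span S = UNIV" "\<And>x. x \<in> S \<Longrightarrow> f x = g x"
  shows "f x = g x"
proof -
  have "x \<in> span S" using assms by simp
  then show ?thesis
    by (induction rule: span_induct_alt) (auto simp: assms lin_0 lin_add lin_scale)
qed

lemma is_basis_iff: "is_basis sc B \<longleftrightarrow> independent B \<and> span B = UNIV"
  using finiteI_independent by (auto simp: is_basis_def)

lemma Bs_basis: "is_basis sc Bs"
  by (simp add: is_basis_iff independent_Basis span_Basis)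

lemma basis_expand:
  assumes "is_basis sc B" shows "(\<Sum>b\<in>B. sc (representation B x b) b) = x"
  using assms sum_representation_eq[of B x B] by (auto simp: is_basis_def)

lemma rep_add: "is_basis sc B \<Longrightarrow> representation B (x + y) b = representation B x b + representation B y b"
  using representation_add[of B y x] by (auto simp: is_basis_iff add.commute)

lemma rep_scale: "is_basis sc B \<Longrightarrow> representation B (sc c x) b = c * representation B x b"
  using representation_scale[of B x c] by (auto simp: is_basis_iff)

lemma rep_sum: "is_basis sc B \<Longrightarrow> representation B (\<Sum>i\<in>A. g i) b = (\<Sum>i\<in>A. representation B (g i) b)"
  using representation_sum[of B A g] by (auto simp: is_basis_iff)

lemma rep_basis: "is_basis sc B \<Longrightarrow> b \<in> B \<Longrightarrow> representation B b c = (if c = b then 1 else 0)"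
  using representation_basis[of B b] by (auto simp: is_basis_iff)

text \<open>Two bases are allowed so that one double sum gives two facts about the trace: with
  \<open>g\<close> the identity it does not depend on the basis, with equal bases it is
  cyclic.\<close>

lemma trace_swap:
  assumes B: "is_basis sc B" and C: "is_basis sc C" and f: "lin f" and g: "lin g"
  shows "(\<Sum>b\<in>B. representation B (f (g b)) b) = (\<Sum>c\<in>C. representation C (g (f c)) c)"
proof -
  have 1: "representation B (f (g b)) b = (\<Sum>c\<in>C. representation C (g b) c * representation B (f c) b)" for b
  proof -
    have "f (g b) = (\<Sum>c\<in>C. sc (representation C (g b) c) (f c))"
      by (subst basis_expand[OF C, symmetric, of "g b"]) (simp add: lin_sum[OF f] lin_scale[OF f])
    then show ?thesis by (simp add: rep_sum[OF B] rep_scale[OF B])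
  qed
  have 2: "representation C (g (f c)) c = (\<Sum>b\<in>B. representation B (f c) b * representation C (g b) c)" for c
  proof -
    have "g (f c) = (\<Sum>b\<in>B. sc (representation B (f c) b) (g b))"
      by (subst basis_expand[OF B, symmetric, of "f c"]) (simp add: lin_sum[OF g] lin_scale[OF g])
    then show ?thesis by (simp add: rep_sum[OF C] rep_scale[OF C])
  qed
  show ?thesis unfolding 1 2 by (subst sum.swap) (simp add: mult.commute)
qed

lemma some_basis: "is_basis sc (SOME B. is_basis sc B)"
  using Bs_basis by (rule someI)

lemma tr_eq:
  assumes "is_basis sc B" "lin f"
  shows "tr f = (\<Sum>b\<in>B. representation B (f b) b)"
  using trace_swap[OF some_basis assms(1) assms(2), of "\<lambda>x. x"]
  by (simp add: trace_end_def Let_def linI)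

lemma tr_comm: "lin f \<Longrightarrow> lin g \<Longrightarrow> tr (\<lambda>x. f (g x)) = tr (\<lambda>x. g (f x))"
  using trace_swap[OF some_basis some_basis] by (simp add: trace_end_def Let_def)

lemma tr_add: "tr (\<lambda>x. f x + g x) = tr f + tr g"
  by (simp add: trace_end_def Let_def rep_add[OF some_basis] sum.distrib)

lemma tr_scale: "tr (\<lambda>x. sc c (f x)) = c * tr f"
  by (simp add: trace_end_def Let_def rep_scale[OF some_basis] sum_distrib_left)

lemma tr_diff: "tr (\<lambda>x. f x - g x) = tr f - tr g"
  using tr_add[of "\<lambda>x. f x - g x" g] by (simp add: algebra_simps)

lemma tr_zero: "tr (\<lambda>x. 0) = 0"
  using tr_add[of "\<lambda>x. 0" "\<lambda>x. 0"] by simp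

text \<open>A basis is built along the flag of kernels of the powers of \<open>N\<close>: each new
  vector is mapped into the span of the preceding part, so every diagonal entry is zero.\<close>

lemma tr_nilpotent:
  assumes N: "lin N" and k: "\<And>x. (N ^^ k) x = 0"
  shows "tr N = 0"
proof -
  have "\<exists>B. independent B \<and> span B = {x. (N ^^ i) x = 0} \<and> (\<forall>b\<in>B. representation B (N b) b = 0)" for i
  proof (induction i)
    case 0
    show ?case by (intro exI[of _ "{}"]) (auto simp: dependent_def)
  next
    case (Suc i)
    then obtain B where B: "independent B" "span B = {x. (N ^^ i) x = 0}"
      "\<And>b. b \<in> B \<Longrightarrow> representation B (N b) b = 0" by blast
    have sub: "subspace {x. (N ^^ i) x = 0}" for i
      using lin_funpow[OF N, of i] by (auto simp: subspace_def lin_0 lin_add lin_scale)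
    have Nker: "N x \<in> span B" if "(N ^^ Suc i) x = 0" for x
      using that B(2) by (simp add: funpow_swap1)
    have "B \<subseteq> {x. (N ^^ Suc i) x = 0}"
      using B(2) span_superset[of B] N by (auto simp: lin_0)
    then obtain C where C: "B \<subseteq> C" "C \<subseteq> {x. (N ^^ Suc i) x = 0}" "independent C"
      "{x. (N ^^ Suc i) x = 0} \<subseteq> span C"
      using maximal_independent_subset_extend[OF _ B(1)] by metis
    have spC: "span C = {x. (N ^^ Suc i) x = 0}"
      using C(2,4) span_minimal[OF C(2) sub] by blast
    have "representation C (N c) c = 0" if "c \<in> C" for c
    proof -
      have "N c \<in> span B" using Nker C(2) that by blast
      then have r: "representation C (N c) = representation B (N c)"
        using representation_extend[OF C(3) _ C(1)] by blast
      show ?thesis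
        using B(3)[of c] r representation_ne_zero[of B "N c" c] by metis
    qed
    then show ?case using C(3) spC by blast
  qed
  from this[of k] obtain B where B: "independent B" "span B = UNIV" "\<And>b. b \<in> B \<Longrightarrow> representation B (N b) b = 0"
    using k by auto
  then have "is_basis sc B" by (simp add: is_basis_iff)
  from tr_eq[OF this N] B(3) show ?thesis by simp
qed

section \<open>Diagonalizable operators and their functional calculus\<close>

definition diagonalizable :: "('g \<Rightarrow> 'g) \<Rightarrow> bool" where
  "diagonalizable f \<longleftrightarrow> span {v. \<exists>c. f v = sc c v} = UNIV"

lemma diag_basis:
  assumes "diagonalizable f"
  obtains B l where "is_basis sc B" "\<And>b. b \<in> B \<Longrightarrow> f b = sc (l b) b"
proof -
  let ?E = "{v. \<exists>c. f v = sc c v}"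
  obtain B where B: "B \<subseteq> ?E" "independent B" "?E \<subseteq> span B"
    by (rule maximal_independent_subset)
  have "span B = UNIV"
    using span_minimal[OF B(3) subspace_span] assms unfolding diagonalizable_def by blast
  moreover have "\<forall>b\<in>B. \<exists>c. f b = sc c b" using B(1) by blast
  then obtain l where "\<And>b. b \<in> B \<Longrightarrow> f b = sc (l b) b" by metis
  ultimately show ?thesis using that B(2) unfolding is_basis_iff by blast
qed

lemma rep_eqI:
  assumes "is_basis sc B" "x = (\<Sum>b\<in>B. sc (c b) b)" "b \<in> B"
  shows "representation B x b = c b"
proof -
  have "finite B" using assms(1) by (simp add: is_basis_def)
  then show ?thesis
    using assms(3) unfolding assms(2)
    by (simp add: rep_sum[OF assms(1)] rep_scale[OF assms(1)] rep_basis[OF assms(1)] sum.delta if_distrib cong: if_cong)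
qed

text \<open>\<open>\<phi>\<close> need not be polynomial; it is used for complex conjugation and for
  the indicator of one eigenvalue. The conclusion covers every eigenvector and not only the
  eigenbasis, because it is applied to brackets of eigenvectors.\<close>

lemma functional_calculus:
  assumes f: "lin f" and d: "diagonalizable f"
  obtains D where "lin D" "\<And>v c. f v = sc c v \<Longrightarrow> D v = sc (\<phi> c) v"
proof -
  obtain B l where B: "is_basis sc B" "\<And>b. b \<in> B \<Longrightarrow> f b = sc (l b) b"
    using diag_basis[OF d] by metis
  define D where "D x = (\<Sum>b\<in>B. sc (representation B x b * \<phi> (l b)) b)" for x
  have "lin D"
    by (rule linI)
       (auto simp: D_def rep_add[OF B(1)] rep_scale[OF B(1)] ring_distribs scale_left_distrib
         sum.distrib scale_sum_right mult.assoc)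
  moreover have "D v = sc (\<phi> c) v" if v: "f v = sc c v" for v c
  proof -
    have 1: "f v = (\<Sum>b\<in>B. sc (representation B v b * l b) b)"
      by (subst basis_expand[OF B(1), symmetric, of v]) (simp add: lin_sum[OF f] lin_scale[OF f] B(2))
    have 2: "f v = (\<Sum>b\<in>B. sc (c * representation B v b) b)"
      by (subst v, subst basis_expand[OF B(1), symmetric, of v]) (simp add: scale_sum_right)
    \<comment> \<open>Both expansions describe \<open>f v\<close>, so a coordinate of
      \<open>v\<close> can be nonzero only at basis vectors with eigenvalue
      \<open>c\<close>.\<close>
    have "representation B v b = 0 \<or> l b = c" if "b \<in> B" for b
      using rep_eqI[OF B(1) 1 that] rep_eqI[OF B(1) 2 that] by auto
    then have "representation B v b * \<phi> (l b) = \<phi> c * representation B v b" if "b \<in> B" for b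
      using that by (cases "representation B v b = 0") (auto simp: mult.commute)
    then have "D v = (\<Sum>b\<in>B. sc (\<phi> c * representation B v b) b)"
      unfolding D_def by (intro sum.cong) auto
    also have "\<dots> = sc (\<phi> c) v"
      by (subst (2) basis_expand[OF B(1), symmetric, of v]) (simp add: scale_sum_right)
    finally show ?thesis .
  qed
  ultimately show ?thesis using that by blast
qed

lemma functional_calculus_commute:
  assumes "diagonalizable f" "lin D" "\<And>v c. f v = sc c v \<Longrightarrow> D v = sc (\<phi> c) v"
    and g: "lin g" "\<And>x. f (g x) = g (f x)"
  shows "D (g x) = g (D x)"
proof (rule lin_eqI[OF lin_comp[OF assms(2) g(1)] lin_comp[OF g(1) assms(2)], where S = "{v. \<exists>c. f v = sc c v}"])
  show "span {v. \<exists>c. f v = sc c v} = UNIV" using assms(1) by (simp add: diagonalizable_def)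
  fix v assume "v \<in> {v. \<exists>c. f v = sc c v}"
  then obtain c where c: "f v = sc c v" by blast
  then have "f (g v) = sc c (g v)" by (simp add: g lin_scale[OF g(1)])
  then show "D (g v) = g (D v)" by (simp add: assms(3)[OF c] assms(3) lin_scale[OF g(1)])
qed

text \<open>The trace of \<open>f\<close> times its complex conjugate is the sum of the \<open>|\<lambda>|\<^sup>2\<close>.\<close>
lemma conj_trace_zero:
  assumes f: "lin f" and d: "diagonalizable f" and D: "lin D" "\<And>v c. f v = sc c v \<Longrightarrow> D v = sc (cnj c) v"
    and 0: "tr (\<lambda>x. f (D x)) = 0"
  shows "f x = 0"
proof -
  obtain B l where B: "is_basis sc B" "\<And>b. b \<in> B \<Longrightarrow> f b = sc (l b) b"
    using diag_basis[OF d] by metis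
  have fin: "finite B" using B(1) by (simp add: is_basis_def)
  have "0 = (\<Sum>b\<in>B. representation B (f (D b)) b)"
    using tr_eq[OF B(1) lin_comp[OF f D(1)]] 0 by simp
  also have "\<dots> = (\<Sum>b\<in>B. l b * cnj (l b))"
    by (rule sum.cong)
      (auto simp: B(2) D(2)[OF B(2)] lin_scale[OF f] rep_scale[OF B(1)] rep_basis[OF B(1)] mult.commute)
  also have "\<dots> = of_real (\<Sum>b\<in>B. (cmod (l b))\<^sup>2)"
    unfolding of_real_sum by (rule sum.cong) (auto simp: complex_norm_square[symmetric])
  finally have "(\<Sum>b\<in>B. (cmod (l b))\<^sup>2) = 0" by (metis of_real_eq_0_iff)
  then have "\<And>b. b \<in> B \<Longrightarrow> l b = 0"
    using fin by (subst (asm) sum_nonneg_eq_0_iff) auto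
  then have "f b = 0" if "b \<in> B" for b using B(2) that by simp
  then show ?thesis
    using lin_eqI[OF f, of "\<lambda>_. 0" B x] B(1) by (auto simp: is_basis_iff linI)
qed

text \<open>A common eigenvector \<open>w\<close> of \<open>S\<close> is the sum of its components
  under the spectral projections of the new operator \<open>f\<close>. These commute with
  \<open>S\<close>, so each component is still a common eigenvector.\<close>

lemma simultaneous_diag:
  assumes "finite S" "\<And>f. f \<in> S \<Longrightarrow> lin f" "\<And>f. f \<in> S \<Longrightarrow> diagonalizable f"
    and "\<And>f g x. f \<in> S \<Longrightarrow> g \<in> S \<Longrightarrow> f (g x) = g (f x)"
  shows "span {v. \<forall>f\<in>S. \<exists>c. f v = sc c v} = UNIV"
  using assms
proof (induction S rule: finite_induct)
  case empty then show ?case by simp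
next
  case (insert f S)
  let ?W = "{v. \<forall>f\<in>S. \<exists>c. f v = sc c v}" and ?W' = "{v. \<forall>f\<in>insert f S. \<exists>c. f v = sc c v}"
  have IH: "span ?W = UNIV" using insert by blast
  have lf: "lin f" and df: "diagonalizable f" using insert.prems by auto
  obtain B l where B: "is_basis sc B" "\<And>b. b \<in> B \<Longrightarrow> f b = sc (l b) b"
    using diag_basis[OF df] by metis
  have fin: "finite B" using B(1) by (simp add: is_basis_def)
  have "w \<in> span ?W'" if w: "w \<in> ?W" for w
  proof -
    have "\<exists>D. lin D \<and> (\<forall>v d. f v = sc d v \<longrightarrow> D v = sc (if d = c then 1 else 0) v)" for c
      by (rule functional_calculus[OF lf df, of "\<lambda>d. if d = c then 1 else 0"]) metis
    then obtain D where D: "\<And>c. lin (D c)" "\<And>c v d. f v = sc d v \<Longrightarrow> D c v = sc (if d = c then 1 else 0) v"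
      by metis
    have "(\<Sum>c\<in>l ` B. D c w) = w"
    proof (rule lin_eqI[where S = B and f = "\<lambda>w. \<Sum>c\<in>l ` B. D c w" and g = "\<lambda>x. x" and x = w])
      show "lin (\<lambda>w. \<Sum>c\<in>l ` B. D c w)"
        by (auto intro!: linI simp: lin_add[OF D(1)] lin_scale[OF D(1)] sum.distrib scale_sum_right)
      show "lin (\<lambda>x. x)" by (simp add: linI)
      show "span B = UNIV" using B(1) by (simp add: is_basis_iff)
      fix b assume b: "b \<in> B"
      have "(\<Sum>c\<in>l ` B. D c b) = (\<Sum>c\<in>l ` B. if c = l b then b else 0)"
        by (rule sum.cong) (auto simp: D(2)[OF B(2)[OF b]])
      also have "\<dots> = b" using fin b by (simp add: sum.delta)
      finally show "(\<Sum>c\<in>l ` B. D c b) = b" .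
    qed
    moreover have "D c w \<in> ?W'" for c
    proof -
      have "f (D c w) = sc c (D c w)"
      proof (rule lin_eqI[where S = B and f = "\<lambda>w. f (D c w)" and g = "\<lambda>w. sc c (D c w)" and x = w])
        show "lin (\<lambda>w. f (D c w))" "lin (\<lambda>w. sc c (D c w))"
          using lf D(1) by (auto intro: lin_comp lin_scale_fun)
        show "span B = UNIV" using B(1) by (simp add: is_basis_iff)
        fix b assume b: "b \<in> B"
        show "f (D c b) = sc c (D c b)"
          using D(2)[OF B(2)[OF b], of c] by (auto simp: lin_scale[OF lf] lin_0[OF lf] B(2)[OF b])
      qed
      moreover have "\<exists>d. g (D c w) = sc d (D c w)" if g: "g \<in> S" for g
      proof -
        obtain d where "g w = sc d w" using w g by blast
        then have "g (D c w) = sc d (D c w)"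
          using functional_calculus_commute[OF df D(1), where g = g and x = w and \<phi> = "\<lambda>d. if d = c then 1 else 0", OF D(2)]
            insert.prems(1)[of g] insert.prems(3)[of f g] g
          by (simp add: lin_scale[OF D(1)])
        then show ?thesis ..
      qed
      ultimately show ?thesis by auto
    qed
    ultimately show ?thesis by (metis (no_types, lifting) span_base span_sum)
  qed
  then have "span ?W \<subseteq> span ?W'" by (intro span_minimal) auto
  then show ?case using IH by auto
qed

section \<open>Generalized eigenspaces and the semisimple part of an operator\<close>

definition gen_eig :: "('g \<Rightarrow> 'g) \<Rightarrow> complex \<Rightarrow> 'g set" where
  "gen_eig T c = {v. \<exists>n. ((\<lambda>z. T z - sc c z) ^^ n) v = 0}"

lemma lin_shift: "lin T \<Longrightarrow> lin (\<lambda>z. T z - sc c z)"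
  by (rule lin_diff_fun) (auto intro: lin_self_scale)

lemma gen_eig_mono:
  assumes "lin T" "((\<lambda>z. T z - sc c z) ^^ n) v = 0" "n \<le> m"
  shows "((\<lambda>z. T z - sc c z) ^^ m) v = 0"
  using assms(2) lin_0[OF lin_funpow[OF lin_shift[OF assms(1)]]]
  by (metis (no_types, lifting) assms(3) funpow_add le_add_diff_inverse2 o_apply)

lemma gen_eig_subspace: "lin T \<Longrightarrow> subspace (gen_eig T c)"
proof -
  assume T: "lin T"
  note L = lin_funpow[OF lin_shift[OF T]]
  show ?thesis
    unfolding subspace_def
  proof (intro conjI ballI allI)
    show "0 \<in> gen_eig T c" unfolding gen_eig_def by (auto intro!: exI[of _ 0])
    fix x y assume "x \<in> gen_eig T c" "y \<in> gen_eig T c"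
    then obtain n m where "((\<lambda>z. T z - sc c z) ^^ n) x = 0" "((\<lambda>z. T z - sc c z) ^^ m) y = 0"
      unfolding gen_eig_def by blast
    then have "((\<lambda>z. T z - sc c z) ^^ (max n m)) (x + y) = 0"
      using gen_eig_mono[OF T] by (simp add: lin_add[OF L])
    then show "x + y \<in> gen_eig T c" unfolding gen_eig_def by blast
  next
    fix a x assume "x \<in> gen_eig T c"
    then obtain n where "((\<lambda>z. T z - sc c z) ^^ n) x = 0" unfolding gen_eig_def by blast
    then have "((\<lambda>z. T z - sc c z) ^^ n) (sc a x) = 0" by (simp add: lin_scale[OF L])
    then show "sc a x \<in> gen_eig T c" unfolding gen_eig_def by blast
  qed
qed

lemma gen_eig_invariant:
  assumes T: "lin T" and g: "lin g" "\<And>x. g (T x) = T (g x)" and v: "v \<in> gen_eig T c"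
  shows "g v \<in> gen_eig T c"
proof -
  obtain n where n: "((\<lambda>z. T z - sc c z) ^^ n) v = 0" using v unfolding gen_eig_def by blast
  have "((\<lambda>z. T z - sc c z) ^^ n) (g v) = g (((\<lambda>z. T z - sc c z) ^^ n) v)"
    by (induction n) (auto simp: g lin_diff[OF g(1)] lin_scale[OF g(1)])
  then show ?thesis using n lin_0[OF g(1)] unfolding gen_eig_def by auto
qed

text \<open>On this space \<open>T - c\<close> is the nonzero scalar \<open>a - c\<close> plus a
  nilpotent operator; the induction on the nilpotency exponent unrolls the geometric series of its
  inverse.\<close>

lemma gen_eig_surj:
  assumes T: "lin T" and "a \<noteq> c" and "w \<in> gen_eig T a"
  obtains u where "u \<in> gen_eig T a" "T u - sc c u = w"
proof -
  have "\<exists>u. u \<in> gen_eig T a \<and> T u - sc c u = w" if "((\<lambda>z. T z - sc a z) ^^ n) w = 0" for n w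
    using that
  proof (induction n arbitrary: w)
    case 0
    then show ?case using gen_eig_subspace[OF T, of a] lin_0[OF T]
      by (intro exI[of _ 0]) (auto simp: subspace_0)
  next
    case (Suc n)
    then have "((\<lambda>z. T z - sc a z) ^^ n) (T w - sc a w) = 0"
      using funpow_swap1[of "\<lambda>z. T z - sc a z" n w] by simp
    then obtain u where u: "u \<in> gen_eig T a" "T u - sc c u = T w - sc a w"
      using Suc.IH by blast
    have w: "w \<in> gen_eig T a" using Suc.prems unfolding gen_eig_def by blast
    \<comment> \<open>By the choice of \<open>u\<close>, the operator \<open>T - c\<close> maps
      \<open>w - u\<close> to \<open>(a - c) w\<close>.\<close>
    define u' where "u' = sc (1 / (a - c)) (w - u)"
    have "T u' - sc c u' = sc (1 / (a - c)) ((T w - sc c w) - (T u - sc c u))"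
      by (simp add: u'_def lin_scale[OF T] lin_diff[OF T] scale_right_diff_distrib mult.commute)
    also have "\<dots> = sc (1 / (a - c)) (sc (a - c) w)"
      by (simp add: u(2) scale_left_diff_distrib)
    also have "\<dots> = w" using assms(2) by simp
    finally have "T u' - sc c u' = w" .
    moreover have "u' \<in> gen_eig T a"
      unfolding u'_def using u(1) w gen_eig_subspace[OF T, of a] by (simp add: subspace_diff subspace_scale)
    ultimately show ?case by blast
  qed
  then show ?thesis using assms(3) that unfolding gen_eig_def by blast
qed

text \<open>An eigenvector for \<open>c\<close> in this space would be multiplied by
  \<open>c - a\<close> under \<open>T - a\<close>, which is nilpotent on it; powers of
  \<open>T - c\<close> follow one factor at a time.\<close>

lemma gen_eig_inj:
  assumes T: "lin T" and "a \<noteq> c" and v: "v \<in> gen_eig T a" and n: "((\<lambda>z. T z - sc c z) ^^ n) v = 0"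
  shows "v = 0"
proof -
  have 1: "v = 0" if v: "v \<in> gen_eig T a" and z: "T v - sc c v = 0" for v
  proof -
    have "((\<lambda>z. T z - sc a z) ^^ n) v = sc ((c - a) ^ n) v" for n
    proof (induction n)
      case (Suc n)
      then show ?case using z
        by (simp add: lin_scale[OF T] scale_left_diff_distrib left_diff_distrib)
    qed simp
    then show ?thesis using v assms(2) unfolding gen_eig_def by auto
  qed
  show ?thesis using n
  proof (induction n)
    case (Suc n)
    let ?w = "((\<lambda>z. T z - sc c z) ^^ n) v"
    have "?w \<in> gen_eig T a"
    proof (induction n)
      case (Suc n)
      show ?case
        using gen_eig_invariant[OF T lin_shift[OF T, of c] _ Suc] by (simp add: lin_diff[OF T] lin_scale[OF T])
    qed (simp add: v)
    then have "?w = 0" using 1 Suc.prems by simp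
    then show ?case using Suc.IH by simp
  qed simp
qed

text \<open>A power of \<open>T - a\<close> removes the component at \<open>a\<close> and is
  injective on the others, so induction on the number of eigenvalues applies.\<close>

lemma gen_eig_independent:
  assumes T: "lin T" and "finite A" "\<And>c. c \<in> A \<Longrightarrow> u c \<in> gen_eig T c" "(\<Sum>c\<in>A. u c) = 0" "c \<in> A"
  shows "u c = 0"
  using assms(2-)
proof (induction A arbitrary: u c rule: finite_induct)
  case (insert a A)
  obtain n where n: "((\<lambda>z. T z - sc a z) ^^ n) (u a) = 0"
    using insert.prems(1)[of a] unfolding gen_eig_def by blast
  define P where "P = (\<lambda>z. T z - sc a z) ^^ n"
  have P: "lin P" unfolding P_def by (rule lin_funpow[OF lin_shift[OF T]])
  have PT: "P (T x) = T (P x)" for x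
    unfolding P_def by (induction n) (auto simp: lin_diff[OF T] lin_scale[OF T])
  have "P (u a + (\<Sum>c\<in>A. u c)) = 0"
    using insert.prems(2) insert.hyps lin_0[OF P] by simp
  then have s: "(\<Sum>c\<in>A. P (u c)) = 0"
    using n by (simp add: lin_add[OF P] lin_sum[OF P] P_def[symmetric])
  have "P (u c) = 0" if "c \<in> A" for c
    using insert.IH[OF _ s that] gen_eig_invariant[OF T P PT] insert.prems(1) by blast
  then have 0: "u c = 0" if "c \<in> A" for c
    using gen_eig_inj[OF T _ insert.prems(1), of c a n] that insert.hyps(2) unfolding P_def by blast
  then have "u a = 0" using insert.prems(2) insert.hyps by simp
  then show ?case using 0 insert.prems(3) by auto
qed simp

text \<open>Induction on the degree of a polynomial annihilating \<open>v\<close>. For a root c of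
  it, \<open>w = T v - c v\<close> is annihilated by the quotient, hence lies in the span; solving
  (T - c) u = w up to a remainder in the generalized eigenspace of c leaves \<open>v - u\<close> in
  that eigenspace.\<close>

lemma gen_eig_span:
  assumes T: "lin T"
  shows "span (\<Union>c. gen_eig T c) = UNIV"
proof -
  let ?G = "\<Union>c. gen_eig T c"
  define ev where "ev p v = (\<Sum>i\<le>degree p. sc (coeff p i) ((T ^^ i) v))" for p v
  have evn: "ev p v = (\<Sum>i\<le>n. sc (coeff p i) ((T ^^ i) v))" if "degree p \<le> n" for p v n
    unfolding ev_def by (rule sum.mono_neutral_left) (use that in \<open>auto simp: coeff_eq_0\<close>)
  have main: "v \<in> span ?G" if "p \<noteq> 0" "ev p v = 0" for p v
    using that
  proof (induction "degree p" arbitrary: p v)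
    case 0
    then obtain a where "p = [:a:]" "a \<noteq> 0" by (metis degree_eq_zeroE pCons_0_0)
    then have "v = 0" using 0 by (simp add: ev_def)
    then show ?case by (simp add: span_zero)
  next
    case (Suc d)
    have "\<not> constant (poly p)" using Suc.hyps(2) constant_degree by (metis nat.distinct(1))
    then obtain c where "poly p c = 0" using fundamental_theorem_of_algebra by blast
    then obtain q where q: "p = [:- c, 1:] * q" by (auto simp: poly_eq_0_iff_dvd dvd_def)
    have q0: "q \<noteq> 0" using q Suc.prems by auto
    have dq: "degree q = d" using q q0 Suc.hyps(2) degree_mult_eq[of "[:- c, 1:]" q] by simp
    define w where "w = T v - sc c v"
    have "ev p v = (\<Sum>i\<le>Suc d. sc (coeff p i) ((T ^^ i) v))" using evn Suc.hyps(2) by simp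
    also have "\<dots> = (\<Sum>i\<le>Suc d. sc (coeff (pCons 0 q) i) ((T ^^ i) v)) - (\<Sum>i\<le>Suc d. sc (c * coeff q i) ((T ^^ i) v))"
      by (simp add: q sum_subtractf[symmetric] scale_left_diff_distrib[symmetric] del: sum.atMost_Suc)
    also have "(\<Sum>i\<le>Suc d. sc (coeff (pCons 0 q) i) ((T ^^ i) v)) = (\<Sum>i\<le>d. sc (coeff q i) ((T ^^ i) (T v)))"
      by (subst sum.atMost_Suc_shift) (simp add: funpow_swap1)
    also have "(\<Sum>i\<le>Suc d. sc (c * coeff q i) ((T ^^ i) v)) = (\<Sum>i\<le>d. sc (coeff q i) ((T ^^ i) (sc c v)))"
      using dq by (simp add: coeff_eq_0 lin_scale[OF lin_funpow[OF T]] mult.commute)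
    also have "(\<Sum>i\<le>d. sc (coeff q i) ((T ^^ i) (T v))) - (\<Sum>i\<le>d. sc (coeff q i) ((T ^^ i) (sc c v))) = ev q w"
      unfolding w_def ev_def dq
      by (simp only: lin_diff[OF lin_funpow[OF T]] scale_right_diff_distrib sum_subtractf)
    finally have "ev q w = 0" using Suc.prems by simp
    then have "w \<in> span ?G" using Suc.hyps(1)[of q w] dq q0 by simp
    moreover have "x \<in> span ?G \<Longrightarrow> \<exists>u y. u \<in> span ?G \<and> y \<in> gen_eig T c \<and> T u - sc c u = x - y" for x
    proof (induction rule: span_induct_alt)
      case base
      show ?case using gen_eig_subspace[OF T, of c]
        by (intro exI[of _ 0]) (auto simp: span_zero lin_0[OF T] subspace_0)
    next
      case (step k x y)
      then obtain u1 y1 where 1: "u1 \<in> span ?G" "y1 \<in> gen_eig T c" "T u1 - sc c u1 = y - y1" by blast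
      obtain a where a: "x \<in> gen_eig T a" using step by blast
      obtain u2 y2 where 2: "u2 \<in> span ?G" "y2 \<in> gen_eig T c" "T u2 - sc c u2 = x - y2"
      proof (cases "a = c")
        case True
        then show ?thesis using that[of 0 x] a by (simp add: span_zero lin_0[OF T])
      next
        case False
        then obtain u where "u \<in> gen_eig T a" "T u - sc c u = x" using gen_eig_surj[OF T _ a] by metis
        then show ?thesis using that[of u 0] gen_eig_subspace[OF T, of c] by (auto intro: span_base simp: subspace_0)
      qed
      let ?u = "sc k u2 + u1" and ?y = "sc k y2 + y1"
      have "T ?u - sc c ?u = sc k (T u2 - sc c u2) + (T u1 - sc c u1)"
        by (simp add: lin_add[OF T] lin_scale[OF T] scale_right_distrib scale_right_diff_distrib mult.commute)
      also have "\<dots> = sc k x + y - ?y" by (simp add: 1 2 scale_right_diff_distrib)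
      finally have "T ?u - sc c ?u = sc k x + y - ?y" .
      moreover have "?u \<in> span ?G" using 1 2 by (simp add: span_add span_scale)
      moreover have "?y \<in> gen_eig T c"
        using 1 2 gen_eig_subspace[OF T, of c] by (simp add: subspace_add subspace_scale)
      ultimately show ?case by blast
    qed
    ultimately obtain u y where u: "u \<in> span ?G" "y \<in> gen_eig T c" "T u - sc c u = w - y" by blast
    have "y = T (v - u) - sc c (v - u)"
      using u(3) by (simp add: w_def lin_diff[OF T] scale_right_diff_distrib algebra_simps)
    moreover obtain n where "((\<lambda>z. T z - sc c z) ^^ n) y = 0" using u(2) unfolding gen_eig_def by blast
    ultimately have "((\<lambda>z. T z - sc c z) ^^ Suc n) (v - u) = 0"
      unfolding funpow_Suc_right o_def by simp
    then have "v - u \<in> gen_eig T c" unfolding gen_eig_def by blast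
    then have "v - u \<in> span ?G" by (auto intro: span_base)
    then show ?case using u(1) span_add[of "v - u" ?G u] by simp
  qed
  have "v \<in> span ?G" for v
  proof -
    let ?S = "\<lambda>i. (T ^^ i) v"
    \<comment> \<open>Among the first \<open>dimension + 1\<close> iterates of \<open>v\<close>
      either two coincide or they form a dependent set; the first case is separate because
      coinciding vectors collapse in the image set.\<close>
    obtain p where "p \<noteq> 0" "ev p v = 0"
    proof (cases "inj_on ?S {..dimension}")
      case False
      then obtain i j where ij: "(T ^^ i) v = (T ^^ j) v" "i < j"
        unfolding inj_on_def by (metis linorder_neqE_nat)
      let ?p = "monom 1 j - monom 1 i :: complex poly"
      have c: "coeff ?p j = 1" using ij by simp
      have "degree ?p \<le> j"
        by (rule degree_le) (use ij in auto)
      then have "ev ?p v = (\<Sum>n\<le>j. sc (coeff ?p n) ((T ^^ n) v))" by (rule evn)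
      also have "\<dots> = (\<Sum>n\<le>j. (if n = j then (T ^^ n) v else 0) - (if n = i then (T ^^ n) v else 0))"
        by (rule sum.cong) (use ij in \<open>auto simp: scale_minus_left\<close>)
      also have "\<dots> = 0" using ij by (simp add: sum_subtractf sum.delta)
      finally show ?thesis using that[of ?p] c by (metis coeff_0 zero_neq_one)
    next
      case True
      have "dependent (?S ` {..dimension})"
        using independent_card_le_dim[of "?S ` {..dimension}" UNIV] card_image[OF True] dim_subset_UNIV[of UNIV] by auto
      then obtain u where u: "(\<Sum>x\<in>?S ` {..dimension}. sc (u x) x) = 0" "\<exists>x\<in>?S ` {..dimension}. u x \<noteq> 0"
        using dependent_finite[of "?S ` {..dimension}"] by auto
      define p where "p = (\<Sum>i\<le>dimension. monom (u (?S i)) i)"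
      have cp: "coeff p i = (if i \<le> dimension then u (?S i) else 0)" for i
        by (simp add: p_def coeff_sum if_distrib sum.delta cong: if_cong)
      have "degree p \<le> dimension" by (rule degree_le) (simp add: cp)
      then have "ev p v = (\<Sum>i\<le>dimension. sc (u (?S i)) (?S i))" by (simp add: evn cp)
      also have "\<dots> = 0" using u(1) True by (simp add: sum.reindex)
      finally have "ev p v = 0" .
      moreover have "p \<noteq> 0" using u(2) cp by (metis (no_types, lifting) atMost_iff coeff_0 imageE)
      ultimately show ?thesis using that by blast
    qed
    then show ?thesis by (rule main)
  qed
  then show ?thesis by blast
qed

text \<open>That \<open>D\<close> is a scalar on whole generalized eigenspaces, and not just on the
  basis used to build it, is what later makes it a derivation.\<close>

lemma jordan_chevalley:
  assumes T: "lin T"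
  obtains D k where "lin D" "diagonalizable D" "\<And>c v. v \<in> gen_eig T c \<Longrightarrow> D v = sc c v"
    "\<And>x. ((\<lambda>z. T z - D z) ^^ k) x = 0"
proof -
  obtain B where B: "B \<subseteq> (\<Union>c. gen_eig T c)" "independent B" "(\<Union>c. gen_eig T c) \<subseteq> span B"
    by (rule maximal_independent_subset)
  have "span B = UNIV"
    using span_minimal[OF B(3) subspace_span] gen_eig_span[OF T] by blast
  then have bas: "is_basis sc B" using B(2) unfolding is_basis_iff by blast
  have fin: "finite B" using bas by (simp add: is_basis_def)
  have "\<forall>b\<in>B. \<exists>c. b \<in> gen_eig T c" using B(1) by blast
  then obtain l where l: "\<And>b. b \<in> B \<Longrightarrow> b \<in> gen_eig T (l b)" by metis
  define D where "D x = (\<Sum>b\<in>B. sc (representation B x b * l b) b)" for x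
  have linD: "lin D"
    by (rule linI)
       (auto simp: D_def rep_add[OF bas] rep_scale[OF bas] ring_distribs scale_left_distrib
         sum.distrib scale_sum_right mult.assoc)
  have D: "D v = sc c v" if v: "v \<in> gen_eig T c" for v c
  proof -
    define u where "u a = (\<Sum>b\<in>{b\<in>B. l b = a}. sc (representation B v b) b)" for a
    \<comment> \<open>\<open>c\<close> is inserted since it need not be an eigenvalue.
      \<open>u a\<close> is the part of \<open>v\<close> along basis vectors with eigenvalue
      \<open>a\<close>; directness of the sum leaves only \<open>u c\<close>.\<close>
    let ?A = "insert c (l ` B)"
    have su: "(\<Sum>a\<in>?A. f a (u a)) = (\<Sum>b\<in>B. f (l b) (sc (representation B v b) b))"
      if "\<And>a. lin (f a)" for f
    proof -
      have "(\<Sum>a\<in>?A. f a (u a)) = (\<Sum>a\<in>?A. \<Sum>b\<in>{b\<in>B. l b = a}. f (l b) (sc (representation B v b) b))"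
        unfolding u_def lin_sum[OF that] by (intro sum.cong) auto
      also have "\<dots> = (\<Sum>b\<in>B. f (l b) (sc (representation B v b) b))"
        using fin by (intro sum.group) auto
      finally show ?thesis .
    qed
    have "(\<Sum>a\<in>?A. u a) = v"
      using su[of "\<lambda>_ x. x"] basis_expand[OF bas, of v] by (simp add: linI)
    then have 0: "(\<Sum>a\<in>?A. u a - (if a = c then v else 0)) = 0"
      using fin by (simp add: sum_subtractf sum.delta)
    have "u a \<in> gen_eig T a" for a
      unfolding u_def using l gen_eig_subspace[OF T, of a]
      by (intro subspace_sum subspace_scale) auto
    then have w: "u a - (if a = c then v else 0) \<in> gen_eig T a" for a
      using v gen_eig_subspace[OF T, of a] by (auto intro: subspace_diff)
    have ua: "u a = (if a = c then v else 0)" if "a \<in> ?A" for a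
    proof -
      have "u a - (if a = c then v else 0) = 0"
        by (rule gen_eig_independent[where u = "\<lambda>a. u a - (if a = c then v else 0)" and A = ?A, OF T _ _ 0 that])
          (use fin w in auto)
      then show ?thesis by simp
    qed
    have "D v = (\<Sum>b\<in>B. sc (l b) (sc (representation B v b) b))"
      by (simp add: D_def mult.commute)
    also have "\<dots> = (\<Sum>a\<in>?A. sc a (u a))" by (rule su[symmetric]) (rule lin_self_scale)
    also have "\<dots> = (\<Sum>a\<in>?A. if a = c then sc c v else 0)" by (rule sum.cong) (auto simp: ua)
    also have "\<dots> = sc c v" using fin by (simp add: sum.delta)
    finally show ?thesis .
  qed
  have TD: "lin (\<lambda>z. T z - D z)" by (rule lin_diff_fun[OF T linD])
  have dia: "diagonalizable D"
  proof -
    have "(\<Union>c. gen_eig T c) \<subseteq> {v. \<exists>c. D v = sc c v}" using D by blast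
    from span_mono[OF this] show ?thesis using gen_eig_span[OF T] unfolding diagonalizable_def by blast
  qed
  have "\<exists>n. ((\<lambda>z. T z - D z) ^^ n) b = 0" if "b \<in> B" for b
  proof -
    have lb: "b \<in> gen_eig T (l b)" using l that .
    then obtain n where n: "((\<lambda>z. T z - sc (l b) z) ^^ n) b = 0" unfolding gen_eig_def by blast
    \<comment> \<open>Starting from \<open>b\<close> the iterates stay in one generalized
      eigenspace, where \<open>D\<close> is multiplication by \<open>l b\<close>.\<close>
    have "((\<lambda>z. T z - D z) ^^ m) b = ((\<lambda>z. T z - sc (l b) z) ^^ m) b \<and>
      ((\<lambda>z. T z - sc (l b) z) ^^ m) b \<in> gen_eig T (l b)" for m
    proof (induction m)
      case (Suc m)
      have "((\<lambda>z. T z - sc (l b) z) ^^ Suc m) b \<in> gen_eig T (l b)"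
        using gen_eig_invariant[OF T lin_shift[OF T, of "l b"] _ conjunct2[OF Suc]]
        by (simp add: lin_diff[OF T] lin_scale[OF T])
      then show ?case using Suc D by auto
    qed (use lb in auto)
    then show ?thesis using n by metis
  qed
  then obtain n where n: "\<And>b. b \<in> B \<Longrightarrow> ((\<lambda>z. T z - D z) ^^ n b) b = 0" by metis
  define k where "k = Max (n ` B)"
  have "((\<lambda>z. T z - D z) ^^ k) x = 0" for x
  proof (rule lin_eqI[where f = "(\<lambda>z. T z - D z) ^^ k" and g = "\<lambda>_. 0" and S = B and x = x])
    fix b assume b: "b \<in> B"
    have "n b \<le> k" unfolding k_def using fin b by simp
    then have "((\<lambda>z. T z - D z) ^^ k) b = ((\<lambda>z. T z - D z) ^^ (k - n b)) (((\<lambda>z. T z - D z) ^^ n b) b)"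
      by (metis funpow_add le_add_diff_inverse2 o_apply)
    then show "((\<lambda>z. T z - D z) ^^ k) b = 0" using n[OF b] lin_0[OF lin_funpow[OF TD]] by simp
  qed (use bas in \<open>auto simp: is_basis_iff linI intro: lin_funpow[OF TD]\<close>)
  then show ?thesis using that linD dia D by blast
qed

lemma tr_nilpotent_commute:
  assumes N: "lin N" and g: "lin g" "\<And>x. N (g x) = g (N x)" and k: "\<And>x. (N ^^ k) x = 0"
  shows "tr (\<lambda>x. N (g x)) = 0"
proof (rule tr_nilpotent[OF lin_comp[OF N g(1)]])
  have c: "(N ^^ n) (g x) = g ((N ^^ n) x)" for n x
    by (induction n) (simp_all add: g(2))
  have c': "N ((g ^^ n) x) = (g ^^ n) (N x)" for n x
    by (induction n) (simp_all add: g(2))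
  have "((\<lambda>x. N (g x)) ^^ n) x = (g ^^ n) ((N ^^ n) x)" for n x
    by (induction n) (simp_all add: c' g(2))
  then show "((\<lambda>x. N (g x)) ^^ k) x = 0" for x
    using k lin_0[OF lin_funpow[OF g(1)]] by simp
qed

end

section \<open>Lie algebras with nondegenerate Killing form\<close>

text \<open>\<open>lie_algebra\<close> asks for linearity in the first argument only, so
  antisymmetry is a separate assumption; for the algebra of the theorem
  \<open>c2_imp_antisymmetric\<close> supplies it.\<close>

locale fd_lie = fd_space sc Bs
  for sc :: "complex \<Rightarrow> 'g::ab_group_add \<Rightarrow> 'g" and Bs :: "'g set" +
  fixes br :: "'g \<Rightarrow> 'g \<Rightarrow> 'g"
  assumes lie: "lie_algebra sc br" and br_anti: "br x y = - br y x"
begin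

lemma br_add_left: "br (x + y) z = br x z + br y z"
  and br_scale_left: "br (sc c x) z = sc c (br x z)"
  and br_self [simp]: "br x x = 0"
  and jacobi: "br x (br y z) + br y (br z x) + br z (br x y) = 0"
  using lie unfolding lie_algebra_def by blast+

lemma br_add_right: "br z (x + y) = br z x + br z y"
  using br_add_left[of x y z] br_anti[of z] by simp

lemma br_scale_right: "br z (sc c x) = sc c (br z x)"
  using br_scale_left[of c x z] br_anti[of z] by simp

lemma lin_br: "lin (br x)"
  by (rule linI) (simp_all add: br_add_right br_scale_right)

lemma lin_br_left: "lin (\<lambda>x. br x y)"
  by (rule linI) (simp_all add: br_add_left br_scale_left)

lemmas br_0_right [simp] = lin_0[OF lin_br]
lemmas br_0_left [simp] = lin_0[OF lin_br_left]
lemmas br_diff_right = lin_diff[OF lin_br]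
lemmas br_diff_left = lin_diff[OF lin_br_left]

lemma br_minus_right: "br y (- x) = - br y x"
  using br_diff_right[of y 0 x] by simp

lemma ad_br: "br (br x y) z = br x (br y z) - br y (br x z)"
proof -
  have "br z (br x y) = - br (br x y) z" "br y (br z x) = - br y (br x z)"
    using br_anti[of z "br x y"] br_anti[of z x] by (simp_all add: br_minus_right)
  then have "br x (br y z) - br y (br x z) - br (br x y) z = 0" using jacobi[of x y z] by simp
  then show ?thesis by simp
qed

lemma br_commute_if: "br x y = 0 \<Longrightarrow> br y x = 0"
  using br_anti[of y x] by simp

lemma ad_commute: "br x y = 0 \<Longrightarrow> br x (br y z) = br y (br x z)"
  using ad_br[of x y z] by simp

abbreviation "kap \<equiv> killing sc br"

lemma kap_def: "kap x y = tr (\<lambda>z. br x (br y z))"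
  by (simp add: killing_def)

lemma kap_add_left: "kap (x + y) z = kap x z + kap y z"
  by (simp add: kap_def br_add_left tr_add)

lemma kap_scale_left: "kap (sc c x) z = c * kap x z"
  by (simp add: kap_def br_scale_left tr_scale)

lemma kap_comm: "kap x y = kap y x"
  unfolding kap_def by (rule tr_comm[OF lin_br lin_br])

lemma kap_add_right: "kap z (x + y) = kap z x + kap z y"
  by (metis kap_comm kap_add_left)

lemma kap_scale_right: "kap z (sc c x) = c * kap z x"
  by (metis kap_comm kap_scale_left)

lemma kap_0_left [simp]: "kap 0 x = 0"
  using kap_scale_left[of 0 0 x] by simp

lemma kap_0_right [simp]: "kap x 0 = 0"
  using kap_scale_right[of x 0 0] by simp

lemma kap_diff_left: "kap (x - y) z = kap x z - kap y z"
  using kap_add_left[of "x - y" y z] by simp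

lemma kap_diff_right: "kap z (x - y) = kap z x - kap z y"
  using kap_add_right[of z "x - y" y] by simp

lemma kap_minus_left: "kap (- x) z = - kap x z"
  using kap_diff_left[of 0 x z] by simp

lemma kap_sum_right: "kap z (\<Sum>i\<in>A. f i) = (\<Sum>i\<in>A. kap z (f i))"
  by (induction A rule: infinite_finite_induct) (auto simp: kap_add_right)

lemma kap_invariant: "kap (br x y) z = kap x (br y z)"
proof -
  have "tr (\<lambda>w. br y (br x (br z w))) = tr (\<lambda>w. br x (br z (br y w)))"
    using tr_comm[OF lin_br[of y] lin_comp[OF lin_br[of x] lin_br[of z]]] by simp
  then show ?thesis by (simp add: kap_def ad_br br_diff_right tr_diff)
qed

lemma span_eqI_subspace: "subspace A \<Longrightarrow> S \<subseteq> A \<Longrightarrow> span S = UNIV \<Longrightarrow> x \<in> A"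
  using span_minimal[of S A] by auto

lemma derivation_extend:
  assumes D: "lin D" and S: "span S = UNIV"
    and d: "\<And>u v. u \<in> S \<Longrightarrow> v \<in> S \<Longrightarrow> D (br u v) = br (D u) v + br u (D v)"
  shows "D (br u v) = br (D u) v + br u (D v)"
proof -
  have 1: "D (br u v) = br (D u) v + br u (D v)" if "u \<in> S" for u v
    by (rule lin_eqI[where f = "\<lambda>v. D (br u v)" and g = "\<lambda>v. br (D u) v + br u (D v)", OF _ _ S d[OF that]])
      (auto intro: lin_comp[OF D lin_br] lin_add_fun lin_br lin_comp[OF lin_br D])
  show ?thesis
    by (rule lin_eqI[where f = "\<lambda>u. D (br u v)" and g = "\<lambda>u. br (D u) v + br u (D v)", OF _ _ S 1])
      (auto intro: lin_comp[OF D lin_br_left] lin_add_fun lin_br_left lin_comp[OF lin_br_left D])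
qed

text \<open>The complex conjugate of a diagonalizable \<open>ad h\<close> is again a derivation, so its trace
  against commutators reduces to the Killing form.\<close>
lemma killing_zero_diagonalizable:
  assumes kap0: "\<And>x y. kap x y = 0" and perf: "span {br a b | a b. True} = UNIV"
    and h: "diagonalizable (br h)"
  shows "br h x = 0"
proof -
  obtain D where D: "lin D" "\<And>v c. br h v = sc c v \<Longrightarrow> D v = sc (cnj c) v"
    using functional_calculus[OF lin_br h, where \<phi> = cnj] by metis
  have der: "D (br u v) = br (D u) v + br u (D v)" for u v
  proof (rule derivation_extend[OF D(1) h[unfolded diagonalizable_def]])
    fix u v assume "u \<in> {v. \<exists>c. br h v = sc c v}" "v \<in> {v. \<exists>c. br h v = sc c v}"
    then obtain a b where a: "br h u = sc a u" and b: "br h v = sc b v" by blast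
    have "br h (br u v) = sc (a + b) (br u v)"
      using ad_br[of h u v] a b
      by (simp add: br_scale_left br_scale_right scale_left_distrib algebra_simps)
    from D(2)[OF this] show "D (br u v) = br (D u) v + br u (D v)"
      by (simp add: D(2)[OF a] D(2)[OF b] br_scale_left br_scale_right scale_left_distrib)
  qed
  \<comment> \<open>As \<open>D\<close> is a derivation, tr(ad [a, b] D) = tr(ad a [ad b, D]) = -
    kap a (D b).\<close>
  have "tr (\<lambda>x. br (br a b) (D x)) = 0" for a b
  proof -
    have "tr (\<lambda>x. br b (br a (D x))) = tr (\<lambda>x. br a (D (br b x)))"
      using tr_comm[OF lin_br[of b] lin_comp[OF lin_br[of a] D(1)]] by simp
    moreover have "br b (D x) - D (br b x) = - br (D b) x" for x
      using der[of b x] by simp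
    then have "br a (br b (D x)) - br a (D (br b x)) = - br a (br (D b) x)" for x
      by (metis br_diff_right br_minus_right)
    then have "tr (\<lambda>x. br a (br b (D x))) - tr (\<lambda>x. br a (D (br b x))) = tr (\<lambda>x. sc (-1) (br a (br (D b) x)))"
      unfolding tr_diff[symmetric] by simp
    ultimately show ?thesis
      using kap0[of a "D b"] tr_scale[of "- 1" "\<lambda>x. br a (br (D b) x)"] by (simp add: ad_br tr_diff kap_def)
  qed
  moreover have "subspace {y. tr (\<lambda>x. br y (D x)) = 0}"
    by (auto simp: subspace_def br_add_left br_scale_left tr_add tr_scale tr_zero)
  ultimately have "tr (\<lambda>x. br h (D x)) = 0"
    using span_eqI_subspace[OF _ _ perf, of "{y. tr (\<lambda>x. br y (D x)) = 0}" h] by auto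
  then show ?thesis using conj_trace_zero[OF lin_br h D] by blast
qed

lemma simple_perfect:
  assumes "simple_lie sc br"
  shows "span {br a b | a b. True} = UNIV"
proof -
  let ?I = "span {br a b | a b. True}"
  have "lie_ideal sc br ?I"
    unfolding lie_ideal_def by (auto intro: span_base)
  moreover have "?I \<noteq> {0}"
  proof -
    obtain x y where "br x y \<noteq> 0" using assms unfolding simple_lie_def by blast
    moreover have "br x y \<in> ?I" by (auto intro: span_base)
    ultimately show ?thesis by blast
  qed
  ultimately show ?thesis using assms unfolding simple_lie_def by blast
qed

text \<open>Takes the place of Cartan's criterion. The radical of the form is an ideal, and it is
  proper because the diagonalizable \<open>br h\<close> is nonzero; in the application
  \<open>h\<close> and \<open>w\<close> come from the highest root.\<close>

lemma simple_killing_nondegenerate: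
  assumes simple: "simple_lie sc br" and h: "diagonalizable (br h)" "br h w \<noteq> 0"
    and x: "\<And>y. kap x y = 0"
  shows "x = 0"
proof -
  let ?R = "{x. \<forall>y. kap x y = 0}"
  have "kap (br y x) z = 0" if "x \<in> ?R" for x y z
    using that kap_invariant[of x y z] br_anti[of y x] by (simp add: kap_minus_left)
  then have "lie_ideal sc br ?R"
    unfolding lie_ideal_def subspace_def by (auto simp: kap_add_left kap_scale_left)
  then have "?R = {0} \<or> ?R = UNIV" using simple unfolding simple_lie_def by blast
  moreover have "?R \<noteq> UNIV"
    using killing_zero_diagonalizable[OF _ simple_perfect[OF simple] h(1), of w] h(2) by blast
  ultimately show ?thesis using x by blast
qed

end

section \<open>Inner derivations and the Jordan decomposition inside g\<close>

locale kill_lie = fd_lie sc Bs br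
  for sc :: "complex \<Rightarrow> 'g::ab_group_add \<Rightarrow> 'g" and Bs :: "'g set" and br :: "'g \<Rightarrow> 'g \<Rightarrow> 'g" +
  assumes nondeg: "\<And>x. (\<And>y. kap x y = 0) \<Longrightarrow> x = 0"
begin

lemma kap_represent:
  assumes "\<And>x y. \<phi> (x + y) = \<phi> x + \<phi> y" "\<And>c x. \<phi> (sc c x) = c * \<phi> x"
  obtains d where "\<And>x. kap d x = \<phi> x"
proof -
  define L where "L x = (\<Sum>b\<in>Bs. sc (kap x b) b)" for x
  have fin: "finite Bs" using Bs_basis by (simp add: is_basis_def)
  have L: "lin L"
    by (rule linI) (auto simp: L_def kap_add_left kap_scale_left scale_left_distrib sum.distrib scale_sum_right)
  have rL: "representation Bs (L x) b = kap x b" if "b \<in> Bs" for x b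
    using rep_eqI[OF Bs_basis L_def that] .
  have ext: "x = 0" if "\<And>b. b \<in> Bs \<Longrightarrow> kap x b = 0" for x
  proof (rule nondeg)
    fix y
    show "kap x y = 0"
      by (subst basis_expand[OF Bs_basis, symmetric, of y]) (simp add: kap_sum_right kap_scale_right that)
  qed
  have "inj L"
  proof (rule injI)
    fix x y assume "L x = L y"
    then have "kap (x - y) b = 0" if "b \<in> Bs" for b
      using rL[OF that, of x] rL[OF that, of y] by (simp add: kap_diff_left)
    then show "x = y" using ext[of "x - y"] by simp
  qed
  then have "surj L" by (rule linear_inj_imp_surj[OF L])
  then obtain d where d: "L d = (\<Sum>b\<in>Bs. sc (\<phi> b) b)" by (metis surjD)
  have kd: "kap d b = \<phi> b" if "b \<in> Bs" for b
    using rL[OF that, of d] rep_eqI[OF Bs_basis d that] by simp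
  have 0: "\<phi> 0 = 0" using assms(2)[of 0 0] by simp
  have \<phi>sum: "\<phi> (\<Sum>i\<in>A. g i) = (\<Sum>i\<in>A. \<phi> (g i))" for A :: "'g set" and g
    by (induction A rule: infinite_finite_induct) (auto simp: 0 assms(1))
  have "kap d x = \<phi> x" for x
    by (subst (1 2) basis_expand[OF Bs_basis, symmetric, of x])
      (simp add: kap_sum_right kap_scale_right \<phi>sum assms(2) kd)
  then show ?thesis using that by blast
qed

text \<open>\<open>d\<close> is chosen so that E = D - ad d is trace-orthogonal to every ad x. For a
  derivation E with this property, kap (E x) y = tr(E ad [x, y]) = 0.\<close>

lemma derivation_inner:
  assumes D: "lin D" and der: "\<And>u v. D (br u v) = br (D u) v + br u (D v)"
  obtains d where "\<And>x. D x = br d x"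
proof -
  obtain d where d: "\<And>x. kap d x = tr (\<lambda>z. D (br x z))"
    by (rule kap_represent[of "\<lambda>x. tr (\<lambda>z. D (br x z))"])
      (auto simp: br_add_left br_scale_left lin_add[OF D] lin_scale[OF D] tr_add tr_scale)
  define E where "E x = D x - br d x" for x
  have E: "lin E" unfolding E_def by (rule lin_diff_fun[OF D lin_br])
  have Eder: "E (br u v) = br (E u) v + br u (E v)" for u v
    by (simp add: E_def der br_diff_left br_diff_right ad_br algebra_simps)
  have Etr: "tr (\<lambda>z. E (br x z)) = 0" for x
    using d[of x] by (simp add: E_def tr_diff kap_def)
  have "E x = 0" for x
  proof (rule nondeg)
    fix y
    have e: "br (E x) w = E (br x w) - br x (E w)" for w using Eder[of x w] by simp
    have "tr (\<lambda>w. br x (E (br y w))) = tr (\<lambda>w. E (br y (br x w)))"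
      using tr_comm[OF lin_br[of x] lin_comp[OF E lin_br[of y]]] by simp
    then have "kap (E x) y = tr (\<lambda>w. E (br x (br y w)) - E (br y (br x w)))"
      by (simp add: kap_def e tr_diff)
    also have "\<dots> = tr (\<lambda>w. E (br (br x y) w))" by (simp add: ad_br lin_diff[OF E])
    finally show "kap (E x) y = 0" using Etr by simp
  qed
  then show ?thesis using that[of d] by (simp add: E_def)
qed

text \<open>By the Leibniz rule ad x - (a + b) lowers the nilpotency exponent of one of the two
  arguments, hence the induction on \<open>n + m\<close>.\<close>

lemma gen_eig_br:
  assumes "u \<in> gen_eig (br x) a" "v \<in> gen_eig (br x) b"
  shows "br u v \<in> gen_eig (br x) (a + b)"
proof -
  have "br u v \<in> gen_eig (br x) (a + b)"
    if "((\<lambda>z. br x z - sc a z) ^^ n) u = 0" "((\<lambda>z. br x z - sc b z) ^^ m) v = 0" for n m u v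
    using that
  proof (induction "n + m" arbitrary: n m u v rule: less_induct)
    case less
    show ?case
    proof (cases n; cases m)
      fix n' m' assume nm: "n = Suc n'" "m = Suc m'"
      let ?u = "br x u - sc a u" and ?v = "br x v - sc b v"
      have "((\<lambda>z. br x z - sc a z) ^^ n') ?u = 0" "((\<lambda>z. br x z - sc b z) ^^ m') ?v = 0"
        using less.prems nm by (simp_all only: funpow_Suc_right o_def)
      then have "br ?u v \<in> gen_eig (br x) (a + b)" "br u ?v \<in> gen_eig (br x) (a + b)"
        using less.hyps[of n' m ?u v] less.hyps[of n m' u ?v] less.prems nm by simp_all
      then have "br ?u v + br u ?v \<in> gen_eig (br x) (a + b)"
        using subspace_add[OF gen_eig_subspace[OF lin_br]] by blast
      also have "br ?u v + br u ?v = br x (br u v) - sc (a + b) (br u v)"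
        using ad_br[of x u v]
        by (simp add: br_diff_left br_diff_right br_scale_left br_scale_right scale_left_distrib algebra_simps)
      finally obtain k where "((\<lambda>z. br x z - sc (a + b) z) ^^ k) (br x (br u v) - sc (a + b) (br u v)) = 0"
        unfolding gen_eig_def by blast
      then have "((\<lambda>z. br x z - sc (a + b) z) ^^ Suc k) (br u v) = 0"
        by (simp only: funpow_Suc_right o_def)
      then show ?thesis unfolding gen_eig_def by blast
    qed (use less.prems gen_eig_subspace[OF lin_br, of x "a + b"] in \<open>auto simp: subspace_0\<close>)
  qed
  then show ?thesis using assms unfolding gen_eig_def by blast
qed

text \<open>The semisimple part of \<open>br x\<close> is a derivation by \<open>gen_eig_br\<close>,
  hence inner. It annihilates the generalized eigenspace for 0, which contains the centralizer of
  \<open>x\<close>.\<close>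

lemma jordan:
  obtains s k where "diagonalizable (br s)" "\<And>y. br x y = 0 \<Longrightarrow> br s y = 0"
    "\<And>z. ((br (x - s)) ^^ k) z = 0"
proof -
  obtain D k where D: "lin D" "diagonalizable D" "\<And>c v. v \<in> gen_eig (br x) c \<Longrightarrow> D v = sc c v"
    "\<And>z. ((\<lambda>z. br x z - D z) ^^ k) z = 0"
    using jordan_chevalley[OF lin_br, of x] by metis
  have "D (br u v) = br (D u) v + br u (D v)" for u v
  proof (rule derivation_extend[OF D(1) gen_eig_span[OF lin_br, of x]])
    fix u v assume "u \<in> (\<Union>c. gen_eig (br x) c)" "v \<in> (\<Union>c. gen_eig (br x) c)"
    then obtain a b where a: "u \<in> gen_eig (br x) a" and b: "v \<in> gen_eig (br x) b" by blast
    show "D (br u v) = br (D u) v + br u (D v)"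
      by (simp add: D(3)[OF a] D(3)[OF b] D(3)[OF gen_eig_br[OF a b]] br_scale_left br_scale_right scale_left_distrib)
  qed
  then obtain s where s: "\<And>x. D x = br s x" using derivation_inner[OF D(1)] by metis
  have "D = br s" using s by blast
  moreover have "br s y = 0" if "br x y = 0" for y
  proof -
    have "y \<in> gen_eig (br x) 0"
      unfolding gen_eig_def using that by (auto intro!: exI[of _ 1])
    then show ?thesis using D(3) s by fastforce
  qed
  moreover have "(\<lambda>z. br x z - D z) = br (x - s)" by (simp add: fun_eq_iff s br_diff_left)
  ultimately show ?thesis using that[of s k] D(2,4) by metis
qed

end

section \<open>A Cartan subalgebra is its own centralizer\<close>

locale cartan_lie = kill_lie sc Bs br
  for sc :: "complex \<Rightarrow> 'g::ab_group_add \<Rightarrow> 'g" and Bs :: "'g set" and br :: "'g \<Rightarrow> 'g \<Rightarrow> 'g" +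
  fixes H :: "'g set"
  assumes cartan: "cartan sc br H"
begin

lemma H_subspace: "subspace H" and H_abelian: "x \<in> H \<Longrightarrow> y \<in> H \<Longrightarrow> br x y = 0"
  and H_diag: "x \<in> H \<Longrightarrow> diagonalizable (br x)"
  using cartan unfolding cartan_def toral_def ad_semisimple_def diagonalizable_def by blast+

text \<open>Adjoining \<open>s\<close> to \<open>H\<close> gives a toral subalgebra again, since
  commuting diagonalizable operators have diagonalizable sums.\<close>

lemma H_maximal:
  assumes s: "diagonalizable (br s)" and c: "\<And>h. h \<in> H \<Longrightarrow> br s h = 0"
  shows "s \<in> H"
proof -
  let ?H' = "{h + sc a s | h a. h \<in> H}"
  have sub: "subspace ?H'"
    unfolding subspace_def
  proof (intro conjI ballI allI)
    show "0 \<in> ?H'" using subspace_0[OF H_subspace] by (auto intro!: exI[of _ 0])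
    fix x y assume "x \<in> ?H'" "y \<in> ?H'"
    then obtain h a h' a' where "x = h + sc a s" "y = h' + sc a' s" "h \<in> H" "h' \<in> H" by blast
    then show "x + y \<in> ?H'" using subspace_add[OF H_subspace]
      by (intro CollectI exI[of _ "h + h'"] exI[of _ "a + a'"]) (auto simp: scale_left_distrib)
  next
    fix c x assume "x \<in> ?H'"
    then obtain h a where "x = h + sc a s" "h \<in> H" by blast
    then show "sc c x \<in> ?H'" using subspace_scale[OF H_subspace]
      by (intro CollectI exI[of _ "sc c h"] exI[of _ "c * a"]) (auto simp: scale_right_distrib)
  qed
  have dia: "diagonalizable (br (h + sc a s))" if h: "h \<in> H" for h a
  proof -
    have hs: "br h s = 0" using c[OF h] br_commute_if by blast
    have "span {v. \<forall>f\<in>{br h, br s}. \<exists>c. f v = sc c v} = UNIV"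
      by (rule simultaneous_diag)
        (auto intro: lin_br H_diag h s ad_commute[OF hs] ad_commute[OF hs, symmetric])
    moreover have "{v. \<forall>f\<in>{br h, br s}. \<exists>c. f v = sc c v} \<subseteq> {v. \<exists>c. br (h + sc a s) v = sc c v}"
      by (auto simp: br_add_left br_scale_left scale_left_distrib[symmetric])
    from span_mono[OF this] calculation show ?thesis unfolding diagonalizable_def by (simp only: top_le)
  qed
  have "toral sc br ?H'"
    unfolding toral_def
    using sub dia c br_commute_if[OF c] H_abelian
    by (auto simp: ad_semisimple_def diagonalizable_def br_add_left br_add_right br_scale_left br_scale_right)
  moreover have "H \<subseteq> ?H'"
  proof
    fix h assume "h \<in> H"
    then show "h \<in> ?H'" by (intro CollectI exI[of _ h] exI[of _ 0]) simp
  qed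
  ultimately have "?H' = H" using cartan unfolding cartan_def by blast
  moreover have "s \<in> ?H'" using subspace_0[OF H_subspace] by (auto intro!: exI[of _ 0] exI[of _ 1])
  ultimately show ?thesis by blast
qed

lemma weight_span: "span {v. \<forall>h\<in>H. \<exists>c. br h v = sc c v} = UNIV"
proof -
  obtain S where S: "S \<subseteq> H" "independent S" "H \<subseteq> span S" by (rule maximal_independent_subset)
  have finS: "finite S" using S(2) by (rule finiteI_independent)
  have "span {v. \<forall>f\<in>br ` S. \<exists>c. f v = sc c v} = UNIV"
    by (rule simultaneous_diag)
      (use S(1) finS in \<open>auto intro!: lin_br H_diag ad_commute H_abelian\<close>)
  moreover have "{v. \<forall>f\<in>br ` S. \<exists>c. f v = sc c v} \<subseteq> {v. \<forall>h\<in>H. \<exists>c. br h v = sc c v}"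
  proof clarify
    fix v h assume v: "\<forall>f\<in>br ` S. \<exists>c. f v = sc c v" and "h \<in> H"
    then have "h \<in> span S" using S by blast
    then show "\<exists>c. br h v = sc c v"
    proof (induction rule: span_induct_alt)
      case base show ?case by (auto intro!: exI[of _ 0])
    next
      case (step c x y)
      then obtain a b where "br x v = sc a v" "br y v = sc b v" using v by blast
      then have "br (sc c x + y) v = sc (c * a + b) v"
        by (simp add: br_add_left br_scale_left scale_left_distrib)
      then show ?case ..
    qed
  qed
  from span_mono[OF this] calculation show ?thesis by (simp only: top_le)
qed

lemma nilpotent_kap_commute:
  assumes "\<And>z. ((br n) ^^ k) z = 0" "br n x = 0"
  shows "kap n x = 0"
  unfolding kap_def
  by (rule tr_nilpotent_commute[OF lin_br lin_br ad_commute[OF assms(2)] assms(1)])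

text \<open>The Jordan decomposition splits \<open>x\<close> into an element of \<open>H\<close> and
  an ad-nilpotent one. Instead of Engel's theorem for the centralizer, ad-nilpotent elements of the
  centralizer are shown to be orthogonal to each other; the nilpotent part of \<open>x\<close> is
  then orthogonal to all weight vectors.\<close>

lemma H_self_centralizing:
  assumes x: "\<And>h. h \<in> H \<Longrightarrow> br x h = 0"
  shows "x \<in> H"
proof -
  have J: "\<exists>s k. s \<in> H \<and> (\<forall>z. ((br (x - s)) ^^ k) z = 0)" if x: "\<And>h. h \<in> H \<Longrightarrow> br x h = 0" for x
  proof -
    obtain s k where s: "diagonalizable (br s)" "\<And>y. br x y = 0 \<Longrightarrow> br s y = 0"
      "\<And>z. ((br (x - s)) ^^ k) z = 0" using jordan[of x] by metis
    have "s \<in> H" by (rule H_maximal[OF s(1) s(2)[OF x]])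
    then show ?thesis using s(3) by blast
  qed
  have nil: "kap n n' = 0"
    if n: "\<And>h. h \<in> H \<Longrightarrow> br n h = 0" "\<And>z. ((br n) ^^ k) z = 0"
      and n': "\<And>h. h \<in> H \<Longrightarrow> br n' h = 0" "\<And>z. ((br n') ^^ k') z = 0" for n n' k k'
  proof -
    define z where "z = n + n'"
    have zH: "br z h = 0" if "h \<in> H" for h using n(1) n'(1) that by (simp add: z_def br_add_left)
    obtain s m where s: "s \<in> H" "\<And>w. ((br (z - s)) ^^ m) w = 0" using J[OF zH] by blast
    obtain D where D: "lin D" "\<And>v c. br s v = sc c v \<Longrightarrow> D v = sc (cnj c) v"
      using functional_calculus[OF lin_br H_diag[OF s(1)], where \<phi> = cnj] by metis
    \<comment> \<open>The conjugate \<open>D\<close> of \<open>br s\<close> commutes with the three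
      nilpotent summands of s = n + n' - (z - s), so tr(ad s D) = 0 and ad s = 0. Then z itself is
      ad-nilpotent, and \<open>kap z z = 0\<close> is polarized.\<close>
    have tr0: "tr (\<lambda>w. br y (D w)) = 0" if "br y s = 0" "\<And>w. ((br y) ^^ k) w = 0" for y k
    proof (rule tr_nilpotent_commute[OF lin_br D(1) _ that(2)])
      fix w show "br y (D w) = D (br y w)"
        by (rule functional_calculus_commute[where \<phi> = cnj and f = "br s", symmetric, OF H_diag[OF s(1)] D lin_br])
          (auto intro: ad_commute[OF br_commute_if[OF that(1)]])
    qed
    have "br (z - s) s = 0" using zH[OF s(1)] by (simp add: br_diff_left)
    from tr0[OF n(1)[OF s(1)] n(2)] tr0[OF n'(1)[OF s(1)] n'(2)] tr0[OF this s(2)]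
 have "tr (\<lambda>w. br s (D w)) = 0"
      by (simp add: z_def br_add_left br_diff_left tr_add tr_diff)
    then have "br s w = 0" for w using conj_trace_zero[OF lin_br H_diag[OF s(1)] D] by blast
    then have "br (z - s) = br z" by (simp add: fun_eq_iff br_diff_left)
    then have "kap z z = 0"
      using s(2) by (intro nilpotent_kap_commute[where k = m]) simp_all
    then show ?thesis
      using nilpotent_kap_commute[OF n(2) br_self] nilpotent_kap_commute[OF n'(2) br_self] kap_comm[of n' n]
      by (simp add: z_def kap_add_left kap_add_right)
  qed
  obtain s k where s: "s \<in> H" "\<And>z. ((br (x - s)) ^^ k) z = 0" using J[OF x] by blast
  let ?n = "x - s"
  have n: "br ?n h = 0" if "h \<in> H" for h using x that H_abelian s(1) by (simp add: br_diff_left)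
  have "?n = 0"
  proof (rule nondeg)
    fix y
    have "subspace {y. kap ?n y = 0}"
      by (auto simp: subspace_def kap_add_right kap_scale_right)
    moreover have "kap ?n v = 0" if v: "\<forall>h\<in>H. \<exists>c. br h v = sc c v" for v
    proof (cases "\<forall>h\<in>H. br h v = 0")
      case True
      then have vH: "br v h = 0" if "h \<in> H" for h using that br_commute_if by blast
      obtain t m where t: "t \<in> H" "\<And>z. ((br (v - t)) ^^ m) z = 0" using J[OF vH] by blast
      have "kap ?n (v - t) = 0"
        by (rule nil[OF n s(2) _ t(2)]) (use vH H_abelian t(1) in \<open>simp_all add: br_diff_left\<close>)
      moreover have "kap ?n t = 0" by (rule nilpotent_kap_commute[OF s(2) n[OF t(1)]])
      ultimately show ?thesis by (simp add: kap_diff_right)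
    next
      case False
      then obtain h c where h: "h \<in> H" "br h v = sc c v" "br h v \<noteq> 0" using v by blast
      have "c * kap ?n v = kap (br ?n h) v" unfolding kap_invariant h(2) kap_scale_right ..
      then show ?thesis using h n by auto
    qed
    ultimately show "kap ?n y = 0"
      using span_eqI_subspace[OF _ _ weight_span, of "{y. kap ?n y = 0}" y] by blast
  qed
  then show ?thesis using s(1) by simp
qed

end

section \<open>Roots\<close>

context cartan_lie
begin

abbreviation "rs \<equiv> root_space br sc H"
abbreviation "R \<equiv> roots sc br H"

lemma rs_iff: "x \<in> rs a \<longleftrightarrow> (\<forall>h\<in>H. br h x = sc (a h) x)"
  by (simp add: root_space_def)

lemma root_not_zero: "a \<in> R \<Longrightarrow> \<exists>h\<in>H. a h \<noteq> 0"
  unfolding roots_def hdual_def by fastforce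

lemma root_vector: "a \<in> R \<Longrightarrow> \<exists>x\<in>rs a. x \<noteq> 0"
  unfolding roots_def using subspace_0 by (auto simp: root_space_def)

lemma hdual_outside: "a \<in> hdual sc H \<Longrightarrow> h \<notin> H \<Longrightarrow> a h = 0"
  by (simp add: hdual_def)

lemma root_hdual: "a \<in> R \<Longrightarrow> a \<in> hdual sc H"
  by (simp add: roots_def)

lemma hdual_eqI:
  assumes "a \<in> hdual sc H" "b \<in> hdual sc H" "\<And>h. h \<in> H \<Longrightarrow> a h = b h"
  shows "a = b"
proof
  fix h show "a h = b h" using assms by (cases "h \<in> H") (simp_all add: hdual_outside)
qed

lemma hdual_fadd: "a \<in> hdual sc H \<Longrightarrow> b \<in> hdual sc H \<Longrightarrow> fadd a b \<in> hdual sc H"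
  and hdual_fneg: "a \<in> hdual sc H \<Longrightarrow> fneg a \<in> hdual sc H"
  by (auto simp: hdual_def fadd_def fneg_def algebra_simps)

lemma fneg_fneg: "fneg (fneg a) = a"
  by (simp add: fneg_def)

lemma rs_br: "x \<in> rs a \<Longrightarrow> y \<in> rs b \<Longrightarrow> br x y \<in> rs (fadd a b)"
  unfolding rs_iff
proof
  fix h assume "\<forall>h\<in>H. br h x = sc (a h) x" "\<forall>h\<in>H. br h y = sc (b h) y" "h \<in> H"
  then have "br h x = sc (a h) x" "br h y = sc (b h) y" by auto
  then show "br h (br x y) = sc (fadd a b h) (br x y)"
    using ad_br[of h x y]
    by (simp add: br_scale_left br_scale_right fadd_def scale_left_distrib algebra_simps)
qed

lemma rs_zero_H: "(\<And>h. h \<in> H \<Longrightarrow> a h = 0) \<Longrightarrow> x \<in> rs a \<Longrightarrow> x \<in> H"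
  by (rule H_self_centralizing) (auto simp: rs_iff br_commute_if)

lemma weight_cases:
  assumes v: "\<forall>h\<in>H. \<exists>c. br h v = sc c v" and nz: "v \<noteq> 0"
  obtains "v \<in> H" | a where "a \<in> R" "v \<in> rs a"
proof -
  define a where "a h = (if h \<in> H then THE c. br h v = sc c v else 0)" for h
  have av: "br h v = sc (a h) v" if "h \<in> H" for h
  proof -
    obtain c where c: "br h v = sc c v" using v \<open>h \<in> H\<close> by blast
    then have "(THE c. br h v = sc c v) = c" using nz by (intro the_equality) auto
    then show ?thesis using c that by (simp add: a_def)
  qed
  have "a \<in> hdual sc H"
    unfolding hdual_def
  proof (intro CollectI conjI ballI allI impI)
    fix x y assume "x \<in> H" "y \<in> H"
    then have "sc (a (x + y)) v = sc (a x + a y) v"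
      using av[of "x + y"] av[of x] av[of y] subspace_add[OF H_subspace]
      by (simp add: br_add_left scale_left_distrib)
    then show "a (x + y) = a x + a y" using nz by simp
  next
    fix c x assume "x \<in> H"
    then have "sc (a (sc c x)) v = sc (c * a x) v"
      using av[of "sc c x"] av[of x] subspace_scale[OF H_subspace] by (auto simp: br_scale_left)
    then show "a (sc c x) = c * a x" using nz by simp
  qed (simp add: a_def)
  moreover have va: "v \<in> rs a" using av by (simp add: rs_iff)
  ultimately show ?thesis
    using that rs_zero_H[of a v] nz by (cases "a = (\<lambda>_. 0)") (auto simp: roots_def)
qed

lemma root_span: "span (H \<union> (\<Union>a\<in>R. rs a)) = UNIV"
proof -
  have "{v. \<forall>h\<in>H. \<exists>c. br h v = sc c v} \<subseteq> H \<union> (\<Union>a\<in>R. rs a)"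
  proof
    fix v assume v: "v \<in> {v. \<forall>h\<in>H. \<exists>c. br h v = sc c v}"
    show "v \<in> H \<union> (\<Union>a\<in>R. rs a)"
    proof (cases "v = 0")
      case True then show ?thesis using subspace_0[OF H_subspace] by simp
    next
      case False
      from v have "\<forall>h\<in>H. \<exists>c. br h v = sc c v" by simp
      then show ?thesis by (rule weight_cases[OF _ False]) auto
    qed
  qed
  from span_mono[OF this] show ?thesis using weight_span by (simp only: top_le)
qed

lemma root_basis:
  obtains B where "is_basis sc B" "B \<subseteq> H \<union> (\<Union>a\<in>R. rs a)"
proof -
  obtain B where B: "B \<subseteq> H \<union> (\<Union>a\<in>R. rs a)" "independent B" "H \<union> (\<Union>a\<in>R. rs a) \<subseteq> span B"
    by (rule maximal_independent_subset)
  have "span B = UNIV" using span_minimal[OF B(3) subspace_span] root_span by blast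
  then show ?thesis using that[of B] B by (auto simp: is_basis_iff)
qed

lemma basis_weights:
  assumes "is_basis sc B" "B \<subseteq> H \<union> (\<Union>a\<in>R. rs a)"
  obtains w where "\<And>b h. b \<in> B \<Longrightarrow> h \<in> H \<Longrightarrow> br h b = sc (w b h) b"
    "\<And>b. b \<in> B \<Longrightarrow> w b \<in> R \<or> (w b = (\<lambda>_. 0) \<and> b \<in> H)"
proof -
  have "\<exists>a. (\<forall>h\<in>H. br h b = sc (a h) b) \<and> (a \<in> R \<or> (a = (\<lambda>_. 0) \<and> b \<in> H))" if b: "b \<in> B" for b
  proof (cases "b \<in> H")
    case True
    then show ?thesis by (intro exI[of _ "\<lambda>_. 0"]) (simp add: H_abelian)
  next
    case False
    then obtain a where a: "a \<in> R" "b \<in> rs a" using assms(2) b by blast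
    have "\<forall>h\<in>H. br h b = sc (a h) b" using a(2) by (simp only: rs_iff)
    then show ?thesis using a(1) by blast
  qed
  then obtain w where "\<forall>b\<in>B. (\<forall>h\<in>H. br h b = sc (w b h) b) \<and> (w b \<in> R \<or> (w b = (\<lambda>_. 0) \<and> b \<in> H))"
    by metis
  then show ?thesis using that by blast
qed

lemma rep_br_weight:
  assumes "is_basis sc B" "\<And>b. b \<in> B \<Longrightarrow> br h b = sc (w b) b" "b \<in> B"
  shows "representation B (br h x) b = w b * representation B x b"
proof -
  have "br h x = (\<Sum>b\<in>B. sc (w b * representation B x b) b)"
    by (subst basis_expand[OF assms(1), symmetric, of x])
      (simp add: lin_sum[OF lin_br] br_scale_right assms(2) mult.commute)
  from rep_eqI[OF assms(1) this assms(3)] show ?thesis .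
qed

lemma roots_finite: "finite R"
proof -
  obtain B where B: "is_basis sc B" "B \<subseteq> H \<union> (\<Union>a\<in>R. rs a)" by (rule root_basis)
  obtain w where w: "\<And>b h. b \<in> B \<Longrightarrow> h \<in> H \<Longrightarrow> br h b = sc (w b h) b"
    "\<And>b. b \<in> B \<Longrightarrow> w b \<in> R \<or> (w b = (\<lambda>_. 0) \<and> b \<in> H)" using basis_weights[OF B] by metis
  have "R \<subseteq> w ` B"
  proof
    fix a assume a: "a \<in> R"
    then obtain x where x: "x \<in> rs a" "x \<noteq> 0" using root_vector by blast
    have "\<exists>b\<in>B. representation B x b \<noteq> 0"
      using x(2) basis_expand[OF B(1), of x] by (metis (no_types, lifting) scale_zero_left sum.neutral)
    then obtain b where b: "b \<in> B" "representation B x b \<noteq> 0" by blast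
    have "a h = w b h" if h: "h \<in> H" for h
      using rep_br_weight[OF B(1) w(1)[OF _ h] b(1), of x] x(1) h b(2) rep_scale[OF B(1), of "a h" x b]
      by (simp add: rs_iff)
    then have "a = w b"
      using a w(2)[OF b(1)] root_not_zero[OF a] hdual_eqI root_hdual by metis
    then show "a \<in> w ` B" using b(1) by blast
  qed
  moreover have "finite B" using B(1) by (simp add: is_basis_def)
  ultimately show ?thesis by (meson finite_imageI finite_subset)
qed

text \<open>Finitely many hyperplanes do not cover \<open>H\<close>: one root at a time is treated
  by moving along a line on which each root vanishes at most once.\<close>

lemma regular_element: "\<exists>y\<in>H. \<forall>a\<in>R. a y \<noteq> 0"
proof -
  have "\<exists>y\<in>H. \<forall>a\<in>A. a y \<noteq> 0" if "finite A" "A \<subseteq> R" for A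
    using that
  proof (induction A rule: finite_induct)
    case empty then show ?case using subspace_0[OF H_subspace] by blast
  next
    case (insert a A)
    then obtain y where y: "y \<in> H" "\<forall>a\<in>A. a y \<noteq> 0" by blast
    obtain z where z: "z \<in> H" "a z \<noteq> 0" using insert.prems root_not_zero by blast
    have "finite ((\<lambda>b. - b y / b z) ` insert a A)" using insert.hyps by simp
    then obtain t where t: "t \<notin> (\<lambda>b. - b y / b z) ` insert a A"
      using ex_new_if_finite[OF infinite_UNIV_char_0[where 'a = complex]] by blast
    have "b (y + sc t z) \<noteq> 0" if b: "b \<in> insert a A" for b
    proof
      assume "b (y + sc t z) = 0"
      moreover have "b \<in> hdual sc H" using b insert.prems root_hdual by blast
      ultimately have 0: "b y + t * b z = 0"
        using y(1) z(1) subspace_scale[OF H_subspace] by (simp add: hdual_def)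
      show False
      proof (cases "b z = 0")
        case True
        then show False using 0 y(2) z(2) b by auto
      next
        case False
        then have "t = - b y / b z" using 0 by (simp add: field_simps eq_neg_iff_add_eq_0)
        then show False using t b by blast
      qed
    qed
    moreover have "y + sc t z \<in> H"
      using y(1) z(1) subspace_scale[OF H_subspace] subspace_add[OF H_subspace] by blast
    ultimately show ?case by blast
  qed
  from this[OF roots_finite subset_refl] show ?thesis .
qed

text \<open>The basis is adapted to \<open>g = H + [y, g]\<close>, and the Killing-dual vectors of its part in \<open>H\<close>
  commute with \<open>y\<close> and hence lie in \<open>H\<close> again.\<close>
lemma regular_decomposition:
  obtains y B d where "y \<in> H" "is_basis sc B" "\<And>x. (\<Sum>b\<in>B. sc (kap (d b) x) b) = x"
    "\<And>b. b \<in> B \<Longrightarrow> (b \<in> H \<and> d b \<in> H) \<or> (\<exists>z. b = br y z)"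
proof -
  obtain y where y: "y \<in> H" "\<And>a. a \<in> R \<Longrightarrow> a y \<noteq> 0" using regular_element by blast
  obtain B where B: "is_basis sc B" "B \<subseteq> H \<union> (\<Union>a\<in>R. rs a)" by (rule root_basis)
  obtain w where w: "\<And>b h. b \<in> B \<Longrightarrow> h \<in> H \<Longrightarrow> br h b = sc (w b h) b"
    "\<And>b. b \<in> B \<Longrightarrow> w b \<in> R \<or> (w b = (\<lambda>_. 0) \<and> b \<in> H)" using basis_weights[OF B] by metis
  have wy: "w b y = 0 \<Longrightarrow> b \<in> H" if "b \<in> B" for b using w(2)[OF that] y(2) by auto
  \<comment> \<open>As no root vanishes at \<open>y\<close>, its centralizer is
    \<open>H\<close>.\<close>
  have cent: "x \<in> H" if x: "br y x = 0" for x
  proof -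
    have "sc (representation B x b) b \<in> H" if b: "b \<in> B" for b
    proof (cases "b \<in> H")
      case True then show ?thesis using subspace_scale[OF H_subspace] by blast
    next
      case False
      have "w b y * representation B x b = 0"
        using rep_br_weight[OF B(1) w(1)[OF _ y(1)] b, of x] x rep_scale[OF B(1), of 0 0 b] by simp
      then show ?thesis using False wy[OF b] subspace_0[OF H_subspace] by auto
    qed
    then have "(\<Sum>b\<in>B. sc (representation B x b) b) \<in> H" by (rule subspace_sum[OF H_subspace])
    then show ?thesis by (simp add: basis_expand[OF B(1)])
  qed
  have "\<exists>d. \<forall>x. kap d x = representation B x b" for b
    by (rule kap_represent[of "\<lambda>x. representation B x b"]) (auto simp: rep_add[OF B(1)] rep_scale[OF B(1)])
  then obtain d where d: "\<And>b x. kap (d b) x = representation B x b" by metis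
  have "(b \<in> H \<and> d b \<in> H) \<or> (\<exists>z. b = br y z)" if b: "b \<in> B" for b
  proof (cases "b \<in> H")
    case False
    then have "w b y \<noteq> 0" using wy b by blast
    then have "b = br y (sc (1 / w b y) b)" using w(1)[OF b y(1)] by (simp add: br_scale_right)
    then show ?thesis by blast
  next
    case True
    have "w b y = 0" using w(1)[OF b y(1)] H_abelian[OF y(1) True] b B(1)
      by (metis dependent_zero is_basis_iff scale_eq_0_iff)
    \<comment> \<open>By invariance this is the \<open>b\<close>-coordinate of
      \<open>br y z\<close>, which is zero because \<open>b\<close> has weight 0 at
      \<open>y\<close>.\<close>
    then have "kap (br (d b) y) z = 0" for z
      unfolding kap_invariant d by (simp add: rep_br_weight[OF B(1) w(1)[OF _ y(1)] b])
    then have "br (d b) y = 0" by (rule nondeg)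
    then show ?thesis using True cent br_commute_if by blast
  qed
  moreover have "(\<Sum>b\<in>B. sc (kap (d b) x) b) = x" for x by (simp add: d basis_expand[OF B(1)])
  ultimately show ?thesis using that[OF y(1) B(1)] by blast
qed

lemma kap_rs_zero:
  assumes "x \<in> rs a" "y \<in> rs b" "h \<in> H" "a h + b h \<noteq> 0"
  shows "kap x y = 0"
proof -
  have "a h * kap x y = kap (br h x) y" using assms by (simp add: rs_iff kap_scale_left)
  also have "\<dots> = - kap (br x h) y" using br_anti[of h x] by (simp add: kap_minus_left)
  also have "\<dots> = - (b h * kap x y)" unfolding kap_invariant using assms by (simp add: rs_iff kap_scale_right)
  finally have "(a h + b h) * kap x y = 0" by (simp add: algebra_simps)
  then show ?thesis using assms(4) by simp
qed

text \<open>Some weight vector pairs nontrivially with \<open>x\<close> by nondegeneracy, and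
  \<open>kap_rs_zero\<close> forces its weight to be the negative of \<open>a\<close>.\<close>

lemma opposite_root_vector:
  assumes a: "a \<in> R" and x: "x \<in> rs a" "x \<noteq> 0"
  obtains y where "y \<in> rs (fneg a)" "kap x y = 1"
proof -
  have "\<exists>y\<in>H \<union> (\<Union>a\<in>R. rs a). kap x y \<noteq> 0"
  proof (rule ccontr)
    assume "\<not> ?thesis"
    then have "H \<union> (\<Union>a\<in>R. rs a) \<subseteq> {y. kap x y = 0}" by blast
    moreover have "subspace {y. kap x y = 0}" by (auto simp: subspace_def kap_add_right kap_scale_right)
    ultimately have "kap x y = 0" for y using span_eqI_subspace[OF _ _ root_span] by blast
    then show False using nondeg x by blast
  qed
  then obtain y where y0: "kap x y \<noteq> 0" "y \<in> H \<union> (\<Union>a\<in>R. rs a)" by blast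
  have "\<exists>b\<in>hdual sc H. y \<in> rs b"
  proof (cases "y \<in> H")
    case True
    have "(\<lambda>_. 0) \<in> hdual sc H" by (simp add: hdual_def)
    moreover have "y \<in> rs (\<lambda>_. 0)" using True by (simp add: rs_iff H_abelian)
    ultimately show ?thesis by blast
  next
    case False
    then obtain b where "b \<in> R" "y \<in> rs b" using y0 by blast
    then show ?thesis using root_hdual by blast
  qed
  then obtain b where y: "kap x y \<noteq> 0" "y \<in> rs b" "b \<in> hdual sc H" using y0 by blast
  have "b = fneg a"
  proof (rule hdual_eqI[OF y(3) hdual_fneg[OF root_hdual[OF a]]])
    fix h assume "h \<in> H"
    then have "a h + b h = 0" using kap_rs_zero[OF x(1) y(2)] y(1) by blast
    then show "b h = fneg a h" by (simp add: fneg_def eq_neg_iff_add_eq_0 add.commute)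
  qed
  then have "sc (1 / kap x y) y \<in> rs (fneg a)" using y(2) by (simp add: rs_iff br_scale_right mult.commute)
  moreover have "kap x (sc (1 / kap x y) y) = 1" using y(1) by (simp add: kap_scale_right)
  ultimately show ?thesis using that by blast
qed

lemma root_neg: "a \<in> R \<Longrightarrow> fneg a \<in> R"
proof -
  assume a: "a \<in> R"
  then obtain x where x: "x \<in> rs a" "x \<noteq> 0" using root_vector by blast
  obtain y where y: "y \<in> rs (fneg a)" "kap x y = 1" using opposite_root_vector[OF a x] .
  then have "y \<noteq> 0" by auto
  then show ?thesis
    using y(1) hdual_fneg[OF root_hdual[OF a]] root_not_zero[OF a] by (auto simp: roots_def fneg_def fun_eq_iff)
qed

text \<open>\<open>t\<close> is the Killing dual of \<open>a\<close>. If a(t) were 0, the conjugate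
  \<open>D\<close> of \<open>br t\<close> would commute with \<open>br e\<close>, so tr(ad [e, f] D)
  = 0 and ad t = 0, against kap t = a on \<open>H\<close>.\<close>

lemma root_dual_element:
  assumes a: "a \<in> R"
  obtains t where "t \<in> H" "\<And>x y. x \<in> rs a \<Longrightarrow> y \<in> rs (fneg a) \<Longrightarrow> br x y = sc (kap x y) t"
    "\<And>h. h \<in> H \<Longrightarrow> kap t h = a h" "a t \<noteq> 0"
proof -
  obtain e where e: "e \<in> rs a" "e \<noteq> 0" using root_vector[OF a] by blast
  obtain f where f: "f \<in> rs (fneg a)" "kap e f = 1" using opposite_root_vector[OF a e] .
  define t where "t = br e f"
  have inH: "br x y \<in> H" if "x \<in> rs a" "y \<in> rs (fneg a)" for x y
    by (rule rs_zero_H[OF _ rs_br[OF that]]) (simp add: fadd_def fneg_def)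
  have kapt: "kap (br x y) h = kap x y * a h" if "x \<in> rs a" "y \<in> rs (fneg a)" "h \<in> H" for x y h
  proof -
    have "kap (br x y) h = kap x (br y h)" by (rule kap_invariant)
    also have "br y h = sc (a h) y" using that br_anti[of y h] by (simp add: rs_iff fneg_def)
    finally show ?thesis by (simp add: kap_scale_right)
  qed
  have tH: "t \<in> H" unfolding t_def by (rule inH[OF e(1) f(1)])
  have th: "kap t h = a h" if "h \<in> H" for h unfolding t_def by (simp add: kapt[OF e(1) f(1) that] f(2))
  have Hnd: "h = 0" if h: "h \<in> H" "\<And>h'. h' \<in> H \<Longrightarrow> kap h h' = 0" for h
  proof (rule nondeg)
    fix y
    have "kap h y = 0" if y: "y \<in> H \<union> (\<Union>a\<in>R. rs a)" for y
    proof (cases "y \<in> H")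
      case False
      then obtain b where b: "b \<in> R" "y \<in> rs b" using y by blast
      obtain k where k: "k \<in> H" "b k \<noteq> 0" using root_not_zero[OF b(1)] by blast
      show ?thesis
        by (rule kap_rs_zero[OF _ b(2) k(1), of h "\<lambda>_. 0"]) (use \<open>h \<in> H\<close> H_abelian k in \<open>auto simp: rs_iff\<close>)
    qed (use h in auto)
    then have "H \<union> (\<Union>a\<in>R. rs a) \<subseteq> {y. kap h y = 0}" by blast
    moreover have "subspace {y. kap h y = 0}" by (auto simp: subspace_def kap_add_right kap_scale_right)
    ultimately show "kap h y = 0" using span_eqI_subspace[OF _ _ root_span] by blast
  qed
  have brt: "br x y = sc (kap x y) t" if "x \<in> rs a" "y \<in> rs (fneg a)" for x y
  proof -
    have "br x y - sc (kap x y) t = 0"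
    proof (rule Hnd)
      show "br x y - sc (kap x y) t \<in> H"
        using inH[OF that] tH subspace_diff[OF H_subspace] subspace_scale[OF H_subspace] by blast
      fix h assume "h \<in> H"
      then show "kap (br x y - sc (kap x y) t) h = 0"
        by (simp add: kap_diff_left kap_scale_left kapt[OF that] th)
    qed
    then show ?thesis by simp
  qed
  have "a t \<noteq> 0"
  proof
    assume 0: "a t = 0"
    obtain D where D: "lin D" "\<And>v c. br t v = sc c v \<Longrightarrow> D v = sc (cnj c) v"
      using functional_calculus[OF lin_br H_diag[OF tH], where \<phi> = cnj] by metis
    have "br t e = 0" using e(1) tH 0 by (simp add: rs_iff)
    have De: "D (br e w) = br e (D w)" for w
      by (rule functional_calculus_commute[where \<phi> = cnj, OF H_diag[OF tH] D lin_br])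
        (auto intro: ad_commute[OF \<open>br t e = 0\<close>])
    have "tr (\<lambda>w. br f (br e (D w))) = tr (\<lambda>w. br e (br f (D w)))"
    proof -
      have "tr (\<lambda>w. br f (br e (D w))) = tr (\<lambda>w. br f (D (br e w)))" by (simp add: De)
      also have "\<dots> = tr (\<lambda>w. br e (br f (D w)))"
        using tr_comm[OF lin_br[of e] lin_comp[OF lin_br[of f] D(1)]] by simp
      finally show ?thesis .
    qed
    then have "tr (\<lambda>w. br t (D w)) = 0" by (simp add: t_def ad_br tr_diff)
    then have "br t w = 0" for w using conj_trace_zero[OF lin_br H_diag[OF tH] D] by blast
    then have "kap t h = 0" for h by (simp add: kap_def tr_zero)
    then show False using th root_not_zero[OF a] by metis
  qed
  then show ?thesis using that[OF tH brt th] by blast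
qed

text \<open>If \<open>u\<close> in the root space is Killing-orthogonal to \<open>f\<close>, then \<open>f\<close> kills it and the vectors
  \<open>(ad e)^n u\<close> never vanish, by the sl2 commutation relations.\<close>
lemma root_space_one_dim:
  assumes a: "a \<in> R" and e: "e \<in> rs a" "e \<noteq> 0" and x: "x \<in> rs a"
  obtains c where "x = sc c e"
proof -
  obtain f where f: "f \<in> rs (fneg a)" "kap e f = 1" using opposite_root_vector[OF a e] .
  obtain t where t: "t \<in> H" "\<And>x y. x \<in> rs a \<Longrightarrow> y \<in> rs (fneg a) \<Longrightarrow> br x y = sc (kap x y) t" "a t \<noteq> 0"
    using root_dual_element[OF a] by metis
  define u where "u = x - sc (kap x f) e"
  have ua: "u \<in> rs a" using x e(1) by (simp add: u_def rs_iff br_diff_right br_scale_right scale_right_diff_distrib mult.commute)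
  have "kap u f = 0" by (simp add: u_def kap_diff_left kap_scale_left f(2))
  then have fu: "br f u = 0" using t(2)[OF ua f(1)] br_commute_if by simp
  let ?E = "\<lambda>n. (br e ^^ n) u"
  have tE: "br h (?E n) = sc (of_nat (Suc n) * a h) (?E n)" if "h \<in> H" for h n
  proof (induction n)
    case 0 then show ?case using ua that by (simp add: rs_iff)
  next
    case (Suc n)
    have "br h (br e (?E n)) = br (br h e) (?E n) + br e (br h (?E n))" using ad_br[of h e] by simp
    also have "br (br h e) (?E n) = sc (a h) (br e (?E n))"
      using e(1) that by (simp add: rs_iff br_scale_left)
    also have "br e (br h (?E n)) = sc (of_nat (Suc n) * a h) (br e (?E n))"
      by (subst Suc) (simp add: br_scale_right del: of_nat_Suc)
    finally show ?case
      unfolding scale_left_distrib[symmetric] by (simp add: algebra_simps)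
  qed
  \<comment> \<open>The coefficient is minus the sum of the eigenvalues (j + 1) a(t) of
    \<open>t\<close> on the vectors \<open>?E j\<close> with j = 0, ..., n.\<close>
  have fE: "br f (?E (Suc n)) = sc (- (a t * of_nat (Suc n) * of_nat (Suc (Suc n)) / 2)) (?E n)" for n
  proof (induction n)
    case 0
    have "br f (br e u) = br e (br f u) - br (br e f) u" using ad_br[of e f u] by simp
    then show ?case using fu t(2)[OF e(1) f(1)] f(2) ua t(1) by (simp add: rs_iff scale_minus_left)
  next
    case (Suc n)
    have "br f (br e (?E (Suc n))) = br e (br f (?E (Suc n))) - br (br e f) (?E (Suc n))"
      using ad_br[of e f "?E (Suc n)"] by simp
    also have "br e (br f (?E (Suc n))) = sc (- (a t * of_nat (Suc n) * of_nat (Suc (Suc n)) / 2)) (?E (Suc n))"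
      by (subst Suc) (simp only: br_scale_right funpow.simps o_apply)
    also have "br (br e f) (?E (Suc n)) = sc (of_nat (Suc (Suc n)) * a t) (?E (Suc n))"
      using t(2)[OF e(1) f(1)] f(2) tE[OF t(1), of "Suc n"] by simp
    finally have X: "br f (br e (?E (Suc n))) =
      sc (- (a t * of_nat (Suc n) * of_nat (Suc (Suc n)) / 2) - of_nat (Suc (Suc n)) * a t) (?E (Suc n))"
      unfolding scale_left_diff_distrib[symmetric] .
    have "- (a t * of_nat (Suc n) * of_nat (Suc (Suc n)) / 2) - of_nat (Suc (Suc n)) * a t
      = - (a t * of_nat (Suc (Suc n)) * of_nat (Suc (Suc (Suc n))) / 2)"
      by (simp add: field_simps)
    with X show ?case by (simp only: funpow.simps o_apply)
  qed
  have "u = 0"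
  proof (rule ccontr)
    assume u: "u \<noteq> 0"
    have nz: "?E n \<noteq> 0" for n
    proof (induction n)
      case (Suc n)
      show ?case
      proof
        assume "?E (Suc n) = 0"
        then have "sc (- (a t * of_nat (Suc n) * of_nat (Suc (Suc n)) / 2)) (?E n) = 0" using fE[of n] by simp
        then show False using Suc t(3) by (simp del: of_nat_Suc)
      qed
    qed (simp add: u)
    have inR: "(\<lambda>h. of_nat (Suc n) * a h) \<in> R" for n
    proof -
      have "(\<lambda>h. of_nat (Suc n) * a h) \<in> hdual sc H"
        using root_hdual[OF a] by (auto simp: hdual_def algebra_simps)
      moreover have "?E n \<in> rs (\<lambda>h. of_nat (Suc n) * a h)" using tE by (simp add: rs_iff)
      moreover have "(\<lambda>h. of_nat (Suc n) * a h) \<noteq> (\<lambda>_. 0)" using t(3)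
        by (metis mult_eq_0_iff of_nat_eq_0_iff nat.distinct(1))
      ultimately show ?thesis using nz[of n] unfolding roots_def by blast
    qed
    have "inj (\<lambda>n h. of_nat (Suc n) * a h)"
      by (rule injI) (use t(3) in \<open>auto dest!: fun_cong[of _ _ t] simp del: of_nat_Suc\<close>)
    then have "infinite (range (\<lambda>n h. of_nat (Suc n) * a h))" by (simp add: range_inj_infinite)
    moreover have "range (\<lambda>n h. of_nat (Suc n) * a h) \<subseteq> R" using inR by blast
    ultimately show False using roots_finite finite_subset by blast
  qed
  then show ?thesis using that[of "kap x f"] by (simp add: u_def)
qed

text \<open>The coroot is 2 t / a(t) with t the Killing dual of \<open>a\<close>, of norm 4 / a(t).
  For the highest root this shows that the dual Coxeter number is nonzero.\<close>

lemma coroot_norm: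
  assumes a: "a \<in> R"
  shows "kap (coroot sc br H a) (coroot sc br H a) \<noteq> 0"
proof -
  obtain t where t: "t \<in> H" "\<And>x y. x \<in> rs a \<Longrightarrow> y \<in> rs (fneg a) \<Longrightarrow> br x y = sc (kap x y) t"
    "\<And>h. h \<in> H \<Longrightarrow> kap t h = a h" "a t \<noteq> 0" using root_dual_element[OF a] by metis
  have sc_t: "a (sc c t) = c * a t" for c using root_hdual[OF a] t(1) by (simp add: hdual_def)
  obtain e where e: "e \<in> rs a" "e \<noteq> 0" using root_vector[OF a] by blast
  obtain f where f: "f \<in> rs (fneg a)" "kap e f = 1" using opposite_root_vector[OF a e] .
  have "coroot sc br H a = sc (2 / a t) t"
    unfolding coroot_def
  proof (rule the_equality)
    have "sc (2 / a t) e \<in> rs a" using e(1) by (simp add: rs_iff br_scale_right mult.commute)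
    moreover have "sc (2 / a t) t = br (sc (2 / a t) e) f" using t(2)[OF e(1) f(1)] f(2) by (simp add: br_scale_left)
    moreover have "a (sc (2 / a t) t) = 2" by (simp add: sc_t t(4))
    ultimately show "sc (2 / a t) t \<in> H \<and> a (sc (2 / a t) t) = 2 \<and>
      (\<exists>x\<in>rs a. \<exists>y\<in>rs (fneg a). sc (2 / a t) t = br x y)"
      using subspace_scale[OF H_subspace t(1)] f(1) by blast
    fix s assume s: "s \<in> H \<and> a s = 2 \<and> (\<exists>x\<in>rs a. \<exists>y\<in>rs (fneg a). s = br x y)"
    then obtain c where c: "s = sc c t" using t(2) by metis
    then have "c = 2 / a t" using s sc_t t(4) by (simp add: field_simps)
    then show "s = sc (2 / a t) t" using c by simp
  qed
  then show ?thesis using t(3)[OF t(1)] t(4) by (simp add: kap_scale_left kap_scale_right)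
qed

text \<open>The brackets with the \<open>e \<alpha>\<close> of the lowest root vector span an ideal.\<close>
lemma lowest_root_vector_generates:
  assumes simple: "simple_lie sc br" and P: "pos_system sc br H P" and hi: "highest_root sc br H P \<theta>"
    and e: "\<And>\<alpha>. \<alpha> \<in> P \<Longrightarrow> e \<alpha> \<in> rs \<alpha>" "\<And>\<alpha>. \<alpha> \<in> P \<Longrightarrow> e \<alpha> \<noteq> 0"
    and f: "f \<in> rs (fneg \<theta>)" "f \<noteq> 0"
    and A: "subspace A" "f \<in> A" "\<And>\<alpha> x. \<alpha> \<in> P \<Longrightarrow> x \<in> A \<Longrightarrow> br (e \<alpha>) x \<in> A"
  shows "x \<in> A"
proof -
  have PR: "P \<subseteq> R" using P by (simp add: pos_system_def)
  \<comment> \<open>\<open>W\<close> is generated as a set and not as a subspace, so that all its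
    elements are weight vectors.\<close>
  define W where "W = \<Inter> {W. f \<in> W \<and> (\<forall>\<alpha>\<in>P. \<forall>w\<in>W. br (e \<alpha>) w \<in> W)}"
  have Wf: "f \<in> W" and We: "\<And>\<alpha> w. \<alpha> \<in> P \<Longrightarrow> w \<in> W \<Longrightarrow> br (e \<alpha>) w \<in> W"
    unfolding W_def by blast+
  have Wind: "w \<in> W \<Longrightarrow> Q f \<Longrightarrow> (\<And>\<alpha> w. \<alpha> \<in> P \<Longrightarrow> w \<in> W \<Longrightarrow> Q w \<Longrightarrow> Q (br (e \<alpha>) w)) \<Longrightarrow> Q w" for Q w
  proof -
    assume w: "w \<in> W" and Q: "Q f" "\<And>\<alpha> w. \<alpha> \<in> P \<Longrightarrow> w \<in> W \<Longrightarrow> Q w \<Longrightarrow> Q (br (e \<alpha>) w)"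
    have "W \<subseteq> {w \<in> W. Q w}"
      by (subst W_def, rule Inter_lower) (use Q Wf We in blast)
    then show "Q w" using w by blast
  qed
  have Wwt: "\<exists>a. w \<in> rs a" if "w \<in> W" for w
    using that by (rule Wind) (use f rs_br e in blast)+
  have WH: "br h w \<in> span W" if "w \<in> W" "h \<in> H" for h w
  proof -
    obtain a where "w \<in> rs a" using Wwt \<open>w \<in> W\<close> by blast
    then have "br h w = sc (a h) w" using \<open>h \<in> H\<close> by (simp add: rs_iff)
    then show ?thesis using span_scale[OF span_base[OF \<open>w \<in> W\<close>]] by simp
  qed
  have Wpos: "br x w \<in> span W" if "w \<in> W" "\<alpha> \<in> P" "x \<in> rs \<alpha>" for x w \<alpha>
  proof -
    have "\<alpha> \<in> R" using that PR by blast
    then obtain c where "x = sc c (e \<alpha>)"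
      using root_space_one_dim[OF _ e(1)[OF \<open>\<alpha> \<in> P\<close>] e(2)[OF \<open>\<alpha> \<in> P\<close>] \<open>x \<in> rs \<alpha>\<close>] by blast
    then show ?thesis
      using span_scale[OF span_base[OF We[OF \<open>\<alpha> \<in> P\<close> \<open>w \<in> W\<close>]]] by (simp add: br_scale_left)
  qed
  have spanW: "br x w \<in> span W" if xW: "\<And>w. w \<in> W \<Longrightarrow> br x w \<in> span W" and w: "w \<in> span W" for x w
    using w
  proof (induction rule: span_induct_alt)
    case (step c y z)
    have "sc c (br x y) + br x z \<in> span W"
      by (rule span_add[OF span_scale[OF xW[OF step(1)]] step(2)])
    then show ?case by (simp only: br_add_right br_scale_right)
  qed (simp add: span_zero)
  \<comment> \<open>All negative roots are treated at once, because [x, e \<alpha>] may belong to a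
    different negative root. At \<open>f\<close> itself the bracket vanishes, as \<theta> + \<beta>
    is not a root.\<close>
  have Wneg: "\<forall>\<beta>\<in>P. \<forall>x\<in>rs (fneg \<beta>). br x w \<in> span W" if "w \<in> W" for w
    using that
  proof (rule Wind)
    show "\<forall>\<beta>\<in>P. \<forall>x\<in>rs (fneg \<beta>). br x f \<in> span W"
    proof (intro ballI)
      fix \<beta> x assume b: "\<beta> \<in> P" "x \<in> rs (fneg \<beta>)"
      have th: "\<theta> \<in> P" using hi by (simp add: highest_root_def)
      have br: "br x f \<in> rs (fneg (fadd \<theta> \<beta>))"
        using rs_br[OF b(2) f(1)] by (simp add: fadd_def fneg_def add.commute)
      have hd: "fneg (fadd \<theta> \<beta>) \<in> hdual sc H" using b th PR root_hdual hdual_fadd hdual_fneg by blast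
      have "br x f = 0"
      proof (rule ccontr)
        assume nz: "br x f \<noteq> 0"
        show False
        proof (cases "fneg (fadd \<theta> \<beta>) = (\<lambda>_. 0)")
          case True
          have "\<theta> z = - \<beta> z" for z
            using fun_cong[OF True, of z] unfolding fneg_def fadd_def by (simp only: eq_neg_iff_add_eq_0 neg_equal_0_iff_equal)
          then have "\<theta> = fneg \<beta>" by (simp add: fun_eq_iff fneg_def)
          then show False using b th P PR by (auto simp: pos_system_def)
        next
          case False
          then have "fneg (fadd \<theta> \<beta>) \<in> R" using br nz hd by (auto simp: roots_def)
          from root_neg[OF this] have "fadd \<theta> \<beta> \<in> R" by (simp only: fneg_fneg)
          then show False using hi b by (simp add: highest_root_def)
        qed
      qed
      then show "br x f \<in> span W" by (simp add: span_zero)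
    qed
  next
    fix \<alpha> w assume al: "\<alpha> \<in> P" and w: "w \<in> W" and IH: "\<forall>\<beta>\<in>P. \<forall>x\<in>rs (fneg \<beta>). br x w \<in> span W"
    show "\<forall>\<beta>\<in>P. \<forall>x\<in>rs (fneg \<beta>). br x (br (e \<alpha>) w) \<in> span W"
    proof (intro ballI)
      fix \<beta> x assume b: "\<beta> \<in> P" "x \<in> rs (fneg \<beta>)"
      define z where "z = br x (e \<alpha>)"
      have z: "z \<in> rs (fadd (fneg \<beta>) \<alpha>)" unfolding z_def by (rule rs_br[OF b(2) e(1)[OF al]])
      have hd: "fadd (fneg \<beta>) \<alpha> \<in> hdual sc H"
        using b al PR by (intro hdual_fadd hdual_fneg root_hdual) auto
      have "br z w \<in> span W"
      proof (cases "z = 0 \<or> fadd (fneg \<beta>) \<alpha> = (\<lambda>_. 0)")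
        case True
        then show ?thesis using rs_zero_H[OF _ z] WH[OF w] by (auto simp: span_zero)
      next
        case False
        then have r: "fadd (fneg \<beta>) \<alpha> \<in> R" using z hd by (auto simp: roots_def)
        show ?thesis
        proof (cases "fadd (fneg \<beta>) \<alpha> \<in> P")
          case True then show ?thesis using Wpos[OF w _ z] by blast
        next
          case False
          then have "fneg (fadd (fneg \<beta>) \<alpha>) \<in> P" using r P by (auto simp: pos_system_def)
          moreover have "z \<in> rs (fneg (fneg (fadd (fneg \<beta>) \<alpha>)))" using z by (simp add: fneg_fneg)
          ultimately show ?thesis using IH by blast
        qed
      qed
      moreover have "br (e \<alpha>) (br x w) \<in> span W"
        by (rule spanW[OF Wpos[OF _ al e(1)[OF al]]]) (use IH b in auto)
      moreover have "br x (br (e \<alpha>) w) = br z w + br (e \<alpha>) (br x w)" using ad_br[of x "e \<alpha>" w] by (simp add: z_def)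
      ultimately show "br x (br (e \<alpha>) w) \<in> span W" by (simp add: span_add)
    qed
  qed
  have "br x w \<in> span W" if w: "w \<in> span W" for x w
  proof -
    have "br x w \<in> span W" if x: "x \<in> H \<union> (\<Union>a\<in>R. rs a)" for x
    proof (rule spanW[OF _ w])
      fix w assume w: "w \<in> W"
      consider "x \<in> H" | a where "a \<in> P" "x \<in> rs a" | a where "fneg a \<in> P" "x \<in> rs (fneg (fneg a))"
      proof (cases "x \<in> H")
        case False
        then obtain a where "a \<in> R" "x \<in> rs a" using x by blast
        then show ?thesis using P that(2)[of a] that(3)[of a] fneg_fneg[of a] unfolding pos_system_def by metis
      qed (rule that(1))
      then show "br x w \<in> span W" using WH[OF w] Wpos[OF w] Wneg[OF w] by cases blast+
    qed
    then have "H \<union> (\<Union>a\<in>R. rs a) \<subseteq> {x. br x w \<in> span W}" by blast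
    moreover have "subspace {x. br x w \<in> span W}"
      by (auto simp: subspace_def br_add_left br_scale_left span_zero intro: span_add span_scale)
    ultimately show ?thesis using span_eqI_subspace[OF _ _ root_span] by blast
  qed
  then have "lie_ideal sc br (span W)" by (simp add: lie_ideal_def)
  moreover have "span W \<noteq> {0}" using Wf f(2) span_base[of f W] by blast
  ultimately have "span W = UNIV" using simple unfolding simple_lie_def by blast
  moreover have "span W \<subseteq> A"
    by (rule span_minimal[OF _ A(1)]) (use Wind[where Q = "\<lambda>w. w \<in> A"] A in blast)
  ultimately show ?thesis by blast
qed

end

section \<open>The shuffle ring of functions on words\<close>

text \<open>Functions on words form a commutative ring under the shuffle product, the product dual to the
  cocommutative coproduct of an enveloping algebra.\<close>

fun splits :: "'a list \<Rightarrow> ('a list \<times> 'a list) list" where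
  "splits [] = [([], [])]"
| "splits (y # w) = map (\<lambda>(u, v). (y # u, v)) (splits w) @ map (\<lambda>(u, v). (u, y # v)) (splits w)"

lemma splits_sum:
  fixes f :: "'a \<Rightarrow> nat"
  shows "(u, v) \<in> set (splits w) \<Longrightarrow> sum_list (map f u) + sum_list (map f v) = sum_list (map f w)"
  by (induction w arbitrary: u v) force+

lemma splits_length: "(u, v) \<in> set (splits w) \<Longrightarrow> length u + length v = length w"
  using splits_sum[of u v w "\<lambda>_. 1"] by (simp add: sum_list_triv)

text \<open>A type of its own, so that the ring operations can be those of the shuffle product
  instead of pointwise ones.\<close>

typedef 'a fnl = "UNIV :: ('a list \<Rightarrow> complex) set" morphisms ev Fnl ..

lemma ev_Fnl [simp]: "ev (Fnl f) = f"
  by (simp add: Fnl_inverse)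

lemma fnl_eqI: "(\<And>w. ev f w = ev g w) \<Longrightarrow> f = g"
  by (metis ev_inject ext)

text \<open>The right action of a letter. Letters are primitive for the coproduct, so this is a
  derivation of the shuffle product.\<close>

definition der :: "'a \<Rightarrow> 'a fnl \<Rightarrow> 'a fnl" where
  "der y f = Fnl (\<lambda>w. ev f (y # w))"

definition smul :: "complex \<Rightarrow> 'a fnl \<Rightarrow> 'a fnl" where
  "smul c f = Fnl (\<lambda>w. c * ev f w)"

lemma ev_der [simp]: "ev (der y f) w = ev f (y # w)"
  by (simp add: der_def)

lemma ev_smul [simp]: "ev (smul c f) w = c * ev f w"
  by (simp add: smul_def)

instantiation fnl :: (type) "{comm_ring_1}"
begin

definition "0 = Fnl (\<lambda>_. 0)"
definition "1 = Fnl (\<lambda>w. if w = [] then 1 else 0)"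
definition "f + g = Fnl (\<lambda>w. ev f w + ev g w)"
definition "f - g = Fnl (\<lambda>w. ev f w - ev g w)"
definition "- f = Fnl (\<lambda>w. - ev f w)"
definition "f * g = Fnl (\<lambda>w. \<Sum>(u, v)\<leftarrow>splits w. ev f u * ev g v)"

lemma ev_basic: "ev 0 w = 0" "ev 1 w = (if w = [] then 1 else 0)" "ev (f + g) w = ev f w + ev g w"
  "ev (f - g) w = ev f w - ev g w" "ev (- f) w = - ev f w"
  by (simp_all add: zero_fnl_def one_fnl_def plus_fnl_def minus_fnl_def uminus_fnl_def)

lemma ev_times: "ev (f * g) w = (\<Sum>(u, v)\<leftarrow>splits w. ev f u * ev g v)"
  by (simp add: times_fnl_def)

lemma ev_times_Nil: "ev (f * g) [] = ev f [] * ev g []"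
  by (simp add: ev_times)

lemma ev_times_Cons: "ev (f * g) (y # w) = ev (der y f * g) w + ev (f * der y g) w"
  by (simp add: ev_times case_prod_unfold comp_def)

lemma ev_times_add: "ev ((f + g) * h) w = ev (f * h) w + ev (g * h) w"
  "ev (h * (f + g)) w = ev (h * f) w + ev (h * g) w"
  by (simp_all add: ev_times ev_basic ring_distribs case_prod_unfold sum_list_addf)

lemma der_times: "der y (f * g) = der y f * g + f * der y g"
  by (rule fnl_eqI) (simp add: ev_times_Cons ev_basic)

instance
proof
  fix f g h :: "'a fnl"
  show "f * g = g * f"
  proof (rule fnl_eqI)
    fix w show "ev (f * g) w = ev (g * f) w"
      by (induction w arbitrary: f g) (simp_all add: ev_times_Nil ev_times_Cons mult.commute add.commute)
  qed
  show "(f * g) * h = f * (g * h)"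
  proof (rule fnl_eqI)
    fix w show "ev ((f * g) * h) w = ev (f * (g * h)) w"
      by (induction w arbitrary: f g h)
        (simp_all add: ev_times_Nil ev_times_Cons der_times ev_times_add)
  qed
  show "1 * f = f"
  proof (rule fnl_eqI)
    have d: "der y 1 = 0" for y :: 'a by (rule fnl_eqI) (simp add: ev_basic)
    have z: "ev (0 * f) w = 0" for f :: "'a fnl" and w
      by (simp add: ev_times ev_basic case_prod_unfold)
    fix w show "ev (1 * f) w = ev f w"
      by (induction w arbitrary: f) (simp_all add: ev_times_Nil ev_times_Cons d z ev_basic)
  qed
  show "(f + g) * h = f * h + g * h"
    by (rule fnl_eqI) (simp add: ev_times_add ev_basic)
  show "(0::'a fnl) \<noteq> 1"
    by (metis ev_basic(1,2) zero_neq_one)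
qed (auto intro!: fnl_eqI simp: ev_basic)

end

lemmas ev_ring [simp] = ev_basic

lemma ev_sum: "ev (\<Sum>i\<in>A. f i) w = (\<Sum>i\<in>A. ev (f i) w)"
  by (induction A rule: infinite_finite_induct) auto

lemma der_add: "der y (f + g) = der y f + der y g"
  and der_zero [simp]: "der y 0 = 0"
  and der_one [simp]: "der y 1 = 0"
  and der_smul: "der y (smul c f) = smul c (der y f)"
  by (auto intro!: fnl_eqI)

lemma smul_add_right: "smul c (f + g) = smul c f + smul c g"
  and smul_diff_right: "smul c (f - g) = smul c f - smul c g"
  and smul_add_left: "smul (c + d) f = smul c f + smul d f"
  and smul_smul: "smul c (smul d f) = smul (c * d) f"
  and smul_one [simp]: "smul 1 f = f"
  and smul_zero_left [simp]: "smul 0 f = 0"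
  and smul_zero_right [simp]: "smul c 0 = 0"
  and smul_minus: "smul (- c) f = - smul c f"
  by (auto intro!: fnl_eqI simp: algebra_simps)

lemma smul_mult_left: "smul c f * g = smul c (f * g)"
  by (rule fnl_eqI)
    (simp add: ev_times case_prod_unfold mult.assoc sum_list_const_mult)

lemma smul_mult_right: "f * smul c g = smul c (f * g)"
  using smul_mult_left[of c g f] by (simp add: mult.commute)

lemma smul_of_nat: "smul (of_nat n) f = of_nat n * f"
  by (induction n) (simp_all add: smul_add_left algebra_simps)

text \<open>The annihilator of all words shorter than \<open>r\<close>; inside the functionals on
  the vacuum module this is the filtration dual to PBW degree.\<close>

definition low :: "nat \<Rightarrow> 'a fnl set" where
  "low r = {f. \<forall>w. length w < r \<longrightarrow> ev f w = 0}"

lemma low_0 [simp]: "f \<in> low 0"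
  by (simp add: low_def)

lemma low_zero [simp]: "0 \<in> low r"
  by (simp add: low_def)

lemma low_add: "f \<in> low r \<Longrightarrow> g \<in> low r \<Longrightarrow> f + g \<in> low r"
  and low_smul: "f \<in> low r \<Longrightarrow> smul c f \<in> low r"
  by (simp_all add: low_def)

lemma low_mono: "f \<in> low r \<Longrightarrow> s \<le> r \<Longrightarrow> f \<in> low s"
  by (auto simp: low_def)

lemma low_mult: "f \<in> low r \<Longrightarrow> g \<in> low s \<Longrightarrow> f * g \<in> low (r + s)"
  unfolding low_def
proof (intro CollectI allI impI)
  fix w :: "'a list" assume f: "f \<in> {f. \<forall>w. length w < r \<longrightarrow> ev f w = 0}"
    and g: "g \<in> {f. \<forall>w. length w < s \<longrightarrow> ev f w = 0}" and w: "length w < r + s"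
  have "ev f u * ev g v = 0" if "(u, v) \<in> set (splits w)" for u v
    using splits_length[OF that] w f g by (cases "length u < r") auto
  then have *: "map (\<lambda>(u, v). ev f u * ev g v) (splits w) = map (\<lambda>_. 0) (splits w)" by auto
  show "ev (f * g) w = 0" by (simp only: ev_times * sum_list_0)
qed

lemma low_der: "f \<in> low (Suc r) \<Longrightarrow> der y f \<in> low r"
  by (simp add: low_def)

lemma low_power: "f \<in> low 1 \<Longrightarrow> f ^ d \<in> low d"
  using low_mult[of f 1] by (induction d) auto

section \<open>The right action of the current algebra on functionals\<close>

text \<open>A letter \<open>(x, n)\<close> stands for the negative mode \<open>x(-n-1)\<close>.\<close>

definition wt :: "('g \<times> nat) list \<Rightarrow> nat" where
  "wt w = (\<Sum>p\<leftarrow>w. snd p + 1)"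

lemma wt_simps [simp]: "wt [] = 0" "wt (p # w) = snd p + 1 + wt w"
  by (simp_all add: wt_def)

lemma wt_0: "wt w = 0 \<longleftrightarrow> w = []"
  by (cases w) auto

lemma length_le_wt: "length w \<le> wt w"
  by (induction w) auto

lemma splits_wt: "(u, v) \<in> set (splits w) \<Longrightarrow> wt u + wt v = wt w"
  unfolding wt_def by (rule splits_sum)

lemma ev_times_eqI:
  assumes "\<And>u v. (u, v) \<in> set (splits w) \<Longrightarrow> ev f u * ev g v = ev f' u * ev g' v"
  shows "ev (f * g) w = ev (f' * g') w"
proof -
  have "map (\<lambda>(u, v). ev f u * ev g v) (splits w) = map (\<lambda>(u, v). ev f' u * ev g' v) (splits w)"
    using assms by auto
  then show ?thesis by (simp only: ev_times)
qed

lemma ev_times_0I: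
  assumes "\<And>u v. (u, v) \<in> set (splits w) \<Longrightarrow> ev f u * ev g v = 0"
  shows "ev (f * g) w = 0"
  using ev_times_eqI[of w f g 0 0] assms by simp

text \<open>The value of \<open>\<psi>\<close> on x(m) w: a negative mode is one more letter, a
  nonnegative mode is commuted to the right until it meets the vacuum and gives zero. The last
  summand is the central term, with the form \<open>K\<close> at level \<open>l\<close>.\<close>

primrec actw :: "('g \<Rightarrow> 'g \<Rightarrow> 'g) \<Rightarrow> ('g \<Rightarrow> 'g \<Rightarrow> complex) \<Rightarrow> complex \<Rightarrow> ('g \<times> nat) list \<Rightarrow>
    (('g \<times> nat) list \<Rightarrow> complex) \<Rightarrow> 'g \<Rightarrow> int \<Rightarrow> complex" where
  "actw br K l [] \<psi> x m = (if m < 0 then \<psi> [(x, nat (- m - 1))] else 0)"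
| "actw br K l (p # w) \<psi> x m = (if m < 0 then \<psi> ((x, nat (- m - 1)) # p # w)
    else actw br K l w (\<lambda>u. \<psi> (p # u)) x m + actw br K l w \<psi> (br x (fst p)) (m - int (snd p) - 1)
      + (if m = int (snd p) + 1 then l * of_int m * K x (fst p) * \<psi> w else 0))"

text \<open>The value of \<open>\<psi>\<close> on L_{-1} w, by the rule [L_{-1}, x(-n-1)] = (n+1)
  x(-n-2) applied to each letter.\<close>

primrec translatew :: "('g \<times> nat) list \<Rightarrow> (('g \<times> nat) list \<Rightarrow> complex) \<Rightarrow> complex" where
  "translatew [] \<psi> = 0"
| "translatew (p # w) \<psi> = of_nat (snd p + 1) * \<psi> ((fst p, snd p + 1) # w) + translatew w (\<lambda>u. \<psi> (p # u))"

definition translate :: "('g \<times> nat) fnl \<Rightarrow> ('g \<times> nat) fnl" where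
  "translate f = Fnl (\<lambda>w. translatew w (ev f))"

lemma translate_Nil: "ev (translate f) [] = 0"
  by (simp add: translate_def)

lemma der_translate: "der (x, n) (translate f) = translate (der (x, n) f) + smul (of_nat (n + 1)) (der (x, n + 1) f)"
  by (rule fnl_eqI) (simp add: translate_def der_def)

lemma ev_translate_Cons:
  "ev (translate f) ((x, n) # w) = ev (translate (der (x, n) f)) w + of_nat (n + 1) * ev f ((x, n + 1) # w)"
  using arg_cong[OF der_translate[of x n f], of "\<lambda>f. ev f w"] by simp

lemma translate_add: "translate (f + g) = translate f + translate g"
proof (rule fnl_eqI)
  fix w show "ev (translate (f + g)) w = ev (translate f + translate g) w"
  proof (induction w arbitrary: f g)
    case (Cons p w)
    then show ?case by (cases p) (simp add: ev_translate_Cons der_add algebra_simps)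
  qed (simp add: translate_Nil)
qed

lemma translate_smul: "translate (smul c f) = smul c (translate f)"
proof (rule fnl_eqI)
  fix w show "ev (translate (smul c f)) w = ev (smul c (translate f)) w"
  proof (induction w arbitrary: f)
    case (Cons p w)
    then show ?case by (cases p) (simp add: ev_translate_Cons der_smul algebra_simps)
  qed (simp add: translate_Nil)
qed

lemma translate_zero: "translate 0 = 0"
  using translate_add[of 0 0] by simp

lemma translate_times: "translate (f * g) = translate f * g + f * translate g"
proof (rule fnl_eqI)
  fix w show "ev (translate (f * g)) w = ev (translate f * g + f * translate g) w"
  proof (induction w arbitrary: f g)
    case (Cons p w)
    obtain x n where p: "p = (x, n)" by force
    show ?case
      by (simp add: p ev_translate_Cons der_times translate_add Cons ev_times_Cons der_translate ev_times_add
        smul_mult_left smul_mult_right algebra_simps)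
  qed (simp add: translate_Nil ev_times_Nil)
qed

lemma translate_one: "translate 1 = 0"
  using translate_times[of 1 1] by simp

lemma translate_weight:
  assumes "\<And>u. wt u = wt w + 1 \<Longrightarrow> ev f u = 0"
  shows "ev (translate f) w = 0"
  using assms
proof (induction w arbitrary: f)
  case (Cons p w)
  have "ev (translate (der p f)) w = 0" by (rule Cons.IH) (simp add: Cons.prems)
  then show ?case using Cons.prems[of "(fst p, snd p + 1) # w"] by (cases p) (simp add: ev_translate_Cons)
qed (simp add: translate_Nil)

context fd_lie
begin

text \<open>The level \<open>l\<close> is relative to the Killing form, that is, \<open>l = k / (2 h)\<close>.\<close>
definition act :: "complex \<Rightarrow> 'g \<Rightarrow> int \<Rightarrow> ('g \<times> nat) fnl \<Rightarrow> ('g \<times> nat) fnl" where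
  "act l x m f = Fnl (\<lambda>w. actw br kap l w (ev f) x m)"

text \<open>The scalar by which the central part of [x(m), y(n)] acts.\<close>

definition cc :: "complex \<Rightarrow> 'g \<Rightarrow> int \<Rightarrow> 'g \<Rightarrow> int \<Rightarrow> complex" where
  "cc l x m y n = (if m + n = 0 then l * of_int m * kap x y else 0)"

lemma act_neg: "m < 0 \<Longrightarrow> act l x m f = der (x, nat (- m - 1)) f"
proof (rule fnl_eqI)
  fix w assume "m < 0"
  then show "ev (act l x m f) w = ev (der (x, nat (- m - 1)) f) w"
    by (cases w) (simp_all add: act_def)
qed

lemma act_minus: "act l x (- int n - 1) f = der (x, n) f"
  by (subst act_neg) auto

lemma act_Nil: "m \<ge> 0 \<Longrightarrow> ev (act l x m f) [] = 0"
  by (simp add: act_def)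

lemma der_act_nonneg:
  assumes "m \<ge> 0"
  shows "der (y, n) (act l x m f) = act l x m (der (y, n) f) + act l (br x y) (m - int n - 1) f
    + smul (cc l x m y (- int n - 1)) f"
  by (rule fnl_eqI) (use assms in \<open>auto simp: act_def der_def cc_def\<close>)

lemma act_Cons:
  assumes "m \<ge> 0"
  shows "ev (act l x m f) ((y, n) # w) = ev (act l x m (der (y, n) f)) w + ev (act l (br x y) (m - int n - 1) f) w
    + cc l x m y (- int n - 1) * ev f w"
  using arg_cong[OF der_act_nonneg[OF assms, of y n l x f], of "\<lambda>f. ev f w"] by simp

lemma act_add: "act l x m (f + g) = act l x m f + act l x m g"
proof (rule fnl_eqI)
  fix w show "ev (act l x m (f + g)) w = ev (act l x m f + act l x m g) w"
  proof (induction w arbitrary: f g x m)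
    case Nil then show ?case by (cases "m < 0") (auto simp: act_neg act_Nil)
  next
    case (Cons p w)
    then show ?case
      by (cases p; cases "m < 0") (auto simp: act_neg act_Cons der_add algebra_simps)
  qed
qed

lemma act_smul: "act l x m (smul c f) = smul c (act l x m f)"
proof (rule fnl_eqI)
  fix w show "ev (act l x m (smul c f)) w = ev (smul c (act l x m f)) w"
  proof (induction w arbitrary: f x m)
    case Nil then show ?case by (cases "m < 0") (auto simp: act_neg act_Nil)
  next
    case (Cons p w)
    then show ?case
      by (cases p; cases "m < 0") (auto simp: act_neg act_Cons der_smul algebra_simps)
  qed
qed

lemma act_zero [simp]: "act l x m 0 = 0"
  using act_add[of l x m 0 0] by simp

text \<open>The functionals that factor through the enveloping algebra of \<open>t\<^sup>-\<^sup>1 g[t\<^sup>-\<^sup>1]\<close>.\<close>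

definition frel :: "('g \<times> nat) fnl \<Rightarrow> bool" where
  "frel f \<longleftrightarrow> (\<forall>x y n. der (x + y, n) f = der (x, n) f + der (y, n) f)
    \<and> (\<forall>c x n. der (sc c x, n) f = smul c (der (x, n) f))
    \<and> (\<forall>x n y m. der (y, m) (der (x, n) f) = der (x, n) (der (y, m) f) + der (br x y, n + m + 1) f)"

text \<open>\<open>frel\<close> speaks only about the first letters of a word; removing an arbitrary
  prefix beforehand imposes the relations at every position.\<close>

definition F :: "('g \<times> nat) fnl set" where
  "F = {f. \<forall>u. frel (fold der u f)}"

lemma F_frel:
  assumes "f \<in> F" shows "frel f"
proof -
  have "frel (fold der [] f)" using assms unfolding F_def by blast
  then show ?thesis by simp
qed

lemma F_der:
  assumes "f \<in> F" shows "der y f \<in> F"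
proof -
  have "frel (fold der (y # u) f)" for u using assms unfolding F_def by blast
  then show ?thesis by (simp add: F_def)
qed

lemma der_letter_add: "f \<in> F \<Longrightarrow> der (x + y, n) f = der (x, n) f + der (y, n) f"
  and der_letter_scale: "f \<in> F \<Longrightarrow> der (sc c x, n) f = smul c (der (x, n) f)"
  and der_der: "f \<in> F \<Longrightarrow> der (y, m) (der (x, n) f) = der (x, n) (der (y, m) f) + der (br x y, n + m + 1) f"
  using F_frel unfolding frel_def by blast+

lemma der_letter_zero: "f \<in> F \<Longrightarrow> der (0, n) f = 0"
  using der_letter_scale[of f 0 0 n] by simp

lemma frelD:
  assumes "frel f"
  shows "der (x + y, n) f = der (x, n) f + der (y, n) f"
    "der (sc c x, n) f = smul c (der (x, n) f)"
    "der (y, m) (der (x, n) f) = der (x, n) (der (y, m) f) + der (br x y, n + m + 1) f"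
  using assms unfolding frel_def by blast+

lemma frelI:
  assumes "\<And>x y n. der (x + y, n) f = der (x, n) f + der (y, n) f"
    "\<And>c x n. der (sc c x, n) f = smul c (der (x, n) f)"
    "\<And>x n y m. der (y, m) (der (x, n) f) = der (x, n) (der (y, m) f) + der (br x y, n + m + 1) f"
  shows "frel f"
  using assms unfolding frel_def by blast

lemma der_letter_sum: "f \<in> F \<Longrightarrow> der (\<Sum>i\<in>A. g i, n) f = (\<Sum>i\<in>A. der (g i, n) f)"
  by (induction A rule: infinite_finite_induct) (auto simp: der_letter_zero der_letter_add)

lemma frel_add:
  assumes f: "frel f" and g: "frel g" shows "frel (f + g)"
proof (rule frelI)
  fix x n y m
  show "der (y, m) (der (x, n) (f + g)) = der (x, n) (der (y, m) (f + g)) + der (br x y, n + m + 1) (f + g)"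
    using frelD(3)[OF f, of y m x n] frelD(3)[OF g, of y m x n] by (simp add: der_add)
qed (simp_all add: der_add frelD(1,2)[OF f] frelD(1,2)[OF g] smul_add_right)

lemma frel_smul:
  assumes f: "frel f" shows "frel (smul c f)"
proof (rule frelI)
  fix x n y m
  show "der (y, m) (der (x, n) (smul c f)) = der (x, n) (der (y, m) (smul c f)) + der (br x y, n + m + 1) (smul c f)"
    using frelD(3)[OF f, of y m x n] by (simp add: der_smul smul_add_right)
qed (simp_all add: der_smul frelD(1,2)[OF f] smul_add_right smul_smul mult.commute)

lemma frel_zero: "frel 0"
  by (simp add: frel_def)

lemma fold_der_add: "fold der u (f + g) = fold der u f + fold der u g"
  by (induction u arbitrary: f g) (auto simp: der_add)

lemma fold_der_smul: "fold der u (smul c f) = smul c (fold der u f)"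
  by (induction u arbitrary: f) (auto simp: der_smul)

lemma F_add: "f \<in> F \<Longrightarrow> g \<in> F \<Longrightarrow> f + g \<in> F"
  by (simp add: F_def fold_der_add frel_add)

lemma F_smul: "f \<in> F \<Longrightarrow> smul c f \<in> F"
  by (simp add: F_def fold_der_smul frel_smul)

lemma F_zero [simp]: "0 \<in> F"
proof -
  have "fold der u 0 = 0" for u :: "('g \<times> nat) list" by (induction u) auto
  then show ?thesis by (simp add: F_def frel_zero)
qed

lemma F_diff: "f \<in> F \<Longrightarrow> g \<in> F \<Longrightarrow> f - g \<in> F"
  using F_add[of f "smul (- 1) g"] F_smul[of g "- 1"] by (simp add: smul_minus)

lemma F_sum: "(\<And>i. i \<in> A \<Longrightarrow> f i \<in> F) \<Longrightarrow> (\<Sum>i\<in>A. f i) \<in> F"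
  by (induction A rule: infinite_finite_induct) (auto intro: F_add)

lemma F_I:
  assumes "frel f" "\<And>y. der y f \<in> F"
  shows "f \<in> F"
  unfolding F_def
proof (intro CollectI allI)
  fix u show "frel (fold der u f)"
    using assms by (cases u) (auto simp: F_def)
qed

lemma F_one [simp]: "1 \<in> F"
  by (rule F_I) (simp_all add: frel_def)

lemma F_times:
  assumes "f \<in> F" "g \<in> F"
  shows "f * g \<in> F"
proof -
  have "frel (fold der u (f * g))" if "f \<in> F" "g \<in> F" for u f g
    using that
  proof (induction u arbitrary: f g)
    case Nil
    note f = Nil(1) and g = Nil(2)
    have "frel (f * g)"
    proof (rule frelI)
      fix x n y m
      show "der (y, m) (der (x, n) (f * g)) = der (x, n) (der (y, m) (f * g)) + der (br x y, n + m + 1) (f * g)"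
        using der_der[OF f, of y m x n] der_der[OF g, of y m x n]
        by (simp add: der_times der_add algebra_simps)
    qed (simp_all add: der_times der_letter_add[OF f] der_letter_add[OF g] der_letter_scale[OF f]
        der_letter_scale[OF g] smul_mult_left smul_mult_right smul_add_right algebra_simps)
    then show ?case by simp
  next
    case (Cons y u)
    then show ?case by (simp add: der_times fold_der_add frel_add F_der)
  qed
  then show ?thesis using assms by (simp add: F_def)
qed

lemma F_power: "f \<in> F \<Longrightarrow> f ^ d \<in> F"
  by (induction d) (auto intro: F_times)

lemma act_letter_add:
  assumes "f \<in> F" shows "act l (x + y) m f = act l x m f + act l y m f"
proof (rule fnl_eqI)
  fix w show "ev (act l (x + y) m f) w = ev (act l x m f + act l y m f) w"
    using assms
  proof (induction w arbitrary: f x y m)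
    case Nil then show ?case by (cases "m < 0") (auto simp: act_neg act_Nil der_letter_add simp del: ev_der)
  next
    case (Cons p w)
    obtain z n where p: "p = (z, n)" by force
    show ?case
    proof (cases "m < 0")
      case True then show ?thesis using Cons.prems by (simp add: act_neg der_letter_add del: ev_der)
    next
      case False
      have "cc l (x + y) m z k = cc l x m z k + cc l y m z k" for k
        by (simp add: cc_def kap_add_left algebra_simps)
      then show ?thesis using False Cons.IH[of "der p f"] Cons.IH[of f] Cons.prems F_der
        by (simp add: p act_Cons br_add_left algebra_simps)
    qed
  qed
qed

lemma act_letter_scale:
  assumes "f \<in> F" shows "act l (sc c x) m f = smul c (act l x m f)"
proof (rule fnl_eqI)
  fix w show "ev (act l (sc c x) m f) w = ev (smul c (act l x m f)) w"
    using assms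
  proof (induction w arbitrary: f x m)
    case Nil then show ?case by (cases "m < 0") (auto simp: act_neg act_Nil der_letter_scale simp del: ev_der)
  next
    case (Cons p w)
    obtain z n where p: "p = (z, n)" by force
    show ?case
    proof (cases "m < 0")
      case True then show ?thesis using Cons.prems by (simp add: act_neg der_letter_scale del: ev_der)
    next
      case False
      have "cc l (sc c x) m z k = c * cc l x m z k" for k
        by (simp add: cc_def kap_scale_left)
      then show ?thesis using False Cons.IH[of "der p f"] Cons.IH[of f] Cons.prems F_der
        by (simp add: p act_Cons br_scale_left algebra_simps)
    qed
  qed
qed

lemma act_letter_zero: "f \<in> F \<Longrightarrow> act l 0 m f = 0"
  using act_letter_scale[of f l 0 0 m] by simp

lemma act_letter_sum: "f \<in> F \<Longrightarrow> act l (\<Sum>i\<in>A. g i) m f = (\<Sum>i\<in>A. act l (g i) m f)"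
  by (induction A rule: infinite_finite_induct) (auto simp: act_letter_zero act_letter_add)

lemma act_letter_diff: "f \<in> F \<Longrightarrow> act l (x - y) m f = act l x m f - act l y m f"
  using act_letter_add[of f l "x - y" y m] by (simp add: algebra_simps)

lemma act_letter_minus: "f \<in> F \<Longrightarrow> act l (- y) m f = - act l y m f"
  using act_letter_diff[of f l 0 y m] act_letter_zero by simp

lemma der_act:
  assumes f: "f \<in> F"
  shows "der (y, n) (act l x m f) = act l x m (der (y, n) f) + act l (br x y) (m - int n - 1) f
    + smul (cc l x m y (- int n - 1)) f"
proof (cases "m < 0")
  case True
  have *: "nat (- (m - int n - 1) - 1) = nat (- m - 1) + n + 1" using True by linarith
  have a: "act l (br x y) (m - int n - 1) f = der (br x y, nat (- m - 1) + n + 1) f"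
    unfolding *[symmetric] by (rule act_neg) (use True in simp)
  show ?thesis unfolding a using True der_der[OF f, of y n x "nat (- m - 1)"]
    by (simp add: act_neg cc_def)
qed (simp add: der_act_nonneg)

lemma F_act:
  assumes "f \<in> F" shows "act l x m f \<in> F"
proof -
  have "frel (fold der u (act l x m f))" if "f \<in> F" for u f x m
    using that
  proof (induction u arbitrary: f x m)
    case Nil
    note f = Nil and fd = F_der[OF Nil]
    have 1: "cc l x m (y + z) k = cc l x m y k + cc l x m z k" "cc l x m (sc c y) k = c * cc l x m y k" for y z c k
      by (simp_all add: cc_def kap_add_right kap_scale_right algebra_simps)
    \<comment> \<open>The cocycle identity of the central term, from invariance of the Killing form;
      the next fact is the Jacobi identity.\<close>
    have 2: "cc l (br x z) (m - int n - 1) y (- int k - 1) = cc l (br x y) (m - int k - 1) z (- int n - 1)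
      + cc l x m (br z y) (- int (n + k + 1) - 1)" for y z n k
    proof -
      have "kap (br x z) y = kap x (br z y)" "kap (br x y) z = - kap x (br z y)"
        using br_anti[of y z] kap_scale_right[of x "-1" "br z y"] by (simp_all add: kap_invariant)
      then show ?thesis by (auto simp: cc_def algebra_simps)
    qed
    have 3: "br (br x z) y = br (br x y) z + br x (br z y)" for z y
      using ad_br[of x z y] br_anti[of z "br x y"] by simp
    have 4: "m - int n - 1 - int k - 1 = m - int k - 1 - int n - 1"
       "m - int (n + k + 1) - 1 = m - int k - 1 - int n - 1" for n k by auto
    show ?case
      unfolding fold_simps
    proof (rule frelI)
      fix y z n show "der (y + z, n) (act l x m f) = der (y, n) (act l x m f) + der (z, n) (act l x m f)"
        by (simp add: der_act[OF f] der_letter_add[OF f] act_letter_add[OF f] act_add br_add_right 1 smul_add_left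
          algebra_simps)
    next
      fix c y n show "der (sc c y, n) (act l x m f) = smul c (der (y, n) (act l x m f))"
        by (simp add: der_act[OF f] der_letter_scale[OF f] act_letter_scale[OF f] act_smul br_scale_right 1
          smul_smul smul_add_right)
    next
      fix z n y k
      show "der (y, k) (der (z, n) (act l x m f)) =
        der (z, n) (der (y, k) (act l x m f)) + der (br z y, n + k + 1) (act l x m f)"
        unfolding der_act[OF f] der_add der_smul der_act[OF fd] der_der[OF f, of y k z n] act_add 4
          2[of z n y k] 3[of z y] act_letter_add[OF f] smul_add_left
        by (simp add: algebra_simps)
    qed
  next
    case (Cons p u)
    obtain y n where p: "p = (y, n)" by force
    have "frel (fold der u f)" using Cons.prems by (simp add: F_def)
    then show ?case using Cons.IH Cons.prems F_der
      by (simp add: p der_act fold_der_add fold_der_smul frel_add frel_smul)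
  qed
  then show ?thesis using assms by (simp add: F_def)
qed

text \<open>\<open>act\<close> is a right action: \<open>act l y n (act l x m f)\<close> is \<open>f\<close> precomposed with \<open>x(m) y(n)\<close>.\<close>
lemma act_commute:
  assumes "f \<in> F"
  shows "act l y n (act l x m f) = act l x m (act l y n f) + act l (br x y) (m + n) f + smul (cc l x m y n) f"
proof -
  \<comment> \<open>Three ranges of modes: n < 0 is the rule for \<open>der\<close>, m < 0 follows
    by exchanging the two modes, and two nonnegative modes are handled by induction on the
    word.\<close>
  have A: "act l y n (act l x m f) = act l x m (act l y n f) + act l (br x y) (m + n) f + smul (cc l x m y n) f"
    if f: "f \<in> F" and n: "n < 0" for f x m y n
  proof -
    have "n = - int (nat (- n - 1)) - 1" using n by simp
    then obtain k where k: "n = - int k - 1" by blast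
    show ?thesis using der_act[OF f, of y k l x m] by (simp only: k act_minus) (simp add: algebra_simps)
  qed
  have cc_anti: "cc l x m y n = - cc l y n x m" for x m y n
  proof (cases "m + n = 0")
    case True
    then have "n = - m" by simp
    then show ?thesis by (simp add: cc_def kap_comm[of x y])
  qed (simp add: cc_def add.commute)
  have B: "act l y n (act l x m f) = act l x m (act l y n f) + act l (br x y) (m + n) f + smul (cc l x m y n) f"
    if f: "f \<in> F" and mn: "m < 0 \<or> n < 0" for f x m y n
  proof (cases "n < 0")
    case False
    then have "act l x m (act l y n f) = act l y n (act l x m f) + act l (br y x) (n + m) f + smul (cc l y n x m) f"
      using A[OF f] mn by blast
    then show ?thesis
      using br_anti[of y x] cc_anti[of x m y n]
      by (simp add: act_letter_minus[OF f] smul_minus algebra_simps)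
  qed (rule A[OF f])
  have "ev (act l y n (act l x m f)) w = ev (act l x m (act l y n f)) w + ev (act l (br x y) (m + n) f) w
    + cc l x m y n * ev f w" if "f \<in> F" for w f x m y n
    using that
  proof (induction w arbitrary: f x m y n)
    case Nil
    show ?case
    proof (cases "m < 0 \<or> n < 0")
      case True then show ?thesis by (subst B[OF Nil True]) simp
    qed (auto simp: act_Nil cc_def)
  next
    case (Cons p w)
    obtain z k where p: "p = (z, k)" by force
    show ?case
    proof (cases "m < 0 \<or> n < 0")
      case True then show ?thesis by (subst B[OF Cons.prems True]) simp
    next
      case False
      then have mn: "m \<ge> 0" "n \<ge> 0" "m + n \<ge> 0" by auto
      note f = Cons.prems
      have T1: "ev (act l y n (act l x m (der p f))) w = ev (act l x m (act l y n (der p f))) w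
          + ev (act l (br x y) (m + n) (der p f)) w + cc l x m y n * ev (der p f) w"
        by (rule Cons.IH[OF F_der[OF f]])
      have T2: "ev (act l y n (act l (br x z) (m - int k - 1) f)) w = ev (act l (br x z) (m - int k - 1) (act l y n f)) w
          + ev (act l (br (br x z) y) (m - int k - 1 + n) f) w + cc l (br x z) (m - int k - 1) y n * ev f w"
        by (rule Cons.IH[OF f])
      have T3: "ev (act l (br y z) (n - int k - 1) (act l x m f)) w = ev (act l x m (act l (br y z) (n - int k - 1) f)) w
          + ev (act l (br x (br y z)) (m + (n - int k - 1)) f) w + cc l x m (br y z) (n - int k - 1) * ev f w"
        by (rule Cons.IH[OF f])
      have L: "ev (act l y n (act l x m f)) (p # w) =
          ev (act l y n (act l x m (der p f))) w + ev (act l y n (act l (br x z) (m - int k - 1) f)) w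
          + cc l x m z (- int k - 1) * ev (act l y n f) w
          + ev (act l (br y z) (n - int k - 1) (act l x m f)) w + cc l y n z (- int k - 1) * ev (act l x m f) w"
        unfolding p by (simp add: act_Cons[OF mn(2)] der_act[OF f] act_add act_smul)
      have R: "ev (act l x m (act l y n f)) (p # w) =
          ev (act l x m (act l y n (der p f))) w + ev (act l x m (act l (br y z) (n - int k - 1) f)) w
          + cc l y n z (- int k - 1) * ev (act l x m f) w
          + ev (act l (br x z) (m - int k - 1) (act l y n f)) w + cc l x m z (- int k - 1) * ev (act l y n f) w"
        unfolding p by (simp add: act_Cons[OF mn(1)] der_act[OF f] act_add act_smul)
      have M: "ev (act l (br x y) (m + n) f) (p # w) = ev (act l (br x y) (m + n) (der p f)) w
          + ev (act l (br (br x y) z) (m + n - int k - 1) f) w + cc l (br x y) (m + n) z (- int k - 1) * ev f w"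
        unfolding p by (rule act_Cons[OF mn(3)])
      \<comment> \<open>What is left after expanding along the first letter cancels by the Jacobi
        identity (\<open>J\<close>) and the cocycle identity (\<open>K\<close>).\<close>
      have "br (br x y) z = br (br x z) y + br x (br y z)"
        using ad_br[of x y z] br_anti[of y "br x z"] by simp
      then have J: "ev (act l (br (br x y) z) (m + n - int k - 1) f) w =
          ev (act l (br (br x z) y) (m - int k - 1 + n) f) w + ev (act l (br x (br y z)) (m + (n - int k - 1)) f) w"
        using act_letter_add[OF f, of l "br (br x z) y" "br x (br y z)" "m + n - int k - 1"]
        by (simp add: algebra_simps)
      have "kap (br x y) z = kap x (br y z)" "kap (br x z) y = - kap x (br y z)"
        using br_anti[of z y] kap_scale_right[of x "-1" "br y z"] by (simp_all add: kap_invariant)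
      then have K: "cc l (br x y) (m + n) z (- int k - 1) =
          cc l (br x z) (m - int k - 1) y n + cc l x m (br y z) (n - int k - 1)"
        by (auto simp: cc_def algebra_simps)
      show ?thesis unfolding L R M T1 T2 T3 J K by (simp add: algebra_simps)
    qed
  qed
  note X = this[OF assms]
  show ?thesis by (rule fnl_eqI, unfold ev_ring ev_smul, rule X)
qed

text \<open>The product is dual to the map from the vacuum module of level \<open>l + l'\<close> to
  the tensor product of those of levels \<open>l\<close> and \<open>l'\<close>, where a current acts
  by the sum of its two actions. With \<open>l' = 0\<close> a power of \<eta> can be separated from
  a general functional.\<close>

lemma act_times:
  assumes "m \<ge> 0"
  shows "act (l + l') x m (f * g) = act l x m f * g + f * act l' x m g"
proof (rule fnl_eqI)
  fix w show "ev (act (l + l') x m (f * g)) w = ev (act l x m f * g + f * act l' x m g) w"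
  proof (induction w arbitrary: f g x m)
    case Nil
    then show ?case by (cases "m < 0") (auto simp: act_neg act_Nil ev_times_Nil der_times simp del: ev_der)
  next
    case (Cons p w)
    obtain z k where p: "p = (z, k)" by force
    show ?case
    proof (cases "m < 0")
      case True then show ?thesis by (simp add: act_neg der_times del: ev_der)
    next
      case False
      have "cc (l + l') x m z n = cc l x m z n + cc l' x m z n" for n by (simp add: cc_def algebra_simps)
      then show ?thesis
        using False Cons.IH[of x m "der p f" g] Cons.IH[of x m f "der p g"] Cons.IH[of "br x z" "m - int k - 1" f g]
        by (simp add: p act_Cons der_times act_add ev_times_Cons der_act_nonneg ev_times_add
          smul_mult_left smul_mult_right distrib_right add_ac)
    qed
  qed
qed

text \<open>Commuting a nonnegative mode to the vacuum never lengthens a word.\<close>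

lemma act_low:
  assumes m: "m \<ge> 0" and f: "f \<in> low s"
  shows "act l x m f \<in> low s"
proof -
  have "ev (act l x m f) w = 0" if "m \<ge> 0" "\<And>u. length u \<le> length w \<Longrightarrow> ev f u = 0" for w f x m
    using that
  proof (induction w arbitrary: f x m)
    case Nil then show ?case by (simp add: act_Nil)
  next
    case (Cons p w)
    obtain z k where p: "p = (z, k)" by force
    have "ev (act l (br x z) (m - int k - 1) f) w = 0"
      using Cons.IH[of "m - int k - 1" f] Cons.prems by (cases "m - int k - 1 < 0") (auto simp: act_neg)
    moreover have "ev (act l x m (der p f)) w = 0" by (rule Cons.IH) (use Cons.prems in auto)
    ultimately show ?case using Cons.prems by (simp add: p act_Cons)
  qed
  then show ?thesis using m f by (simp add: low_def)
qed

text \<open>Commuting x(0) through a word produces no central term, and the brackets that arise are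
  negative modes, which do not see the level.\<close>

lemma act_level_zero: "act l x 0 f = act l' x 0 f"
proof (rule fnl_eqI)
  fix w show "ev (act l x 0 f) w = ev (act l' x 0 f) w"
    by (induction w arbitrary: f) (auto simp: act_Nil act_Cons act_neg cc_def)
qed

lemma act_zero_times: "act l x 0 (f * g) = act l x 0 f * g + f * act l x 0 g"
  using act_times[of 0 l 0 x f g] act_level_zero[of 0 x g l] by simp

lemma act_weight:
  assumes "\<And>u. int (wt u) = int (wt w) - m \<Longrightarrow> ev f u = 0"
  shows "ev (act l x m f) w = 0"
  using assms
proof (induction w arbitrary: f x m)
  case Nil then show ?case by (cases "m < 0") (auto simp: act_neg act_Nil)
next
  case (Cons p w)
  obtain z k where p: "p = (z, k)" by force
  have 1: "ev (act l x m (der p f)) w = 0" by (rule Cons.IH) (use Cons.prems in \<open>auto simp: p\<close>)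
  have 2: "ev (act l (br x z) (m - int k - 1) f) w = 0" by (rule Cons.IH) (use Cons.prems in \<open>auto simp: p\<close>)
  have 3: "m = int k + 1 \<Longrightarrow> ev f w = 0" using Cons.prems by (simp add: p)
  show ?case
    using 1 2 3 Cons.prems by (cases "m < 0") (auto simp: p act_neg act_Cons cc_def)
qed

text \<open>Turns vanishing on short words of bounded weight into membership in \<open>low\<close>.
  The relations are homogeneous in the weight, so truncation stays inside \<open>F\<close>.\<close>

definition cut :: "nat \<Rightarrow> ('g \<times> nat) fnl \<Rightarrow> ('g \<times> nat) fnl" where
  "cut D f = Fnl (\<lambda>w. if wt w \<le> D then ev f w else 0)"

lemma ev_cut [simp]: "ev (cut D f) w = (if wt w \<le> D then ev f w else 0)"
  by (simp add: cut_def)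

lemma F_cut:
  assumes "f \<in> F" shows "cut D f \<in> F"
proof -
  have "frel (fold der u (cut D f))" if "f \<in> F" for u D f
    using that
  proof (induction u arbitrary: D f)
    case Nil
    have "frel (cut D f)"
    proof (rule frelI)
      fix x n y m
      have "ev f ((x, n) # (y, m) # w) = ev f ((y, m) # (x, n) # w) + ev f ((br x y, n + m + 1) # w)" for w
        using arg_cong[OF der_der[OF Nil, of y m x n], of "\<lambda>f. ev f w"] by simp
      then show "der (y, m) (der (x, n) (cut D f)) = der (x, n) (der (y, m) (cut D f)) + der (br x y, n + m + 1) (cut D f)"
        by (intro fnl_eqI) (simp add: add_ac)
    next
      fix x y n
      have "ev f ((x + y, n) # w) = ev f ((x, n) # w) + ev f ((y, n) # w)" for w
        using arg_cong[OF der_letter_add[OF Nil, of x y n], of "\<lambda>f. ev f w"] by simp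
      then show "der (x + y, n) (cut D f) = der (x, n) (cut D f) + der (y, n) (cut D f)"
        by (intro fnl_eqI) simp
    next
      fix c x n
      have "ev f ((sc c x, n) # w) = c * ev f ((x, n) # w)" for w
        using arg_cong[OF der_letter_scale[OF Nil, of c x n], of "\<lambda>f. ev f w"] by simp
      then show "der (sc c x, n) (cut D f) = smul c (der (x, n) (cut D f))"
        by (intro fnl_eqI) simp
    qed
    then show ?case by simp
  next
    case (Cons p u)
    have "der p (cut D f) = (if snd p + 1 \<le> D then cut (D - (snd p + 1)) (der p f) else 0)"
      by (rule fnl_eqI) auto
    moreover have "fold der u 0 = 0" by (induction u) auto
    ultimately show ?case using Cons F_der frel_zero by auto
  qed
  then show ?thesis using assms by (simp add: F_def)
qed

end

section \<open>Trace functionals and the Sugawara operator\<close>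

lemma ev_times_low:
  assumes "h \<in> low (length w)"
  shows "ev (g * h) w = ev g [] * ev h w"
proof -
  have "g - smul (ev g []) 1 \<in> low 1" by (simp add: low_def)
  from low_mult[OF this assms] have "ev ((g - smul (ev g []) 1) * h) w = 0" by (simp add: low_def)
  then show ?thesis by (simp add: left_diff_distrib smul_mult_left)
qed

context fd_lie
begin

definition ad_word :: "('g \<times> nat) list \<Rightarrow> 'g \<Rightarrow> 'g" where
  "ad_word w z = foldr (\<lambda>p. br (fst p)) w z"

lemma ad_word_simps [simp]: "ad_word [] z = z" "ad_word (p # w) z = br (fst p) (ad_word w z)"
  by (simp_all add: ad_word_def)

text \<open>The weight \<open>N\<close> part of a trace in the adjoint representation evaluated at t
  = 1; it respects the relations because the bracket of two letters has the sum of their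
  weights.\<close>

definition trf :: "('g \<Rightarrow> 'g) \<Rightarrow> nat \<Rightarrow> ('g \<times> nat) fnl" where
  "trf T N = Fnl (\<lambda>w. if wt w = N then tr (\<lambda>z. T (ad_word w z)) else 0)"

lemma ev_trf: "ev (trf T N) w = (if wt w = N then tr (\<lambda>z. T (ad_word w z)) else 0)"
  by (simp add: trf_def)

lemma trf_add: "trf (\<lambda>z. S z + T z) N = trf S N + trf T N"
  by (rule fnl_eqI) (simp add: ev_trf tr_add)

lemma trf_diff: "trf (\<lambda>z. S z - T z) N = trf S N - trf T N"
  by (rule fnl_eqI) (simp add: ev_trf tr_diff)

lemma trf_scale: "trf (\<lambda>z. sc c (T z)) N = smul c (trf T N)"
  by (rule fnl_eqI) (simp add: ev_trf tr_scale)

lemma der_trf: "der (x, n) (trf T N) = (if n + 1 \<le> N then trf (\<lambda>z. T (br x z)) (N - (n + 1)) else 0)"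
  by (rule fnl_eqI) (auto simp: ev_trf)

lemma F_trf:
  assumes "lin T" shows "trf T N \<in> F"
proof -
  have "frel (fold der u (trf T N))" if "lin T" for u T N
    using that
  proof (induction u arbitrary: T N)
    case Nil
    note T = Nil
    have "frel (trf T N)"
      by (rule frelI)
        (auto simp: der_trf trf_add trf_scale trf_diff br_add_left br_scale_left ad_br lin_add[OF T] lin_scale[OF T]
          lin_diff[OF T] add_ac)
    then show ?case by simp
  next
    case (Cons p u)
    obtain x n where p: "p = (x, n)" by force
    have "fold der u 0 = 0" by (induction u) auto
    then show ?case using Cons.IH[OF lin_comp[OF Cons.prems lin_br]] frel_zero by (simp add: p der_trf)
  qed
  then show ?thesis using assms by (simp add: F_def)
qed

lemma act_trf:
  assumes "lin T"
  shows "act l x 0 (trf T N) = trf (\<lambda>z. T (br x z) - br x (T z)) N"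
proof (rule fnl_eqI)
  fix w show "ev (act l x 0 (trf T N)) w = ev (trf (\<lambda>z. T (br x z) - br x (T z)) N) w"
    using assms
  proof (induction w arbitrary: T N)
    case Nil
    then show ?case using tr_comm[OF Nil lin_br[of x]] by (simp add: act_Nil ev_trf tr_diff)
  next
    case (Cons p w)
    obtain y n where p: "p = (y, n)" by force
    note T = Cons.prems
    have IH: "ev (act l x 0 (trf (\<lambda>z. T (br y z)) M)) w = ev (trf (\<lambda>z. T (br y (br x z)) - br x (T (br y z))) M) w" for M
      by (rule Cons.IH[OF lin_comp[OF T lin_br]])
    have "act l (br x y) (0 - int n - 1) (trf T N) = der (br x y, n) (trf T N)"
      using act_minus[of l "br x y" n] by simp
    then show ?case
      by (simp add: p act_Cons cc_def del: ev_der)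
        (auto simp: der_trf IH ev_trf ad_br lin_diff[OF T] tr_diff)
  qed
qed

text \<open>On one-letter words this is the linear coordinate kap(a, .) of the mode -N. Its values
  on longer words are the corrections that make it an element of \<open>F\<close>, so its products
  can serve as monomials.\<close>

definition psi :: "'g \<Rightarrow> nat \<Rightarrow> ('g \<times> nat) fnl" where
  "psi a N = trf (br a) N"

lemma F_psi [simp]: "psi a N \<in> F"
  by (simp add: psi_def F_trf lin_br)

lemma psi_Nil: "N \<ge> 1 \<Longrightarrow> ev (psi a N) [] = 0"
  by (simp add: psi_def ev_trf)

lemma psi_low: "N \<ge> 1 \<Longrightarrow> psi a N \<in> low 1"
  by (simp add: low_def psi_Nil)

lemma psi_single: "ev (psi a N) [(x, n)] = (if N = n + 1 then kap a x else 0)"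
  by (simp add: psi_def ev_trf kap_def)

lemma psi_weight: "wt w \<noteq> N \<Longrightarrow> ev (psi a N) w = 0"
  by (simp add: psi_def ev_trf)

lemma psi_add: "psi (a + b) N = psi a N + psi b N"
  unfolding psi_def br_add_left[abs_def] trf_add ..

lemma act_psi: "act l x 0 (psi a N) = psi (br a x) N"
proof -
  have "br a (br x z) - br x (br a z) = br (br a x) z" for z by (simp add: ad_br)
  then show ?thesis by (simp add: psi_def act_trf[OF lin_br])
qed

lemma translate_psi_1: "translate (psi a 1) = 0"
proof (rule fnl_eqI)
  fix w show "ev (translate (psi a 1)) w = ev 0 w"
  proof (cases "w = []")
    case False
    then have "ev (translate (psi a 1)) w = 0" by (intro translate_weight psi_weight) (auto simp: wt_0)
    then show ?thesis by simp
  qed (simp add: translate_Nil)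
qed

text \<open>On single letters this is L_{-1} x(-N) = N x(-N-1); longer words are absorbed by
  \<open>low 2\<close>.\<close>

lemma translate_psi: "N \<ge> 1 \<Longrightarrow> translate (psi a (N + 1)) - smul (of_nat N) (psi a N) \<in> low 2"
proof -
  assume N: "N \<ge> 1"
  have "ev (translate (psi a (N + 1))) w = of_nat N * ev (psi a N) w" if len: "length w < 2" for w
  proof (cases w)
    case Nil then show ?thesis using psi_Nil[OF N] by (simp add: translate_Nil)
  next
    case (Cons p w')
    then obtain x n where w: "w = [(x, n)]" using len by (cases p) auto
    show ?thesis by (simp add: w ev_translate_Cons translate_Nil psi_single)
  qed
  then show ?thesis by (simp add: low_def)
qed

lemma F_translate:
  assumes "f \<in> F" shows "translate f \<in> F"
proof -
  have "frel (fold der u (translate f))" if "f \<in> F" for u f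
    using that
  proof (induction u arbitrary: f)
    case Nil
    note f = Nil
    have "frel (translate f)"
    proof (rule frelI)
      fix x n y m
      have "br y x = - br x y" by (rule br_anti)
      have 1: "der (y, m) (der (x, n) f) = der (x, n) (der (y, m) f) + der (br x y, n + m + 1) f" for n m
        by (rule der_der[OF f])
      show "der (y, m) (der (x, n) (translate f)) = der (x, n) (der (y, m) (translate f)) + der (br x y, n + m + 1) (translate f)"
        using 1[of m n] 1[of "m + 1" n] 1[of m "n + 1"]
        by (simp add: der_translate der_add der_smul translate_add smul_add_right)
          (simp add: smul_add_left smul_of_nat[of 2, simplified] algebra_simps)
    qed (simp_all add: der_translate der_letter_add[OF f] der_letter_scale[OF f] translate_add translate_smul smul_add_right
        smul_smul algebra_simps)
    then show ?case by simp
  next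
    case (Cons p u)
    obtain x n where p: "p = (x, n)" by force
    have "frel (fold der u (der (x, n + 1) f))" using F_der[OF Cons.prems, of "(x, n + 1)"] by (simp add: F_def)
    then show ?case using Cons.IH[OF F_der[OF Cons.prems]]
      by (simp add: p der_translate fold_der_add fold_der_smul frel_add frel_smul)
  qed
  then show ?thesis using assms by (simp add: F_def)
qed

text \<open>Invariance moves the bracket from the letter to \<open>a\<close>. Through this a mode
  z(m) turns \<eta> into a variable along [y, z].\<close>

lemma act_psi_low: "N \<ge> 1 \<Longrightarrow> m \<ge> 0 \<Longrightarrow> act l x m (psi a N) - psi (br a x) (N + nat m) \<in> low 2"
proof -
  assume N: "N \<ge> 1" and m: "m \<ge> 0"
  have "ev (act l x m (psi a N)) w = ev (psi (br a x) (N + nat m)) w" if len: "length w < 2" for w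
  proof (cases w)
    case Nil then show ?thesis using m N by (simp add: act_Nil psi_Nil)
  next
    case (Cons p w')
    then obtain y n where w: "w = [(y, n)]" using len by (cases p) auto
    have k: "kap a (br x y) = kap (br a x) y" by (simp add: kap_invariant)
    show ?thesis
    proof (cases "m - int n - 1 < 0")
      case True
      then have "nat (- (m - int n - 1) - 1) = n - nat m" using m by simp
      then show ?thesis using m N True
        by (auto simp: w act_Cons act_Nil act_neg psi_single psi_Nil k simp del: diff_diff_eq)
    next
      case False
      then have "N + nat m \<noteq> n + 1" using N by linarith
      then show ?thesis using m N False by (simp add: w act_Cons act_Nil psi_single psi_Nil)
    qed
  qed
  then show ?thesis by (simp add: low_def)
qed

end

section \<open>The Casimir tensor and the Sugawara construction\<close>

locale dual_basis = kill_lie sc Bs br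
  for sc :: "complex \<Rightarrow> 'g::ab_group_add \<Rightarrow> 'g" and Bs :: "'g set" and br :: "'g \<Rightarrow> 'g \<Rightarrow> 'g" +
  fixes B :: "'g set" and d :: "'g \<Rightarrow> 'g"
  assumes B: "is_basis sc B" and dual: "(\<Sum>b\<in>B. sc (kap (d b) x) b) = x"
begin

lemma finB: "finite B"
  using B by (simp add: is_basis_def)

lemma rep_dual: "b \<in> B \<Longrightarrow> representation B x b = kap (d b) x"
  by (rule rep_eqI[OF B dual[symmetric]])

lemma dual': "(\<Sum>b\<in>B. sc (kap b x) (d b)) = x"
proof -
  have "(\<Sum>b\<in>B. sc (kap b x) (d b)) - x = 0"
  proof (rule nondeg)
    fix y
    have "kap (\<Sum>b\<in>B. sc (kap b x) (d b)) y = kap (\<Sum>b\<in>B. sc (kap (d b) y) b) x"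
      by (simp add: kap_comm[of _ y] kap_comm[of _ x] kap_sum_right kap_scale_right)
        (simp add: kap_comm[of y] kap_comm[of x] mult.commute)
    then show "kap ((\<Sum>b\<in>B. sc (kap b x) (d b)) - x) y = 0" by (simp only: kap_diff_left dual kap_comm[of y x]) simp
  qed
  then show ?thesis by simp
qed

context
  fixes G :: "'g \<Rightarrow> 'g \<Rightarrow> complex"
  assumes Gadd1: "G (x + y) z = G x z + G y z" and Gsc1: "G (sc c x) z = c * G x z"
    and Gadd2: "G z (x + y) = G z x + G z y" and Gsc2: "G z (sc c x) = c * G z x"
begin

lemma G_sum1: "G (\<Sum>i\<in>A. f i) z = (\<Sum>i\<in>A. G (f i) z)" for A :: "'g set"
proof -
  have "G 0 z = 0" using Gsc1[of 0 0 z] by simp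
  then show ?thesis by (induction A rule: infinite_finite_induct) (auto simp: Gadd1)
qed

lemma G_sum2: "G z (\<Sum>i\<in>A. f i) = (\<Sum>i\<in>A. G z (f i))" for A :: "'g set"
proof -
  have "G z 0 = 0" using Gsc2[of z 0 0] by simp
  then show ?thesis by (induction A rule: infinite_finite_induct) (auto simp: Gadd2)
qed

text \<open>Invariance of the Casimir tensor, the sum of d b \<otimes> b, tested by an arbitrary
  bilinear \<open>G\<close>.\<close>

lemma casimir_invariant: "(\<Sum>b\<in>B. G (d b) (br b x)) = - (\<Sum>b\<in>B. G (br (d b) x) b)"
proof -
  have "(\<Sum>b\<in>B. G (br (d b) x) b) = (\<Sum>b\<in>B. G (\<Sum>c\<in>B. sc (kap c (br (d b) x)) (d c)) b)"
    by (simp only: dual')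
  also have "\<dots> = (\<Sum>b\<in>B. \<Sum>c\<in>B. kap c (br (d b) x) * G (d c) b)"
    by (simp only: G_sum1 Gsc1)
  also have "\<dots> = (\<Sum>c\<in>B. \<Sum>b\<in>B. kap (d b) (- br c x) * G (d c) b)"
  proof (subst sum.swap, intro sum.cong refl)
    fix b c
    have "kap c (br (d b) x) = kap (br c (d b)) x" by (simp add: kap_invariant)
    also have "br c (d b) = - br (d b) c" by (rule br_anti)
    also have "kap (- br (d b) c) x = kap (d b) (- br c x)"
      using kap_scale_right[of "d b" "-1" "br c x"] by (simp add: kap_minus_left kap_invariant)
    finally show "kap c (br (d b) x) * G (d c) b = kap (d b) (- br c x) * G (d c) b" by simp
  qed
  also have "\<dots> = (\<Sum>c\<in>B. G (d c) (\<Sum>b\<in>B. sc (kap (d b) (- br c x)) b))"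
    by (simp only: G_sum2 Gsc2)
  also have "\<dots> = (\<Sum>c\<in>B. - G (d c) (br c x))"
    unfolding dual using Gsc2[of _ "-1"] by simp
  finally show ?thesis by (simp add: sum_negf)
qed

lemma casimir_symmetric: "(\<Sum>b\<in>B. G (d b) b) = (\<Sum>b\<in>B. G b (d b))"
proof -
  have "(\<Sum>b\<in>B. G (d b) b) = (\<Sum>b\<in>B. G (d b) (\<Sum>c\<in>B. sc (kap c b) (d c)))"
    by (simp only: dual')
  also have "\<dots> = (\<Sum>b\<in>B. \<Sum>c\<in>B. kap b c * G (d b) (d c))"
    by (simp only: G_sum2 Gsc2 kap_comm)
  also have "\<dots> = (\<Sum>c\<in>B. G (\<Sum>b\<in>B. sc (kap b c) (d b)) (d c))"
    by (subst sum.swap) (simp only: G_sum1 Gsc1)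
  finally show ?thesis by (simp only: dual')
qed

end

text \<open>For the Killing form the adjoint Casimir eigenvalue is 1, by comparing
  \<open>kap x z\<close> with the trace that defines it; half of it becomes the shift 1/2 of the
  level.\<close>

lemma casimir_adjoint: "(\<Sum>b\<in>B. br b (br (d b) x)) = x"
proof -
  have "(\<Sum>b\<in>B. br b (br (d b) x)) - x = 0"
  proof (rule nondeg)
    fix z
    have "kap x z = (\<Sum>b\<in>B. kap (d b) (br x (br z b)))"
      unfolding kap_def[of x z] tr_eq[OF B lin_comp[OF lin_br lin_br]]
      by (rule sum.cong) (auto simp: rep_dual)
    also have "\<dots> = (\<Sum>b\<in>B. kap z (br b (br (d b) x)))"
    proof (rule sum.cong[OF refl])
      fix b
      have "kap (d b) (br x (br z b)) = kap (br (d b) x) (br z b)" by (simp add: kap_invariant)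
      also have "\<dots> = kap (br (br (d b) x) z) b" by (simp add: kap_invariant)
      also have "\<dots> = kap (br b (br (d b) x)) z" unfolding kap_invariant[of b] by (rule kap_comm)
      finally show "kap (d b) (br x (br z b)) = kap z (br b (br (d b) x))" by (simp add: kap_comm)
    qed
    also have "\<dots> = kap (\<Sum>b\<in>B. br b (br (d b) x)) z"
      by (simp only: kap_sum_right[symmetric] kap_comm)
    finally show "kap ((\<Sum>b\<in>B. br b (br (d b) x)) - x) z = 0"
      by (simp add: kap_diff_left)
  qed
  then show ?thesis by simp
qed

text \<open>The Sugawara operator \<open>\<Sum> x\<^sub>i(-1-j) x\<^sup>i(j)\<close>, acting from the right, is a multiple of the translation
  operator.  The factor is \<open>(k + h)/2h\<close> in terms of \<open>l = k/2h\<close>.\<close>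
lemma sugawara:
  assumes "f \<in> F" "wt w \<le> J"
  shows "(\<Sum>b\<in>B. \<Sum>j\<le>J. ev (act l (d b) (int j) (der (b, j) f)) w) = (l + 1 / 2) * ev (translate f) w"
  using assms
proof (induction w arbitrary: f)
  case Nil
  then show ?case by (simp add: act_Nil translate_Nil)
next
  case (Cons p w)
  obtain x n where p: "p = (x, n)" by force
  note f = Cons.prems(1)
  have nJ: "n + 1 \<le> J" "wt w \<le> J - (n + 1)" using Cons.prems(2) by (auto simp: p)
  note FD = F_der[OF f] note FDD = F_der[OF FD]
  \<comment> \<open>The terms in which d b(j) has been commuted past the first letter
    x(-n-1).\<close>
  define Q where "Q j = (\<Sum>b\<in>B. ev (act l (br (d b) x) (int j - int n - 1) (der (b, j) f)) w)" for j
  have step: "ev (act l (d b) (int j) (der (b, j) f)) (p # w) =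
      ev (act l (d b) (int j) (der (b, j) (der p f))) w
      + ev (act l (d b) (int j) (der (br b x, j + n + 1) f)) w
      + ev (act l (br (d b) x) (int j - int n - 1) (der (b, j) f)) w
      + (if j = n + 1 then l * of_nat (n + 1) * kap (d b) x * ev f ((b, n + 1) # w) else 0)" for b j
    unfolding p
    by (subst act_Cons) (auto simp: der_der[OF f, of x n b j] act_add cc_def)
  have IH: "(\<Sum>b\<in>B. \<Sum>j\<le>J. ev (act l (d b) (int j) (der (b, j) (der p f))) w) = (l + 1 / 2) * ev (translate (der p f)) w"
    by (rule Cons.IH[OF FD]) (use nJ in auto)
  have Q1: "(\<Sum>b\<in>B. ev (act l (d b) (int j) (der (br b x, j + n + 1) f)) w) = - Q (j + n + 1)" for j
  proof -
    have "(\<Sum>b\<in>B. ev (act l (d b) (int j) (der (br b x, j + n + 1) f)) w) =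
      - (\<Sum>b\<in>B. ev (act l (br (d b) x) (int j) (der (b, j + n + 1) f)) w)"
      by (rule casimir_invariant[where G = "\<lambda>u v. ev (act l u (int j) (der (v, j + n + 1) f)) w"])
        (simp_all add: act_letter_add[OF FD] act_letter_scale[OF FD] der_letter_add[OF f] der_letter_scale[OF f]
          act_add act_smul del: ev_der)
    then show ?thesis by (simp add: Q_def)
  qed
  have Qbig: "Q j = 0" if "j > J" for j
    unfolding Q_def
  proof (intro sum.neutral ballI act_weight)
    fix b and u :: "('g \<times> nat) list" assume "int (wt u) = int (wt w) - (int j - int n - 1)"
    then show "ev (der (b, j) f) u = 0" using nJ that by linarith
  qed
  \<comment> \<open>By invariance of the Casimir tensor, bracketing b instead of d b with x gives
    minus a shifted copy of \<open>Q\<close>. Only the terms j <= n survive, in which both modes are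
    negative.\<close>
  have telescope: "(\<Sum>j\<le>J. Q j) + (\<Sum>j\<le>J. - Q (j + n + 1)) = (\<Sum>j\<le>n. Q j)"
  proof -
    have "(\<Sum>j\<le>J. Q (j + n + 1)) = (\<Sum>j\<in>{n+1..J+n+1}. Q j)"
      by (rule sum.reindex_bij_witness[of _ "\<lambda>j. j - (n + 1)" "\<lambda>j. j + n + 1"]) auto
    also have "\<dots> = (\<Sum>j\<in>{n+1..J}. Q j)"
      by (rule sum.mono_neutral_right) (use Qbig in auto)
    finally have "(\<Sum>j\<le>J. Q (j + n + 1)) = (\<Sum>j\<in>{n+1..J}. Q j)" .
    moreover have "(\<Sum>j\<le>J. Q j) = (\<Sum>j\<le>n. Q j) + (\<Sum>j\<in>{n+1..J}. Q j)"
    proof -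
      have "{..J} = {..n} \<union> {n+1..J}" using nJ by auto
      then show ?thesis by (simp add: sum.union_disjoint)
    qed
    ultimately show ?thesis by (simp add: sum_negf)
  qed
  \<comment> \<open>Exchanging the two negative modes pairs j with n - j, and the commutator [b,
    [d b, x]] sums to x over b. Twice the sum therefore consists of n + 1 equal terms, the source of
    the 1/2.\<close>
  have half: "(\<Sum>j\<le>n. Q j) = of_nat (n + 1) / 2 * ev f ((x, n + 1) # w)"
  proof -
    define P where "P a c = (\<Sum>b\<in>B. ev f ((b, a) # (br (d b) x, c) # w))" for a c
    have G1: "ev f ((u + v, a) # w') = ev f ((u, a) # w') + ev f ((v, a) # w')"
      "ev f ((sc k u, a) # w') = k * ev f ((u, a) # w')" for u v k a w'
      using arg_cong[OF der_letter_add[OF f, of u v a], of "\<lambda>f. ev f w'"]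
        arg_cong[OF der_letter_scale[OF f, of k u a], of "\<lambda>f. ev f w'"] by simp_all
    have G2: "ev f (q # (u + v, a) # w') = ev f (q # (u, a) # w') + ev f (q # (v, a) # w')"
      "ev f (q # (sc k u, a) # w') = k * ev f (q # (u, a) # w')" for q u v k a w'
      using arg_cong[OF der_letter_add[OF F_der[OF f], of u v a q], of "\<lambda>f. ev f w'"]
        arg_cong[OF der_letter_scale[OF F_der[OF f], of k u a q], of "\<lambda>f. ev f w'"] by simp_all
    have Gs: "ev f ((\<Sum>b\<in>A. g b, a) # w') = (\<Sum>b\<in>A. ev f ((g b, a) # w'))" for A :: "'g set" and g a w'
      using arg_cong[OF der_letter_sum[OF f, where g = g], of "\<lambda>f. ev f w'"] by (simp add: ev_sum)
    have sym: "P a c + P c a = ev f ((x, a + c + 1) # w)" for a c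
    proof -
      have "(\<Sum>b\<in>B. ev f ((br b x, c) # (d b, a) # w)) = - P c a"
      proof -
        have "(\<Sum>b\<in>B. ev f ((br b x, c) # (d b, a) # w)) = - (\<Sum>b\<in>B. ev f ((b, c) # (br (d b) x, a) # w))"
          by (rule casimir_invariant[where G = "\<lambda>u v. ev f ((v, c) # (u, a) # w)"])
            (simp_all add: G1 G2)
        then show ?thesis by (simp add: P_def)
      qed
      moreover have "(\<Sum>b\<in>B. ev f ((br (d b) x, c) # (b, a) # w)) = (\<Sum>b\<in>B. ev f ((br b x, c) # (d b, a) # w))"
        by (rule casimir_symmetric[where G = "\<lambda>u v. ev f ((br u x, c) # (v, a) # w)"])
          (simp_all add: G1 G2 br_add_left br_scale_left)
      moreover have "ev f ((b, a) # (br (d b) x, c) # w) - ev f ((br (d b) x, c) # (b, a) # w)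
        = ev f ((br b (br (d b) x), a + c + 1) # w)" for b
        using arg_cong[OF der_der[OF f, of "br (d b) x" c b a], of "\<lambda>f. ev f w"] by simp
      then have "P a c - (\<Sum>b\<in>B. ev f ((br (d b) x, c) # (b, a) # w)) = ev f ((\<Sum>b\<in>B. br b (br (d b) x), a + c + 1) # w)"
        by (simp only: P_def sum_subtractf[symmetric] Gs)
      ultimately show ?thesis by (simp add: casimir_adjoint)
    qed
    have QP: "Q j = P j (n - j)" if "j \<le> n" for j
    proof -
      have "nat (- (int j - int n - 1) - 1) = n - j" using that by simp
      moreover have "int j - int n - 1 < 0" using that by simp
      ultimately show ?thesis by (simp add: Q_def P_def act_neg)
    qed
    have "(\<Sum>j\<le>n. Q j) = (\<Sum>j\<le>n. P j (n - j))" by (simp add: QP)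
    moreover have "(\<Sum>j\<le>n. P j (n - j)) = (\<Sum>j\<le>n. P (n - j) j)"
      by (rule sum.reindex_bij_witness[of _ "\<lambda>j. n - j" "\<lambda>j. n - j"]) auto
    ultimately have "2 * (\<Sum>j\<le>n. Q j) = (\<Sum>j\<le>n. P j (n - j) + P (n - j) j)" by (simp add: sum.distrib)
    also have "\<dots> = of_nat (n + 1) * ev f ((x, n + 1) # w)" by (simp add: sym)
    finally show ?thesis by (simp add: mult.commute)
  qed
  have "(\<Sum>b\<in>B. kap (d b) x * ev f ((b, n + 1) # w)) = ev f ((x, n + 1) # w)"
  proof -
    have "ev (der (\<Sum>b\<in>B. sc (kap (d b) x) b, n + 1) f) w = (\<Sum>b\<in>B. kap (d b) x * ev f ((b, n + 1) # w))"
      by (simp only: der_letter_sum[OF f] der_letter_scale[OF f] ev_sum ev_smul ev_der)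
    then show ?thesis by (simp add: dual)
  qed
  then have level: "(\<Sum>b\<in>B. \<Sum>j\<le>J. if j = n + 1 then l * of_nat (n + 1) * kap (d b) x * ev f ((b, n + 1) # w) else 0)
     = l * of_nat (n + 1) * ev f ((x, n + 1) # w)"
    using nJ by (simp add: sum.delta mult.assoc sum_distrib_left[symmetric])
  have first: "(\<Sum>b\<in>B. \<Sum>j\<le>J. ev (act l (d b) (int j) (der (br b x, j + n + 1) f)) w) = (\<Sum>j\<le>J. - Q (j + n + 1))"
    by (subst sum.swap) (simp only: Q1)
  have second: "(\<Sum>b\<in>B. \<Sum>j\<le>J. ev (act l (br (d b) x) (int j - int n - 1) (der (b, j) f)) w) = (\<Sum>j\<le>J. Q j)"
    by (subst sum.swap) (simp add: Q_def)
  have "(\<Sum>b\<in>B. \<Sum>j\<le>J. ev (act l (d b) (int j) (der (b, j) f)) (p # w)) =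
      (l + 1 / 2) * ev (translate (der p f)) w + ((\<Sum>j\<le>J. Q j) + (\<Sum>j\<le>J. - Q (j + n + 1)))
      + l * of_nat (n + 1) * ev f ((x, n + 1) # w)"
    unfolding step sum.distrib IH level first second by (simp only: add_ac)
  then show ?case
    unfolding telescope half p ev_translate_Cons by (simp add: algebra_simps)
qed

text \<open>Three alphabets occur: all pairs with N >= 1, which give all symbols; those with a in
  \<open>H\<close>; and those with N = 1, whose products vanish on C_2 and are thus functions on
  R.\<close>

inductive pspan :: "('g \<times> nat) set \<Rightarrow> nat \<Rightarrow> ('g \<times> nat) fnl \<Rightarrow> bool" for X where
  one: "pspan X 0 1"
| mult: "pspan X s f \<Longrightarrow> (a, N) \<in> X \<Longrightarrow> pspan X (Suc s) (psi a N * f)"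
| zero: "pspan X s 0"
| add: "pspan X s f \<Longrightarrow> pspan X s g \<Longrightarrow> pspan X s (f + g)"
| smul: "pspan X s f \<Longrightarrow> pspan X s (smul c f)"

lemma pspan_F: "pspan X s f \<Longrightarrow> f \<in> F"
  by (induction rule: pspan.induct) (auto intro: F_times F_add F_smul)

lemma pspan_low:
  assumes "pspan X s f" "\<And>a N. (a, N) \<in> X \<Longrightarrow> N \<ge> 1"
  shows "f \<in> low s"
  using assms(1)
proof (induction rule: pspan.induct)
  case (mult s f a N)
  then show ?case using low_mult[OF psi_low[of N a], of f s] assms(2) by simp
qed (auto intro: low_add low_smul)

lemma pspan_sum: "(\<And>i. i \<in> A \<Longrightarrow> pspan X s (f i)) \<Longrightarrow> pspan X s (\<Sum>i\<in>A. f i)"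
  by (induction A rule: infinite_finite_induct) (auto intro: pspan.intros)

lemma pspan_times: "pspan X s f \<Longrightarrow> pspan X t g \<Longrightarrow> pspan X (s + t) (f * g)"
  by (induction rule: pspan.induct)
    (auto intro: pspan.intros simp: mult.assoc distrib_right smul_mult_left)

text \<open>Euler's identity for homogeneous polynomials. It is exact on words of the lowest length
  occurring in \<open>f\<close>, where reordering letters costs only shorter words.\<close>

lemma euler:
  assumes "f \<in> F" "f \<in> low (length w)" "wt w \<le> D"
  shows "(\<Sum>b\<in>B. \<Sum>n<D. ev (psi (d b) (n + 1) * der (b, n) f) w) = of_nat (length w) * ev f w"
  using assms
proof (induction w arbitrary: f)
  case Nil
  then show ?case by (simp add: ev_times_Nil psi_Nil)
next
  case (Cons p w)
  obtain x m where p: "p = (x, m)" by force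
  note f = Cons.prems(1)
  have low: "f \<in> low (Suc (length w))" using Cons.prems(2) by simp
  have 1: "ev (psi (d b) (n + 1) * der (b, n) f) (p # w) =
      (if n = m then kap (d b) x * ev f ((b, n) # w) else 0) + ev (psi (d b) (n + 1) * der (b, n) (der p f)) w" for b n
  proof -
    have "ev (der p (psi (d b) (n + 1)) * der (b, n) f) w = ev (der p (psi (d b) (n + 1))) [] * ev (der (b, n) f) w"
      by (rule ev_times_low[OF low_der[OF low]])
    moreover have "ev (psi (d b) (n + 1) * der p (der (b, n) f)) w = ev (psi (d b) (n + 1) * der (b, n) (der p f)) w"
    proof -
      have e: "der p (der (b, n) f) = der (b, n) (der p f) + der (br b x, n + m + 1) f"
        unfolding p by (rule der_der[OF f])
      have "ev (psi (d b) (n + 1) * der (br b x, n + m + 1) f) w = 0"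
        using ev_times_low[OF low_der[OF low], of "psi (d b) (n + 1)"] psi_Nil[of "n + 1"] by simp
      then show ?thesis by (simp add: e distrib_left)
    qed
    ultimately show ?thesis by (simp add: ev_times_Cons p psi_single)
  qed
  have IH: "(\<Sum>b\<in>B. \<Sum>n<D. ev (psi (d b) (n + 1) * der (b, n) (der p f)) w) = of_nat (length w) * ev (der p f) w"
    by (rule Cons.IH[OF F_der[OF f] low_der[OF low]]) (use Cons.prems(3) in simp)
  have mD: "m < D" using Cons.prems(3) by (simp add: p)
  have "(\<Sum>b\<in>B. kap (d b) x * ev f ((b, m) # w)) = ev f ((x, m) # w)"
  proof -
    have "ev (der (\<Sum>b\<in>B. sc (kap (d b) x) b, m) f) w = (\<Sum>b\<in>B. kap (d b) x * ev f ((b, m) # w))"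
      by (simp only: der_letter_sum[OF f] der_letter_scale[OF f] ev_sum ev_smul ev_der)
    then show ?thesis by (simp add: dual)
  qed
  then show ?case
    unfolding 1 sum.distrib IH using mD by (simp add: p sum.delta algebra_simps)
qed

text \<open>The derivatives of \<open>f\<close> have lower degree and are approximated by induction;
  Euler's identity reassembles \<open>f\<close> from them.\<close>

lemma symbol_span:
  assumes "f \<in> F" "f \<in> low s"
  shows "\<exists>g. pspan (UNIV \<times> {1..}) s g \<and> (\<forall>w. length w \<le> s \<longrightarrow> wt w \<le> D \<longrightarrow> ev f w = ev g w)"
  using assms
proof (induction s arbitrary: f)
  case 0
  show ?case
    by (intro exI[of _ "smul (ev f []) 1"]) (auto intro: pspan.intros)
next
  case (Suc s)
  let ?X = "UNIV \<times> {1..} :: ('g \<times> nat) set"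
  have "\<exists>g. pspan ?X s g \<and> (\<forall>w. length w \<le> s \<longrightarrow> wt w \<le> D \<longrightarrow> ev (der p f) w = ev g w)" for p
    by (rule Suc.IH[OF F_der[OF Suc.prems(1)] low_der[OF Suc.prems(2)]])
  then obtain g where g: "\<And>p. pspan ?X s (g p)"
    "\<And>p w. length w \<le> s \<Longrightarrow> wt w \<le> D \<Longrightarrow> ev (der p f) w = ev (g p) w" by metis
  define h where "h = smul (1 / of_nat (Suc s)) (\<Sum>b\<in>B. \<Sum>n<D. psi (d b) (n + 1) * g (b, n))"
  have "pspan ?X (Suc s) h"
    unfolding h_def by (intro pspan.smul pspan_sum pspan.mult g) auto
  moreover have "ev f w = ev h w" if w: "length w \<le> Suc s" "wt w \<le> D" for w
  proof (cases "length w = Suc s")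
    case False
    then have "length w < Suc s" using w by simp
    moreover have "h \<in> low (Suc s)" by (rule pspan_low[OF \<open>pspan ?X (Suc s) h\<close>]) auto
    ultimately show ?thesis using Suc.prems(2) by (simp add: low_def)
  next
    case True
    have "ev (psi (d b) (n + 1) * g (b, n)) w = ev (psi (d b) (n + 1) * der (b, n) f) w" for b n
    proof (rule ev_times_eqI)
      fix u v assume uv: "(u, v) \<in> set (splits w)"
      show "ev (psi (d b) (n + 1)) u * ev (g (b, n)) v = ev (psi (d b) (n + 1)) u * ev (der (b, n) f) v"
      proof (cases "u = []")
        case False
        then have "length v \<le> s" "wt v \<le> D" using splits_length[OF uv] splits_wt[OF uv] w by (cases u; auto)+
        then show ?thesis by (simp add: g(2)[symmetric])
      qed (simp add: psi_Nil)
    qed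
    then have "ev h w = (1 / of_nat (Suc s)) * (\<Sum>b\<in>B. \<Sum>n<D. ev (psi (d b) (n + 1) * der (b, n) f) w)"
      by (simp add: h_def ev_sum)
    also have "\<dots> = ev f w"
      using euler[OF Suc.prems(1) _ w(2)] Suc.prems(2) True by (simp del: of_nat_Suc)
    finally show ?thesis by simp
  qed
  ultimately show ?case by blast
qed

end

section \<open>Singular functionals\<close>

text \<open>\<open>y\<close> plays the role of a regular element of the Cartan subalgebra \<open>H\<close>.\<close>
locale regular_basis = dual_basis sc Bs br B d
  for sc :: "complex \<Rightarrow> 'g::ab_group_add \<Rightarrow> 'g" and Bs :: "'g set" and br :: "'g \<Rightarrow> 'g \<Rightarrow> 'g"
    and B :: "'g set" and d :: "'g \<Rightarrow> 'g" +
  fixes H :: "'g set" and y :: 'g and l :: complex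
  assumes subH: "subspace H" and abelH: "x \<in> H \<Longrightarrow> z \<in> H \<Longrightarrow> br x z = 0" and yH: "y \<in> H"
    and split_basis: "b \<in> B \<Longrightarrow> (b \<in> H \<and> d b \<in> H) \<or> (\<exists>z. b = br y z)"
    and noncritical: "l \<noteq> - 1 / 2"
begin

abbreviation "\<eta> \<equiv> psi y (Suc 0)"
abbreviation "HX \<equiv> H \<times> {1::nat..}"

definition fun_linear :: "(('g \<times> nat) fnl \<Rightarrow> complex) \<Rightarrow> bool" where
  "fun_linear E \<longleftrightarrow> (\<forall>f g. E (f + g) = E f + E g) \<and> (\<forall>c f. E (smul c f) = c * E f)"

text \<open>What remains of the fact that a vector involves finitely many words. It bounds both the
  degree of \<open>E\<close> and the weights N that have to be considered.\<close>

definition local_at :: "nat \<Rightarrow> (('g \<times> nat) fnl \<Rightarrow> complex) \<Rightarrow> bool" where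
  "local_at D E \<longleftrightarrow> (\<forall>f. (\<forall>w. wt w \<le> D \<longrightarrow> ev f w = 0) \<longrightarrow> E f = 0)"

text \<open>In terms of vectors: annihilated by all x(m) with m >= 1, of degree at most
  \<open>r\<close>, and with zero image in R, tested on products of weight-one functionals. No zero
  mode is required to annihilate, so that g acts on this set.\<close>

definition M :: "nat \<Rightarrow> (('g \<times> nat) fnl \<Rightarrow> complex) \<Rightarrow> bool" where
  "M r E \<longleftrightarrow> fun_linear E \<and> (\<exists>D. local_at D E) \<and> (\<forall>f\<in>F. \<forall>x m. m \<ge> 1 \<longrightarrow> E (act l x m f) = 0)
    \<and> (\<forall>f\<in>F \<inter> low (Suc r). E f = 0) \<and> (\<forall>s f. pspan (UNIV \<times> {Suc 0}) s f \<longrightarrow> E f = 0)"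

lemma fun_linearD:
  assumes "fun_linear E"
  shows "E (f + g) = E f + E g" "E (smul c f) = c * E f" "E 0 = 0" "E (f - g) = E f - E g"
    "E (\<Sum>i\<in>A. h i) = (\<Sum>i\<in>A. E (h i))"
proof -
  show a: "E (f + g) = E f + E g" for f g using assms by (simp add: fun_linear_def)
  show s: "E (smul c f) = c * E f" for c f using assms by (simp add: fun_linear_def)
  show z: "E 0 = 0" using s[of 0 0] by simp
  show "E (f - g) = E f - E g" using a[of "f - g" g] by simp
  show "E (\<Sum>i\<in>A. h i) = (\<Sum>i\<in>A. E (h i))"
    by (induction A rule: infinite_finite_induct) (auto simp: a z)
qed

lemma M_linear: "M r E \<Longrightarrow> fun_linear E"
  and M_sing: "M r E \<Longrightarrow> f \<in> F \<Longrightarrow> m \<ge> 1 \<Longrightarrow> E (act l x m f) = 0"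
  and M_low: "M r E \<Longrightarrow> f \<in> F \<Longrightarrow> f \<in> low (Suc r) \<Longrightarrow> E f = 0"
  and M_flat: "M r E \<Longrightarrow> pspan (UNIV \<times> {Suc 0}) s f \<Longrightarrow> E f = 0"
  unfolding M_def by blast+

lemmas M_lin = fun_linearD[OF M_linear]

lemma act_one_zero: "act l x 0 1 = 0"
  using act_zero_times[of l x 1 1] by simp

lemma pspan_act_flat: "pspan (UNIV \<times> {N}) s f \<Longrightarrow> pspan (UNIV \<times> {N}) s (act l x 0 f)"
proof (induction rule: pspan.induct)
  case one then show ?case by (simp add: act_one_zero pspan.zero)
next
  case (mult s f a n)
  then show ?case by (auto simp: act_zero_times act_psi intro!: pspan.add pspan.mult)
qed (auto simp: act_add act_smul intro: pspan.intros)

lemma M_act: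
  assumes "M r E" shows "M r (\<lambda>f. E (act l x 0 f))"
  unfolding M_def
proof (intro conjI ballI allI impI)
  note L = M_lin[OF assms]
  show "fun_linear (\<lambda>f. E (act l x 0 f))"
    by (simp add: fun_linear_def act_add act_smul L)
  obtain D where "local_at D E" using assms by (auto simp: M_def)
  then show "\<exists>D. local_at D (\<lambda>f. E (act l x 0 f))"
    unfolding local_at_def by (intro exI[of _ D]) (metis act_weight diff_zero of_nat_eq_iff)
  fix f z and m :: int assume f: "f \<in> F" and m: "m \<ge> 1"
  have "act l x 0 (act l z m f) = act l z m (act l x 0 f) + act l (br z x) m f"
    using act_commute[OF f, of l x 0 z m] m by (simp add: cc_def)
  then show "E (act l x 0 (act l z m f)) = 0"
    using M_sing[OF assms F_act[OF f] m] M_sing[OF assms f m] by (simp add: L)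
next
  fix f assume "f \<in> F \<inter> low (Suc r)"
  then show "E (act l x 0 f) = 0" using M_low[OF assms F_act act_low] by blast
next
  fix s f assume "pspan (UNIV \<times> {Suc 0}) s f"
  then show "E (act l x 0 f) = 0" using M_flat[OF assms] pspan_act_flat by blast
qed

text \<open>\<open>E\<close> does not see weights above \<open>D\<close>, so \<open>g\<close> may be
  replaced by its truncation, and then the degrees of the two factors add.\<close>

lemma E_approx:
  assumes E: "M r E" "local_at D E" and g: "g \<in> F" "\<And>w. length w < s \<Longrightarrow> wt w \<le> D \<Longrightarrow> ev g w = 0"
    and q: "q \<in> F" "q \<in> low t" "s + t \<ge> Suc r"
  shows "E (g * q) = 0"
proof -
  have "cut D g \<in> low s" using g(2) by (simp add: low_def)
  then have "cut D g * q \<in> low (Suc r)" using low_mult q low_mono by blast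
  then have 1: "E (cut D g * q) = 0" using M_low[OF E(1) F_times[OF F_cut[OF g(1)] q(1)]] by blast
  have "ev ((g - cut D g) * q) w = 0" if w: "wt w \<le> D" for w
  proof (rule ev_times_0I)
    fix u v assume "(u, v) \<in> set (splits w)"
    then have "wt u \<le> D" using splits_wt w by fastforce
    then show "ev (g - cut D g) u * ev q v = 0" by simp
  qed
  then have "E ((g - cut D g) * q) = 0" using E(2) unfolding local_at_def by blast
  then show ?thesis using 1 M_lin(4)[OF E(1), of "g * q" "cut D g * q"] by (simp add: left_diff_distrib)
qed

lemma eta_F: "\<eta> ^ n \<in> F"
  by (rule F_power[OF F_psi])

lemma eta_low: "\<eta> ^ n \<in> low n"
  by (rule low_power[OF psi_low]) simp

lemma pspan_HX: "pspan HX s f \<Longrightarrow> f \<in> F" "pspan HX s f \<Longrightarrow> f \<in> low s"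
  using pspan_F pspan_low[of HX s f] by auto

lemma act_H_psi: "h \<in> H \<Longrightarrow> a \<in> H \<Longrightarrow> act l h 0 (psi a N) = 0"
proof -
  assume "h \<in> H" "a \<in> H"
  moreover have "psi 0 N = 0" using psi_add[of 0 0 N] by simp
  ultimately show ?thesis by (simp add: act_psi abelH)
qed

lemma act_H_pspan:
  assumes h: "h \<in> H" shows "pspan HX s f \<Longrightarrow> act l h 0 f = 0"
proof (induction rule: pspan.induct)
  case (mult s f a N)
  then show ?case using act_H_psi[OF h] by (simp add: act_zero_times)
qed (auto simp: act_one_zero act_add act_smul)

lemma act_H_eta: "h \<in> H \<Longrightarrow> act l h 0 (\<eta> ^ n) = 0"
  by (induction n) (simp_all add: act_one_zero act_zero_times act_H_psi yH)

lemma decompose: obtains h z where "h \<in> H" "x = h + br y z"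
proof -
  have "\<exists>h z. h \<in> H \<and> (\<Sum>b\<in>A. sc (c b) b) = h + br y z" if "A \<subseteq> B" for A c
    using finite_subset[OF that finB] that
  proof (induction A rule: finite_induct)
    case empty
    then show ?case using subspace_0[OF subH] by (intro exI[of _ 0]) simp
  next
    case (insert b A)
    then obtain h z where hz: "h \<in> H" "(\<Sum>b\<in>A. sc (c b) b) = h + br y z" by blast
    from insert.prems split_basis[of b] consider "b \<in> H" | z' where "b = br y z'" by blast
    then show ?case
    proof cases
      case 1
      then have "sc (c b) b + h \<in> H" using hz subH by (simp add: subspace_add subspace_scale)
      then show ?thesis using hz insert.hyps
        by (intro exI[of _ "sc (c b) b + h"] exI[of _ z]) (simp add: add.assoc)
    next
      case 2
      then show ?thesis using hz insert.hyps
        by (intro exI[of _ h] exI[of _ "sc (c b) z' + z"]) (simp add: br_add_right br_scale_right add_ac)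
    qed
  qed
  from this[of B "\<lambda>b. kap (d b) x"] show ?thesis using that dual by auto
qed

text \<open>The extremal choice: no functional in \<open>M r\<close> sees more than \<open>n\<close> factors \<open>y(-1)\<close> in PBW degree \<open>r\<close>.\<close>
context
  fixes r n :: nat
  assumes n_le: "n \<le> r"
    and max: "\<And>E \<phi>. Suc n \<le> r \<Longrightarrow> M r E \<Longrightarrow> \<phi> \<in> F \<Longrightarrow> \<phi> \<in> low (r - Suc n) \<Longrightarrow> E (\<eta> ^ Suc n * \<phi>) = 0"
begin

lemma act_eta_power: "m \<ge> 0 \<Longrightarrow> act 0 x m (\<eta> ^ Suc k) = of_nat (Suc k) * (\<eta> ^ k * act 0 x m \<eta>)"
proof (induction k)
  case (Suc k)
  then show ?case
    using act_times[OF Suc.prems, of 0 0 x \<eta> "\<eta> ^ Suc k"] by (simp add: algebra_simps)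
qed simp

text \<open>Apply z(m) with m = N - 1 to \<eta>^(n+1) \<phi>. \<open>E\<close> annihilates the
  result, by singularity for m >= 1 and by maximality of n for \<open>E\<close> composed with z(0).
  The terms in which z(m) hits \<phi> keep \<eta>^(n+1) and vanish too; what is left is n + 1 times
  the claim, up to higher degree.\<close>

lemma step_bracket:
  assumes nr: "Suc n \<le> r" and E: "M r E" and \<phi>: "\<phi> \<in> F" "\<phi> \<in> low (r - Suc n)" and N: "N \<ge> 1"
  shows "E (\<eta> ^ n * psi (br y z) N * \<phi>) = 0"
proof -
  define m where "m = int N - 1"
  have m: "m \<ge> 0" "1 + nat m = N" using N by (auto simp: m_def)
  note L = M_lin[OF E]
  have "act l z m (\<phi> * \<eta> ^ Suc n) = act l z m \<phi> * \<eta> ^ Suc n + \<phi> * act 0 z m (\<eta> ^ Suc n)"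
    using act_times[OF m(1), of l 0 z \<phi> "\<eta> ^ Suc n"] by simp
  moreover have "E (act l z m (\<phi> * \<eta> ^ Suc n)) = 0"
  proof (cases "m = 0")
    case True
    then show ?thesis using max[OF nr M_act[OF E] \<phi>, of z] by (simp add: mult.commute)
  next
    case False
    show ?thesis by (rule M_sing[OF E F_times[OF \<phi>(1) eta_F]]) (use False m in simp)
  qed
  moreover have "E (act l z m \<phi> * \<eta> ^ Suc n) = 0"
    using max[OF nr E F_act[OF \<phi>(1)] act_low[OF m(1) \<phi>(2)]] by (simp add: mult.commute)
  ultimately have "E (\<phi> * act 0 z m (\<eta> ^ Suc n)) = 0" by (simp add: L)
  then have "of_nat (Suc n) * E (\<phi> * (\<eta> ^ n * act 0 z m \<eta>)) = 0"
    unfolding act_eta_power[OF m(1)] L(2)[symmetric] smul_of_nat by (simp add: algebra_simps)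
  then have 1: "E (\<phi> * (\<eta> ^ n * act 0 z m \<eta>)) = 0" by (simp del: of_nat_Suc)
  have "act 0 z m \<eta> - psi (br y z) N \<in> low 2" using act_psi_low[of "Suc 0" m 0 z y] m by simp
  from low_mult[OF \<phi>(2) low_mult[OF eta_low this]]
  have "\<phi> * (\<eta> ^ n * (act 0 z m \<eta> - psi (br y z) N)) \<in> low (r - Suc n + (n + 2))" by blast
  then have "\<phi> * (\<eta> ^ n * (act 0 z m \<eta> - psi (br y z) N)) \<in> low (Suc r)" using nr by (simp add: low_def)
  then have "E (\<phi> * (\<eta> ^ n * (act 0 z m \<eta> - psi (br y z) N))) = 0"
    using M_low[OF E] F_times[OF \<phi>(1) F_times[OF eta_F F_diff[OF F_act F_psi]]] F_psi by blast
  then show ?thesis using 1 by (simp add: right_diff_distrib L mult_ac)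
qed

text \<open>Up to longer words \<beta> is a combination of the \<open>psi b\<close> with its values
  at the \<open>d b\<close> as coefficients. For \<open>d b\<close> in \<open>H\<close> the
  coefficient is zero; otherwise \<open>b\<close> lies in [y, g] and \<open>step_bracket\<close>
  applies.\<close>

lemma step_orthogonal:
  assumes nr: "Suc n \<le> r" and E: "M r E" and \<phi>: "\<phi> \<in> F" "\<phi> \<in> low (r - Suc n)"
    and \<beta>: "\<beta> \<in> F" "\<beta> \<in> low 1" "\<And>h k. h \<in> H \<Longrightarrow> ev \<beta> [(h, k)] = 0"
  shows "E (\<eta> ^ n * \<beta> * \<phi>) = 0"
proof -
  obtain D where D: "local_at D E" using E by (auto simp: M_def)
  define \<chi> where "\<chi> = (\<Sum>b\<in>B. \<Sum>k<D. smul (ev \<beta> [(d b, k)]) (psi b (k + 1)))"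
  note L = M_lin[OF E]
  have "E (\<eta> ^ n * \<chi> * \<phi>) = (\<Sum>b\<in>B. \<Sum>k<D. ev \<beta> [(d b, k)] * E (\<eta> ^ n * psi b (k + 1) * \<phi>))"
    unfolding \<chi>_def
    by (simp only: sum_distrib_left sum_distrib_right smul_mult_left smul_mult_right L)
  also have "\<dots> = 0"
  proof (intro sum.neutral ballI)
    fix b k assume "b \<in> B"
    then consider "d b \<in> H" | z where "b = br y z" using split_basis by blast
    then show "ev \<beta> [(d b, k)] * E (\<eta> ^ n * psi b (k + 1) * \<phi>) = 0"
      using \<beta>(3) step_bracket[OF nr E \<phi>, of "k + 1"] by cases auto
  qed
  finally have 1: "E (\<eta> ^ n * \<chi> * \<phi>) = 0" .
  have "ev (\<beta> - \<chi>) w = 0" if w: "length w < 2" "wt w \<le> D" for w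
  proof (cases w)
    case Nil
    then show ?thesis using \<beta>(2) by (simp add: low_def \<chi>_def ev_sum psi_Nil)
  next
    case (Cons p w')
    then obtain x k where wx: "w = [(x, k)]" using w by (cases p) auto
    have "k < D" using w(2) wx by simp
    have "ev \<beta> [(x, k)] = ev (der (\<Sum>b\<in>B. sc (kap b x) (d b), k) \<beta>) []"
      by (simp add: dual')
    also have "\<dots> = (\<Sum>b\<in>B. kap b x * ev \<beta> [(d b, k)])"
      by (simp only: der_letter_sum[OF \<beta>(1)] der_letter_scale[OF \<beta>(1)] ev_sum ev_smul ev_der)
    also have "\<dots> = ev \<chi> w"
      using \<open>k < D\<close> by (simp add: wx \<chi>_def ev_sum psi_single if_distrib sum.delta mult.commute cong: if_cong)
    finally show ?thesis by (simp add: wx)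
  qed
  moreover have "\<chi> \<in> F" unfolding \<chi>_def by (intro F_sum F_smul F_psi)
  moreover have "\<eta> ^ n * \<phi> \<in> low (n + (r - Suc n))" by (rule low_mult[OF eta_low \<phi>(2)])
  ultimately have "E ((\<beta> - \<chi>) * (\<eta> ^ n * \<phi>)) = 0"
    using nr by (intro E_approx[OF E D, where s = 2 and t = "n + (r - Suc n)"] F_diff \<beta> F_times eta_F \<phi>) auto
  then have "E (\<beta> * (\<eta> ^ n * \<phi>)) - E (\<chi> * (\<eta> ^ n * \<phi>)) = 0"
    by (simp only: left_diff_distrib L(4))
  then show ?thesis using 1 by (simp add: mult_ac)
qed

text \<open>The product rule peels the factors of \<phi> one at a time, and \<open>q\<close> keeps
  those already set aside. The derivative of a factor is a constant plus a functional \<beta>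
  starting with one letter, and the two parts vanish for different reasons.\<close>

lemma casimir_term:
  assumes E: "M r E"
  shows "pspan HX s \<phi> \<Longrightarrow> pspan HX t q \<Longrightarrow> s + t = r - n \<Longrightarrow>
    (\<Sum>b\<in>B. E (act l (d b) 0 (\<eta> ^ n * q * der (b, 0) \<phi>))) = 0"
proof (induction arbitrary: q t rule: pspan.induct)
  case (mult s f a N)
  note L = M_lin[OF E]
  have aH: "a \<in> H" and N: "N \<ge> 1" using mult.hyps by auto
  have nr: "Suc n \<le> r" using mult.prems by simp
  have q: "pspan HX t q" and f: "pspan HX s f" by fact+
  have "pspan HX (Suc t) (psi a N * q)" by (rule pspan.mult[OF q]) (use mult.hyps in auto)
  from mult.IH[OF this] mult.prems
  have 1: "(\<Sum>b\<in>B. E (act l (d b) 0 (\<eta> ^ n * (psi a N * q) * der (b, 0) f))) = 0" by simp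
  define g where "g = q * f"
  have g: "pspan HX (r - Suc n) g"
    using pspan_times[OF q f] mult.prems by (simp add: g_def) (metis Suc_diff_Suc add.commute add_Suc diff_Suc_Suc diff_diff_left nr plus_1_eq_Suc Suc_le_eq add_Suc_right old.nat.inject)
  define \<beta> where "\<beta> b = der (b, 0) (psi a N) - smul (if N = 1 then kap a b else 0) 1" for b
  have \<beta>F: "\<beta> b \<in> F" for b unfolding \<beta>_def by (intro F_diff F_der F_psi F_smul F_one)
  have \<beta>low: "\<beta> b \<in> low 1" for b by (simp add: low_def \<beta>_def psi_single)
  have \<beta>single: "ev (\<beta> b) [(x, k)] = (if k + 2 = N then tr (\<lambda>z. br a (br b (br x z))) else 0)" for b x k
    by (simp add: \<beta>_def psi_def ev_trf)
  \<comment> \<open>For b = [y, z] the relevant value of \<beta> is tr(ad a ad [y, z] ad h), zero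
    since y commutes with a and h. For \<open>b\<close> and \<open>d b\<close> in \<open>H\<close>
    the mode d b(0) hits only \<beta>, and [d b, h] = 0.\<close>
  have bterm: "E (act l (d b) 0 (\<eta> ^ n * \<beta> b * g)) = 0" if "b \<in> B" for b
    using split_basis[OF that]
  proof (elim disjE conjE exE)
    fix z assume b: "b = br y z"
    show ?thesis
    proof (rule step_orthogonal[OF nr M_act[OF E] pspan_HX(1)[OF g] pspan_HX(2)[OF g] \<beta>F \<beta>low])
      fix h k assume h: "h \<in> H"
      have "br h (br y w) = br y (br h w)" for w by (rule ad_commute[OF abelH[OF h yH]])
      moreover have "br a (br y w) = br y (br a w)" for w by (rule ad_commute[OF abelH[OF aH yH]])
      ultimately have "tr (\<lambda>w. br a (br z (br y (br h w)))) = tr (\<lambda>w. br a (br y (br z (br h w))))"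
        using tr_comm[OF lin_br[of y] lin_comp[OF lin_br[of a] lin_comp[OF lin_br[of z] lin_br[of h]]]] by simp
      then show "ev (\<beta> b) [(h, k)] = 0" by (simp add: \<beta>single b ad_br br_diff_right tr_diff)
    qed
  next
    assume b: "b \<in> H" "d b \<in> H"
    have "act l (d b) 0 (\<eta> ^ n * \<beta> b * g) = \<eta> ^ n * act l (d b) 0 (\<beta> b) * g"
      by (simp add: act_zero_times act_H_eta[OF b(2)] act_H_pspan[OF b(2) g])
    moreover have "E (\<eta> ^ n * act l (d b) 0 (\<beta> b) * g) = 0"
    proof (rule step_orthogonal[OF nr E pspan_HX(1)[OF g] pspan_HX(2)[OF g] F_act[OF \<beta>F] act_low[OF _ \<beta>low]])
      fix h k assume h: "h \<in> H"
      have "ev (act l (d b) 0 (\<beta> b)) [(h, k)] = ev (der (0, k) (\<beta> b)) []"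
        using abelH[OF b(2) h] by (simp add: act_Cons act_Nil act_neg cc_def)
      then show "ev (act l (d b) 0 (\<beta> b)) [(h, k)] = 0" by (simp only: der_letter_zero[OF \<beta>F] ev_ring)
    qed simp
    ultimately show ?thesis by simp
  qed
  \<comment> \<open>Summed over the dual basis the constants assemble to a(0), which kills every
    product of variables along \<open>H\<close>.\<close>
  have const: "(\<Sum>b\<in>B. E (act l (d b) 0 (\<eta> ^ n * smul (kap a b) 1 * g))) = 0"
  proof -
    have Fg: "\<eta> ^ n * g \<in> F" by (intro F_times eta_F pspan_HX(1)[OF g])
    have "(\<Sum>b\<in>B. E (act l (d b) 0 (\<eta> ^ n * smul (kap a b) 1 * g)))
      = E (\<Sum>b\<in>B. act l (sc (kap b a) (d b)) 0 (\<eta> ^ n * g))"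
      by (simp add: L(5) smul_mult_left smul_mult_right act_smul act_letter_scale[OF Fg] kap_comm)
    also have "\<dots> = E (act l a 0 (\<eta> ^ n * g))" unfolding act_letter_sum[OF Fg, symmetric] dual' ..
    also have "\<dots> = 0" by (simp add: act_zero_times act_H_eta[OF aH] act_H_pspan[OF aH g] L(3))
    finally show ?thesis .
  qed
  have "(\<Sum>b\<in>B. E (act l (d b) 0 (\<eta> ^ n * q * (der (b, 0) (psi a N) * f)))) = 0"
  proof -
    have "\<eta> ^ n * q * (der (b, 0) (psi a N) * f) =
      \<eta> ^ n * \<beta> b * g + (if N = 1 then \<eta> ^ n * smul (kap a b) 1 * g else 0)" for b
      by (simp add: \<beta>_def g_def algebra_simps)
    then show ?thesis using const
      by (cases "N = 1") (simp_all add: act_add L sum.distrib bterm)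
  qed
  then show ?case using 1
    by (simp add: der_times distrib_left act_add L sum.distrib mult_ac)
qed (simp_all add: der_add der_smul act_add act_smul M_lin[OF E] sum.distrib distrib_left smul_mult_right
    sum_distrib_left[symmetric])

text \<open>In the Sugawara formula for \<eta>^n \<phi> the summands with j >= 1 die by singularity.
  For j = 0 the derivatives of \<eta> assemble to y(0), which acts as zero, and those of \<phi> are
  covered by \<open>casimir_term\<close>. Translation kills \<eta>, and l + 1/2 is divided
  out.\<close>

lemma translate_relation:
  assumes E: "M r E" and \<phi>: "pspan HX (r - n) \<phi>"
  shows "E (\<eta> ^ n * translate \<phi>) = 0"
proof -
  note L = M_lin[OF E]
  obtain D where D: "local_at D E" using E by (auto simp: M_def)
  let ?\<Theta> = "\<eta> ^ n * \<phi>"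
  have \<Theta>: "?\<Theta> \<in> F" by (intro F_times eta_F pspan_HX(1)[OF \<phi>])
  have "E ((\<Sum>b\<in>B. \<Sum>j\<le>D. act l (d b) (int j) (der (b, j) ?\<Theta>)) - smul (l + 1 / 2) (translate ?\<Theta>)) = 0"
    using D sugawara[OF \<Theta>, of _ D l] unfolding local_at_def by (simp add: ev_sum)
  then have 1: "(\<Sum>b\<in>B. \<Sum>j\<le>D. E (act l (d b) (int j) (der (b, j) ?\<Theta>))) = (l + 1 / 2) * E (translate ?\<Theta>)"
    by (simp add: L)
  have 2: "(\<Sum>j\<le>D. E (act l (d b) (int j) (der (b, j) ?\<Theta>))) = E (act l (d b) 0 (der (b, 0) ?\<Theta>))" for b
  proof -
    have "E (act l (d b) (int j) (der (b, j) ?\<Theta>)) = 0" if "j \<noteq> 0" for j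
      using M_sing[OF E F_der[OF \<Theta>]] that by simp
    then have "(\<Sum>j\<le>D. E (act l (d b) (int j) (der (b, j) ?\<Theta>))) = (\<Sum>j\<in>{0}. E (act l (d b) (int j) (der (b, j) ?\<Theta>)))"
      by (intro sum.mono_neutral_right) auto
    then show ?thesis by simp
  qed
  have deta: "der (b, 0) \<eta> = smul (kap y b) 1" for b
    by (rule fnl_eqI) (auto simp: psi_def ev_trf wt_0 kap_def)
  have eta: "der (b, 0) (\<eta> ^ k) = smul (of_nat k * kap y b) (\<eta> ^ (k - 1))" for b k
  proof (induction k)
    case (Suc k)
    have "\<eta> * der (b, 0) (\<eta> ^ k) = smul (of_nat k * kap y b) (\<eta> ^ k)"
      by (simp only: Suc smul_mult_right) (cases k; simp)
    moreover have "der (b, 0) (\<eta> ^ Suc k) = smul (kap y b) (\<eta> ^ k) + \<eta> * der (b, 0) (\<eta> ^ k)"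
      by (simp add: der_times smul_mult_left deta)
    ultimately show ?case
      by (simp only: smul_add_left[symmetric]) (simp add: algebra_simps)
  qed simp
  have Fg: "\<eta> ^ (n - Suc 0) * \<phi> \<in> F" by (intro F_times eta_F pspan_HX(1)[OF \<phi>])
  have "(\<Sum>b\<in>B. E (act l (d b) 0 (der (b, 0) (\<eta> ^ n) * \<phi>)))
    = E (smul (of_nat n) (\<Sum>b\<in>B. act l (sc (kap b y) (d b)) 0 (\<eta> ^ (n - Suc 0) * \<phi>)))"
    by (simp add: eta smul_mult_left act_smul L act_letter_scale[OF Fg] kap_comm sum_distrib_left mult.assoc)
  also have "\<dots> = of_nat n * E (act l y 0 (\<eta> ^ (n - Suc 0) * \<phi>))" unfolding act_letter_sum[OF Fg, symmetric] dual' L(2) ..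
  also have "\<dots> = 0" by (simp add: act_zero_times act_H_eta[OF yH] act_H_pspan[OF yH \<phi>] L(3))
  finally have "(\<Sum>b\<in>B. E (act l (d b) 0 (der (b, 0) (\<eta> ^ n) * \<phi>))) = 0" .
  moreover have "(\<Sum>b\<in>B. E (act l (d b) 0 (\<eta> ^ n * der (b, 0) \<phi>))) = 0"
    using casimir_term[OF E \<phi> pspan.one] by simp
  ultimately have "(l + 1 / 2) * E (translate ?\<Theta>) = 0"
    unfolding 1[symmetric] 2 by (simp add: der_times act_add L sum.distrib)
  moreover have "l + 1 / 2 \<noteq> 0" using noncritical by (simp add: add_eq_0_iff2)
  ultimately have "E (translate ?\<Theta>) = 0" by simp
  moreover have "translate (\<eta> ^ k) = 0" for k
    by (induction k) (simp_all add: translate_one translate_times translate_psi_1[unfolded One_nat_def])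
  ultimately show ?thesis by (simp add: translate_times)
qed

text \<open>Modulo longer words translation lowers one index N at a time and kills factors with N =
  1, so it preserves the alphabet and the number of factors.\<close>

lemma translate_pspan:
  "pspan HX s f \<Longrightarrow> \<exists>g. pspan HX s g \<and> translate f - g \<in> low (Suc s) \<and> translate f - g \<in> F"
proof (induction rule: pspan.induct)
  case (mult s f a N)
  then obtain g where g: "pspan HX s g" "translate f - g \<in> low (Suc s)" "translate f - g \<in> F" by blast
  have aH: "a \<in> H" and N: "N \<ge> 1" using mult.hyps by auto
  obtain p where p: "pspan HX (Suc s) (p * f)" "translate (psi a N) - p \<in> low 2" "translate (psi a N) - p \<in> F"
  proof (cases "N = 1")
    case True
    then show ?thesis using that[of 0] translate_psi_1[unfolded One_nat_def, of a] by (simp add: pspan.zero)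
  next
    case False
    have "pspan HX (Suc s) (smul (of_nat (N - 1)) (psi a (N - 1)) * f)"
      unfolding smul_mult_left
      by (intro pspan.smul pspan.mult mult.hyps) (use aH N False in auto)
    moreover have "translate (psi a N) - smul (of_nat (N - 1)) (psi a (N - 1)) \<in> low 2"
      using translate_psi[of "N - 1" a] N False by simp
    ultimately show ?thesis using that F_translate[OF F_psi] F_diff F_smul F_psi by blast
  qed
  have "translate (psi a N * f) - (p * f + psi a N * g) = (translate (psi a N) - p) * f + psi a N * (translate f - g)"
    by (simp add: translate_times algebra_simps)
  moreover have "(translate (psi a N) - p) * f \<in> low (Suc (Suc s))"
    using low_mult[OF p(2) pspan_HX(2)[OF mult.hyps(1)]] by simp
  moreover have "psi a N * (translate f - g) \<in> low (Suc (Suc s))"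
    using low_mult[OF psi_low[OF N] g(2)] by simp
  moreover have "(translate (psi a N) - p) * f \<in> F" "psi a N * (translate f - g) \<in> F"
    using F_times p(3) g(3) pspan_HX(1)[OF mult.hyps(1)] F_psi by blast+
  moreover have "pspan HX (Suc s) (psi a N * g)" by (intro pspan.mult g mult.hyps)
  ultimately show ?case using p(1) pspan.add low_add F_add by metis
next
  case (add s f g)
  then obtain f' g' where "pspan HX s f'" "translate f - f' \<in> low (Suc s)" "translate f - f' \<in> F"
    "pspan HX s g'" "translate g - g' \<in> low (Suc s)" "translate g - g' \<in> F" by blast
  moreover have "translate (f + g) - (f' + g') = (translate f - f') + (translate g - g')" by (simp add: translate_add)
  ultimately show ?case using pspan.add low_add F_add by metis
next
  case (smul s f c)
  then obtain f' where "pspan HX s f'" "translate f - f' \<in> low (Suc s)" "translate f - f' \<in> F" by blast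
  moreover have "translate (smul c f) - smul c f' = smul c (translate f - f')" by (simp add: translate_smul smul_diff_right)
  ultimately show ?case using pspan.smul low_smul F_smul by metis
qed (auto simp: translate_one translate_zero intro!: exI[of _ 0] pspan.zero)

text \<open>Injectivity of translation, as a descending induction on N that starts above the weight
  bound \<open>D\<close>. Translating psi h (N+1) * g gives N psi h N * g plus terms that still
  contain psi h (N+1) and vanish by induction; hence the induction is over all
  \<open>g\<close>.\<close>

lemma E_H_product:
  assumes E: "M r E" and nr: "Suc n \<le> r" and h: "h \<in> H" and N: "N \<ge> 1" and g: "pspan HX (r - Suc n) g"
  shows "E (\<eta> ^ n * (psi h N * g)) = 0"
proof -
  note L = M_lin[OF E]
  obtain D where D: "local_at D E" using E by (auto simp: M_def)
  show ?thesis using N g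
  proof (induction "Suc D - N" arbitrary: N g rule: less_induct)
    case less
    note N = less.prems(1) and g = less.prems(2)
    show ?case
    proof (cases "N > D")
      case True
      have "ev (psi h N * (\<eta> ^ n * g)) w = 0" if "wt w \<le> D" for w
      proof (rule ev_times_0I)
        fix u v assume "(u, v) \<in> set (splits w)"
        then have "wt u \<noteq> N" using splits_wt that True by fastforce
        then show "ev (psi h N) u * ev (\<eta> ^ n * g) v = 0" by (simp add: psi_weight)
      qed
      then have "E (psi h N * (\<eta> ^ n * g)) = 0" using D unfolding local_at_def by blast
      then show ?thesis by (simp add: mult_ac)
    next
      case False
      have pg: "pspan HX (r - n) (psi h (N + 1) * g)"
        using pspan.mult[OF g, of h "N + 1"] h nr by (simp add: Suc_diff_Suc Suc_le_eq)
      have 0: "E (\<eta> ^ n * translate (psi h (N + 1)) * g) + E (\<eta> ^ n * psi h (N + 1) * translate g) = 0"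
        using translate_relation[OF E pg] by (simp add: translate_times distrib_left L mult_ac add.commute)
      obtain g' where g': "pspan HX (r - Suc n) g'" "translate g - g' \<in> low (Suc (r - Suc n))" "translate g - g' \<in> F"
        using translate_pspan[OF g] by blast
      have "E (\<eta> ^ n * (psi h (N + 1) * g')) = 0"
        by (rule less.hyps) (use False g' in auto)
      moreover have "E (\<eta> ^ n * psi h (N + 1) * (translate g - g')) = 0"
      proof (rule M_low[OF E])
        show "\<eta> ^ n * psi h (N + 1) * (translate g - g') \<in> F" by (intro F_times eta_F F_psi g')
        have "\<eta> ^ n * psi h (N + 1) * (translate g - g') \<in> low (n + 1 + Suc (r - Suc n))"
          by (intro low_mult eta_low psi_low g') simp
        then show "\<eta> ^ n * psi h (N + 1) * (translate g - g') \<in> low (Suc r)" using nr by (simp add: low_def)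
      qed
      then have "E (\<eta> ^ n * psi h (N + 1) * translate g) - E (\<eta> ^ n * psi h (N + 1) * g') = 0"
        by (simp only: right_diff_distrib L(4))
      ultimately have "E (\<eta> ^ n * psi h (N + 1) * translate g) = 0" by (simp add: mult.assoc)
      then have 1: "E (\<eta> ^ n * translate (psi h (N + 1)) * g) = 0" using 0 by simp
      have "E (\<eta> ^ n * (translate (psi h (N + 1)) - smul (of_nat N) (psi h N)) * g) = 0"
      proof (rule M_low[OF E])
        show "\<eta> ^ n * (translate (psi h (N + 1)) - smul (of_nat N) (psi h N)) * g \<in> F"
          by (intro F_times eta_F F_diff F_translate F_smul F_psi pspan_HX(1)[OF g])
        have "\<eta> ^ n * (translate (psi h (N + 1)) - smul (of_nat N) (psi h N)) * g \<in> low (n + 2 + (r - Suc n))"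
          by (intro low_mult eta_low translate_psi pspan_HX(2)[OF g] N)
        then show "\<eta> ^ n * (translate (psi h (N + 1)) - smul (of_nat N) (psi h N)) * g \<in> low (Suc r)"
          using nr by (simp add: low_def)
      qed
      then have "of_nat N * E (\<eta> ^ n * psi h N * g) = 0"
        using 1 by (simp add: right_diff_distrib left_diff_distrib smul_mult_left smul_mult_right L)
      then show ?thesis using N by (simp add: mult_ac)
    qed
  qed
qed

text \<open>Each factor is split along g = H + [y, g]: the second part is removed by
  \<open>step_bracket\<close>, the first is moved into \<open>q\<close> until only variables along
  \<open>H\<close> remain.\<close>

lemma E_product:
  assumes E: "M r E" and nr: "Suc n \<le> r"
  shows "pspan (UNIV \<times> {1..}) t g \<Longrightarrow> pspan HX u q \<Longrightarrow> t + u = r - n \<Longrightarrow> E (\<eta> ^ n * (g * q)) = 0"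
proof (induction arbitrary: q u rule: pspan.induct)
  note L = M_lin[OF E]
  case one
  have "E (\<eta> ^ n * q) = 0" if "pspan HX s q" "s = r - n" for s
    using that
  proof (induction rule: pspan.induct)
    case one then show ?case using nr by simp
  next
    case (mult s f a N)
    then have "s = r - Suc n" by simp
    then show ?case using E_H_product[OF E nr, of a N f] mult.hyps by simp
  qed (simp_all add: L distrib_left smul_mult_right)
  then show ?case using one by simp
next
  note L = M_lin[OF E]
  case (mult s f a N)
  have N: "N \<ge> 1" using mult.hyps by simp
  obtain h z where a: "h \<in> H" "a = h + br y z" by (rule decompose)
  have "pspan HX (Suc u) (psi h N * q)" using pspan.mult[OF mult.prems(1)] a N by simp
  then have 1: "E (\<eta> ^ n * (f * (psi h N * q))) = 0" by (rule mult.IH) (use mult.prems in simp)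
  have "f * q \<in> F" by (intro F_times pspan_F[OF mult.hyps(1)] pspan_F[OF mult.prems(1)])
  moreover have "f * q \<in> low (s + u)"
    by (rule low_mult[OF pspan_low[OF mult.hyps(1)] pspan_low[OF mult.prems(1)]]) auto
  then have "f * q \<in> low (r - Suc n)" using mult.prems(2) by (auto elim: low_mono)
  ultimately have "E (\<eta> ^ n * psi (br y z) N * (f * q)) = 0" by (rule step_bracket[OF nr E _ _ N])
  then show ?case using 1 by (simp add: a(2) psi_add distrib_left distrib_right L mult_ac)
qed (simp_all add: M_lin[OF E] distrib_left distrib_right smul_mult_left smul_mult_right)

lemma E_vanishes:
  assumes E: "M r E" and \<phi>: "\<phi> \<in> F" "\<phi> \<in> low (r - n)"
  shows "E (\<eta> ^ n * \<phi>) = 0"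
proof -
  note L = M_lin[OF E]
  obtain D where D: "local_at D E" using E by (auto simp: M_def)
  obtain g where g: "pspan (UNIV \<times> {1..}) (r - n) g"
    "\<And>w. length w \<le> r - n \<Longrightarrow> wt w \<le> D \<Longrightarrow> ev \<phi> w = ev g w" using symbol_span[OF \<phi>] by metis
  have "E ((\<phi> - g) * \<eta> ^ n) = 0"
    by (rule E_approx[OF E D, where s = "Suc (r - n)" and t = n])
      (use g pspan_F[OF g(1)] n_le in \<open>auto intro: F_diff \<phi> eta_F eta_low\<close>)
  moreover have "E (\<eta> ^ n * g) = 0"
  proof (cases "Suc n \<le> r")
    case True
    then show ?thesis using E_product[OF E True g(1) pspan.one] by simp
  next
    \<comment> \<open>Now n = r and only \<eta>^r is left, a product of weight-one
      functionals.\<close>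
    case False
    then have nr: "r = n" using n_le by simp
    have p: "pspan (UNIV \<times> {Suc 0}) k (\<eta> ^ k)" for k
      by (induction k) (auto intro: pspan.intros)
    have "E (\<eta> ^ n * g) = 0" if "pspan (UNIV \<times> {1..}) s g" "s = 0" for s
      using that
    proof (induction rule: pspan.induct)
      case one then show ?case using M_flat[OF E p] by simp
    qed (simp_all add: L distrib_left smul_mult_right)
    then show ?thesis using g(1) nr by simp
  qed
  ultimately show ?thesis by (simp add: left_diff_distrib L mult.commute)
qed

end

text \<open>The degree r is read off from \<open>E\<close>, but the extremal power of \<eta> is
  taken over all functionals in \<open>M r\<close>, because \<open>step_bracket\<close> passes from
  a functional to its composite with z(0).\<close>

theorem singular_functional_vanishes:
  assumes lin: "fun_linear E" and loc: "local_at D E"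
    and sing: "\<And>f x m. f \<in> F \<Longrightarrow> m \<ge> 1 \<Longrightarrow> E (act l x m f) = 0"
    and flat: "\<And>s f. pspan (UNIV \<times> {Suc 0}) s f \<Longrightarrow> E f = 0"
    and f: "f \<in> F"
  shows "E f = 0"
proof (rule ccontr)
  assume Ef: "E f \<noteq> 0"
  let ?P = "\<lambda>R. \<forall>f\<in>F \<inter> low R. E f = 0"
  \<comment> \<open>A word is at most as long as its weight, so locality makes the filtration
    argument finite.\<close>
  have "?P (Suc D)"
  proof
    fix f assume "f \<in> F \<inter> low (Suc D)"
    then have "ev f w = 0" if "wt w \<le> D" for w using that length_le_wt[of w] by (simp add: low_def)
    then show "E f = 0" using loc unfolding local_at_def by blast
  qed
  define R where "R = (LEAST R. ?P R)"
  have PR: "?P R" unfolding R_def by (rule LeastI[of ?P, OF \<open>?P (Suc D)\<close>])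
  have "R \<noteq> 0" using PR f Ef by auto
  then obtain r where r: "R = Suc r" by (cases R) auto
  have "\<not> ?P r" unfolding R_def[symmetric] using not_less_Least[of r ?P] r by (simp add: R_def)
  then obtain \<phi> where \<phi>: "\<phi> \<in> F" "\<phi> \<in> low r" "E \<phi> \<noteq> 0" by blast
  have ME: "M r E"
    unfolding M_def using lin loc sing flat PR r by blast
  define A where "A = {n. n \<le> r \<and> (\<exists>E \<phi>. M r E \<and> \<phi> \<in> F \<and> \<phi> \<in> low (r - n) \<and> E (\<eta> ^ n * \<phi>) \<noteq> 0)}"
  have fin: "finite A" unfolding A_def by simp
  have "0 \<in> A" unfolding A_def using ME \<phi> by (auto intro!: exI[of _ E] exI[of _ \<phi>])
  define n0 where "n0 = Max A"
  have "n0 \<in> A" using Max_in[OF fin] \<open>0 \<in> A\<close> unfolding n0_def by blast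
  then obtain E' \<phi>' where E': "n0 \<le> r" "M r E'" "\<phi>' \<in> F" "\<phi>' \<in> low (r - n0)" "E' (\<eta> ^ n0 * \<phi>') \<noteq> 0"
    unfolding A_def by blast
  have max: "E'' (\<eta> ^ Suc n0 * \<psi>) = 0"
    if "Suc n0 \<le> r" "M r E''" "\<psi> \<in> F" "\<psi> \<in> low (r - Suc n0)" for E'' \<psi>
  proof (rule ccontr)
    assume "E'' (\<eta> ^ Suc n0 * \<psi>) \<noteq> 0"
    then have "Suc n0 \<in> A" unfolding A_def using that by blast
    then show False using Max_ge[OF fin] unfolding n0_def by fastforce
  qed
  have "E' (\<eta> ^ n0 * \<phi>') = 0"
    by (rule E_vanishes[OF E'(1) _ E'(2-4)]) (rule max)
  then show False using E'(5) by blast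
qed

end

section \<open>Functionals on the universal affine vertex algebra\<close>

lemma fin_supp_mono [simp]: "mono w \<in> fin_supp"
  by (simp add: fin_supp_def mono_def)

lemma fin_supp_tadd: "f \<in> fin_supp \<Longrightarrow> g \<in> fin_supp \<Longrightarrow> tadd f g \<in> fin_supp"
  by (auto simp: fin_supp_def tadd_def intro: finite_subset[of _ "{w. f w \<noteq> 0} \<union> {w. g w \<noteq> 0}"])

lemma fin_supp_tsub: "f \<in> fin_supp \<Longrightarrow> g \<in> fin_supp \<Longrightarrow> tsub f g \<in> fin_supp"
  by (auto simp: fin_supp_def tsub_def intro: finite_subset[of _ "{w. f w \<noteq> 0} \<union> {w. g w \<noteq> 0}"])

lemma fin_supp_tsc: "f \<in> fin_supp \<Longrightarrow> tsc c f \<in> fin_supp"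
  by (auto simp: fin_supp_def tsc_def intro: finite_subset[of _ "{w. f w \<noteq> 0}"])

lemma lmul_support: "{z. lmul u f z \<noteq> 0} = (@) u ` {w. f w \<noteq> 0}"
  by (auto simp: lmul_def image_iff) (metis append_take_drop_id)

lemma fin_supp_lmul: "f \<in> fin_supp \<Longrightarrow> lmul u f \<in> fin_supp"
  by (simp add: fin_supp_def lmul_support)

lemma lmul_tsub: "lmul u (tsub f g) = tsub (lmul u f) (lmul u g)"
  and lmul_tsc: "lmul u (tsc c f) = tsc c (lmul u f)"
  and lmul_mono: "lmul u (mono w) = mono (u @ w)"
  and rmul_tsub: "rmul (tsub f g) u = tsub (rmul f u) (rmul g u)"
  and rmul_tsc: "rmul (tsc c f) u = tsc c (rmul f u)"
proof -
  show "lmul u (mono w) = mono (u @ w)"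
  proof
    fix z show "lmul u (mono w) z = mono (u @ w) z"
      by (auto simp: lmul_def mono_def) (metis append_take_drop_id)
  qed
qed (auto simp: lmul_def rmul_def tsub_def tsc_def fun_eq_iff)

lemma rmul_mono: "rmul (mono w) u = mono (w @ u)"
proof
  fix z show "rmul (mono w) u z = mono (w @ u) z"
    by (auto simp: rmul_def mono_def) (metis append_take_drop_id)
qed

definition pairing :: "('g gen list \<Rightarrow> complex) \<Rightarrow> 'g tens \<Rightarrow> complex" where
  "pairing G f = (\<Sum>w\<in>{w. f w \<noteq> 0}. f w * G w)"

lemma pairing_superset: "finite S \<Longrightarrow> {w. f w \<noteq> 0} \<subseteq> S \<Longrightarrow> pairing G f = (\<Sum>w\<in>S. f w * G w)"
  unfolding pairing_def by (rule sum.mono_neutral_left) auto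

lemma pairing_mono: "pairing G (mono w) = G w"
  by (subst pairing_superset[of "{w}"]) (auto simp: mono_def)

lemma pairing_tadd:
  assumes "f \<in> fin_supp" "g \<in> fin_supp"
  shows "pairing G (tadd f g) = pairing G f + pairing G g"
proof -
  let ?S = "{w. f w \<noteq> 0} \<union> {w. g w \<noteq> 0}"
  have "finite ?S" using assms by (simp add: fin_supp_def)
  note sup = pairing_superset[OF this]
  have "pairing G f = (\<Sum>w\<in>?S. f w * G w)" "pairing G g = (\<Sum>w\<in>?S. g w * G w)"
    "pairing G (tadd f g) = (\<Sum>w\<in>?S. tadd f g w * G w)"
    by (rule sup, auto simp: tadd_def)+
  then show ?thesis by (simp add: tadd_def sum.distrib[symmetric] distrib_right)
qed

lemma pairing_tsub:
  assumes "f \<in> fin_supp" "g \<in> fin_supp"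
  shows "pairing G (tsub f g) = pairing G f - pairing G g"
proof -
  let ?S = "{w. f w \<noteq> 0} \<union> {w. g w \<noteq> 0}"
  have "finite ?S" using assms by (simp add: fin_supp_def)
  note sup = pairing_superset[OF this]
  have "pairing G f = (\<Sum>w\<in>?S. f w * G w)" "pairing G g = (\<Sum>w\<in>?S. g w * G w)"
    "pairing G (tsub f g) = (\<Sum>w\<in>?S. tsub f g w * G w)"
    by (rule sup, auto simp: tsub_def)+
  then show ?thesis by (simp add: tsub_def sum_subtractf[symmetric] left_diff_distrib)
qed

lemma pairing_tsc:
  assumes "f \<in> fin_supp"
  shows "pairing G (tsc c f) = c * pairing G f"
proof -
  have "finite {w. f w \<noteq> 0}" using assms by (simp add: fin_supp_def)
  from pairing_superset[OF this] show ?thesis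
    by (simp add: tsc_def subset_eq sum_distrib_left mult.assoc)
qed

lemma pairing_lmul: "pairing G (lmul u f) = pairing (\<lambda>w. G (u @ w)) f"
  unfolding pairing_def lmul_support
  by (subst sum.reindex) (auto simp: inj_on_def lmul_def)

text \<open>Functionals on the tensor algebra that vanish on \<open>vac_ideal\<close>, in terms of their values on words.\<close>
locale vac_functional =
  fixes sc :: "complex \<Rightarrow> 'g::ab_group_add \<Rightarrow> 'g" and br :: "'g \<Rightarrow> 'g \<Rightarrow> 'g"
    and frm :: "'g \<Rightarrow> 'g \<Rightarrow> complex" and k :: complex and G :: "'g gen list \<Rightarrow> complex"
  assumes G_add: "G (u @ Some (x + y, m) # w) = G (u @ Some (x, m) # w) + G (u @ Some (y, m) # w)"
    and G_scale: "G (u @ Some (sc c x, m) # w) = c * G (u @ Some (x, m) # w)"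
    and G_bracket: "G (u @ Some (x, m) # Some (y, n) # w) = G (u @ Some (y, n) # Some (x, m) # w)
      + G (u @ Some (br x y, m + n) # w) + (if m + n = 0 then of_int m * frm x y else 0) * G (u @ None # w)"
    and G_central: "G (u @ None # a # w) = G (u @ a # None # w)"
    and G_vac: "m \<ge> 0 \<Longrightarrow> G (u @ [Some (x, m)]) = 0"
    and G_level: "G (u @ [None]) = k * G u"
begin

lemma G_None: "G (u @ None # w) = k * G (u @ w)"
proof (induction w arbitrary: u)
  case (Cons a w)
  then show ?case using Cons[of "u @ [a]"] by (simp add: G_central)
qed (simp add: G_level)

lemma G_None': "G (u @ a # None # w) = k * G (u @ a # w)"
  using G_None[of "u @ [a]" w] by simp

lemma G_bracket': "G (u @ Some (x, m) # Some (y, n) # w) - G (u @ Some (y, n) # Some (x, m) # w)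
    - G (u @ Some (br x y, m + n) # w) - (if m + n = 0 then of_int m * frm x y else 0) * G (u @ None # w) = 0"
  using G_bracket[of u x m y n w] by simp

end

lemma vac_ideal_fin_supp: "f \<in> vac_ideal sc br frm k \<Longrightarrow> f \<in> fin_supp"
proof (induction rule: vac_ideal.induct)
  case (rel r u w)
  then show ?case
    by (auto simp: uhat_rels_def lmul_tsub lmul_tsc lmul_mono rmul_tsub rmul_tsc rmul_mono
      intro!: fin_supp_tsub fin_supp_tsc)
next
  case (vac j u)
  then show ?case
    by (auto simp: vac_gens_def lmul_tsub lmul_tsc lmul_mono intro!: fin_supp_tsub fin_supp_tsc)
next
  case zero then show ?case by (simp add: fin_supp_def)
qed (auto intro: fin_supp_tadd fin_supp_tsc)

lemma vac_functional_kills: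
  assumes "vac_functional sc br frm k G"
  shows "f \<in> vac_ideal sc br frm k \<Longrightarrow> pairing G f = 0"
proof (induction rule: vac_ideal.induct)
  interpret vac_functional sc br frm k G by fact
  note fs = pairing_tsub pairing_tsc pairing_mono fin_supp_tsub fin_supp_tsc fin_supp_mono
    lmul_tsub lmul_tsc lmul_mono rmul_tsub rmul_tsc rmul_mono append_Cons append_Nil append_assoc
  case (rel r u w)
  then show ?case
    unfolding uhat_rels_def
    by (elim UnE CollectE exE conjE; hypsubst)
      (simp only: fs G_add, simp, simp only: fs G_scale, simp, simp only: fs G_bracket',
       simp only: fs G_None G_None', simp)
next
  interpret vac_functional sc br frm k G by fact
  note fs = pairing_tsub pairing_tsc pairing_mono fin_supp_tsub fin_supp_tsc
  case (vac j u)
  then show ?case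
    unfolding vac_gens_def
    by (elim UnE CollectE exE conjE insertE emptyE; hypsubst)
      (simp_all add: lmul_tsub lmul_tsc lmul_mono fs G_vac G_level)
next
  case zero then show ?case by (simp add: pairing_def)
qed (simp_all add: pairing_tadd pairing_tsc vac_ideal_fin_supp)

lemma smul_vector_space: "vector_space (smul :: complex \<Rightarrow> 'a fnl \<Rightarrow> 'a fnl)"
  by unfold_locales (auto intro!: fnl_eqI simp: algebra_simps)

text \<open>A basis of the ideal stays independent when \<open>v\<close> is added, so a linear
  functional can vanish on the ideal and be 1 at \<open>v\<close>. The type \<open>fnl\<close>
  serves here only as a vector space.\<close>

lemma separating_functional:
  fixes v :: "'g::ab_group_add tens"
  assumes fs: "v \<in> fin_supp" and v: "v \<notin> vac_ideal sc br frm k"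
  obtains G where "vac_functional sc br frm k G" "pairing G v \<noteq> 0"
proof -
  let ?I = "vac_ideal sc br frm k"
  interpret V: vector_space "smul :: complex \<Rightarrow> 'g gen fnl \<Rightarrow> 'g gen fnl" by (rule smul_vector_space)
  interpret C: vector_space "(*) :: complex \<Rightarrow> complex \<Rightarrow> complex" by unfold_locales (auto simp: algebra_simps)
  interpret VC: vector_space_pair "smul :: complex \<Rightarrow> 'g gen fnl \<Rightarrow> 'g gen fnl" "(*) :: complex \<Rightarrow> complex \<Rightarrow> complex" ..
  have Fa: "Fnl (tadd f g) = Fnl f + Fnl g" "Fnl (tsc c f) = smul c (Fnl f)"
    "Fnl (tsub f g) = Fnl f - Fnl g" "Fnl (\<lambda>_. 0) = 0" for f g :: "'g tens" and c
    by (auto intro!: fnl_eqI simp: tadd_def tsc_def tsub_def)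
  have inj: "Fnl f = Fnl g \<Longrightarrow> f = g" for f g :: "'g tens" by (metis ev_Fnl)
  have sub: "V.subspace (Fnl ` ?I)"
    unfolding V.subspace_def
  proof (intro conjI ballI allI)
    show "0 \<in> Fnl ` ?I" using vac_ideal.zero[of sc br frm k] Fa(4) by (metis image_eqI)
  next
    fix x y assume "x \<in> Fnl ` ?I" "y \<in> Fnl ` ?I"
    then show "x + y \<in> Fnl ` ?I"
      by (auto simp: Fa(1)[symmetric] intro!: imageI vac_ideal.add)
  next
    fix c x assume "x \<in> Fnl ` ?I"
    then show "smul c x \<in> Fnl ` ?I"
      by (auto simp: Fa(2)[symmetric] intro!: imageI vac_ideal.scal)
  qed
  obtain B where B: "B \<subseteq> Fnl ` ?I" "V.independent B" "Fnl ` ?I \<subseteq> V.span B"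
    by (rule V.maximal_independent_subset)
  have "V.span B \<subseteq> Fnl ` ?I" by (rule V.span_minimal[OF B(1) sub])
  moreover have "Fnl v \<notin> Fnl ` ?I" using v inj by blast
  ultimately have "Fnl v \<notin> V.span B" by blast
  from V.independent_insertI[OF this B(2)] have "V.independent (insert (Fnl v) B)" .
  moreover have vB: "Fnl v \<notin> B" using \<open>Fnl v \<notin> V.span B\<close> V.span_base by blast
  ultimately obtain \<phi> where \<phi>: "Vector_Spaces.linear smul (*) \<phi>" "\<forall>x\<in>insert (Fnl v) B. \<phi> x = (if x = Fnl v then 1 else 0)"
    using VC.linear_independent_extend[of "insert (Fnl v) B" "\<lambda>x. if x = Fnl v then 1 else 0"] by blast
  have \<phi>lin: "\<phi> (x + y) = \<phi> x + \<phi> y" "\<phi> (smul c x) = c * \<phi> x" for x y c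
    using \<phi>(1) unfolding Vector_Spaces.linear_iff by blast+
  have \<phi>0: "\<phi> 0 = 0" using \<phi>lin(2)[of 0 0] by simp
  have \<phi>diff: "\<phi> (x - y) = \<phi> x - \<phi> y" for x y using \<phi>lin(1)[of "x - y" y] by simp
  have "\<phi> x = 0" if "x \<in> V.span B" for x
    using that
  proof (induction rule: V.span_induct_alt)
    case (step c x y)
    then show ?case using \<phi>(2) vB by (auto simp: \<phi>lin)
  qed (rule \<phi>0)
  then have kill: "\<phi> (Fnl f) = 0" if "f \<in> ?I" for f using B(3) that by blast
  define G where "G w = \<phi> (Fnl (mono w))" for w :: "'g gen list"
  have rel: "\<phi> (Fnl (lmul u (rmul r w))) = 0" if "r \<in> uhat_rels sc br frm" for u r w
    by (rule kill[OF vac_ideal.rel[OF that]])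
  have gen: "\<phi> (Fnl (lmul u j)) = 0" if "j \<in> vac_gens k" for u j
    by (rule kill[OF vac_ideal.vac[OF that]])
  note calc = lmul_tsub lmul_tsc lmul_mono rmul_tsub rmul_tsc rmul_mono Fa \<phi>lin \<phi>diff G_def[symmetric]
  have "vac_functional sc br frm k G"
  proof
    fix u w x y and m :: int
    have "tsub (tsub (mono [Some (x + y, m)]) (mono [Some (x, m)])) (mono [Some (y, m)]) \<in> uhat_rels sc br frm"
      unfolding uhat_rels_def by blast
    from rel[OF this, of u w] show "G (u @ Some (x + y, m) # w) = G (u @ Some (x, m) # w) + G (u @ Some (y, m) # w)"
      by (simp add: calc algebra_simps)
  next
    fix u w c x and m :: int
    have "tsub (mono [Some (sc c x, m)]) (tsc c (mono [Some (x, m)])) \<in> uhat_rels sc br frm"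
      unfolding uhat_rels_def by blast
    from rel[OF this, of u w] show "G (u @ Some (sc c x, m) # w) = c * G (u @ Some (x, m) # w)"
      by (simp add: calc)
  next
    fix u w x y and m n :: int
    have "tsub (tsub (tsub (mono [Some (x, m), Some (y, n)]) (mono [Some (y, n), Some (x, m)]))
             (mono [Some (br x y, m + n)]))
          (tsc (if m + n = 0 then of_int m * frm x y else 0) (mono [None])) \<in> uhat_rels sc br frm"
      unfolding uhat_rels_def by blast
    from rel[OF this, of u w] show "G (u @ Some (x, m) # Some (y, n) # w) = G (u @ Some (y, n) # Some (x, m) # w)
      + G (u @ Some (br x y, m + n) # w) + (if m + n = 0 then of_int m * frm x y else 0) * G (u @ None # w)"
      by (simp add: calc algebra_simps)
  next
    fix u w and a :: "'g gen"
    have "tsub (mono [None, a]) (mono [a, None]) \<in> uhat_rels sc br frm" unfolding uhat_rels_def by blast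
    from rel[OF this, of u w] show "G (u @ None # a # w) = G (u @ a # None # w)" by (simp add: calc)
  next
    fix u and x :: 'g and m :: int assume "m \<ge> 0"
    then have "mono [Some (x, m)] \<in> vac_gens k" unfolding vac_gens_def by blast
    from gen[OF this, of u] show "G (u @ [Some (x, m)]) = 0" by (simp add: calc)
  next
    fix u :: "'g gen list"
    have "tsub (mono [None]) (tsc k (mono [])) \<in> (vac_gens k :: 'g tens set)" unfolding vac_gens_def by blast
    from gen[OF this, of u] show "G (u @ [None]) = k * G u" by (simp add: calc)
  qed
  moreover have "pairing G v = 1"
  proof -
    have fin: "finite {w. v w \<noteq> 0}" using fs by (simp add: fin_supp_def)
    have \<phi>sum: "\<phi> (\<Sum>w\<in>A. h w) = (\<Sum>w\<in>A. \<phi> (h w))" for A :: "'g gen list set" and h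
      by (induction A rule: infinite_finite_induct) (auto simp: \<phi>0 \<phi>lin)
    have "Fnl v = (\<Sum>w\<in>{w. v w \<noteq> 0}. smul (v w) (Fnl (mono w)))"
      by (rule fnl_eqI) (simp add: ev_sum mono_def fin if_distrib[of "(*) _"] sum.delta' cong: if_cong)
    then have "\<phi> (Fnl v) = pairing G v" by (simp add: \<phi>sum \<phi>lin pairing_def G_def)
    then show ?thesis using \<phi>(2) by simp
  qed
  ultimately show ?thesis using that by simp
qed

text \<open>The hypothesis \<open>lie_algebra\<close> does not include linearity in the second argument.  A failure of
  antisymmetry would produce a nonzero element acting by zero, so by simplicity all of \<open>t\<^sup>-\<^sup>2 g[t\<^sup>-\<^sup>1]\<close>
  would act by zero.\<close>
lemma c2_imp_antisymmetric:
  fixes sc :: "complex \<Rightarrow> 'g::ab_group_add \<Rightarrow> 'g"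
  assumes lie: "lie_algebra sc br" and simple: "simple_lie sc br"
    and G: "vac_functional sc br frm k G" and v: "v \<in> c2_preimage sc br frm k" "pairing G v \<noteq> 0"
  shows "br x y = - br y x"
proof -
  interpret vac_functional sc br frm k G by (rule G)
  interpret vector_space sc using lie by (simp add: lie_algebra_def)
  \<comment> \<open>The elements all of whose modes act by zero as far as \<open>G\<close> can
    see.\<close>
  define N where "N = {x. \<forall>u m w. G (u @ Some (x, m) # w) = 0}"
  have subN: "subspace N"
    unfolding subspace_def N_def using G_scale[where c = 0 and x = 0] by (auto simp: G_add G_scale)
  have antisym: "br x y + br y x \<in> N" for x y
  proof -
    \<comment> \<open>Exchanging x(m) and y(0) twice returns to the start; with mode 0 for y both
      central terms vanish.\<close>
    have "G (u @ Some (br x y + br y x, m) # w) = 0" for u m w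
      using G_bracket[of u x m y 0 w] G_bracket[of u y 0 x m w] by (simp add: G_add add.commute split: if_splits)
    then show ?thesis by (simp add: N_def)
  qed
  have "br y x \<in> N" if "x \<in> N" for x y
  proof -
    have "G (u @ Some (br y x, m) # w) = 0" for u m w
      using G_bracket[of u y 0 x m w] that[unfolded N_def, THEN CollectD, rule_format, of u m "Some (y, 0) # w"]
        that[unfolded N_def, THEN CollectD, rule_format, of "u @ [Some (y, 0)]" m w]
      by (simp split: if_splits)
    then show ?thesis by (simp add: N_def)
  qed
  then have "lie_ideal sc br N" using subN by (simp add: lie_ideal_def)
  then have "N = {0} \<or> N = UNIV" using simple by (simp add: simple_lie_def)
  moreover have "N \<noteq> UNIV"
  proof
    assume N: "N = UNIV"
    have "f \<in> fin_supp \<and> pairing G f = 0" if "f \<in> c2_preimage sc br frm k" for f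
      using that
    proof (induction rule: c2_preimage.induct)
      case (base f)
      then show ?case using vac_ideal_fin_supp vac_functional_kills[OF G] by blast
    next
      case (mode n f x)
      have "G (Some (x, - n) # w) = 0" for w
      proof -
        have "x \<in> N" using N by simp
        from this[unfolded N_def, THEN CollectD, rule_format, of "[]"] show ?thesis by simp
      qed
      then show ?case using mode by (simp add: fin_supp_lmul pairing_lmul) (simp add: pairing_def)
    qed (auto simp: fin_supp_tadd fin_supp_tsc pairing_tadd pairing_tsc)
    then show False using v by blast
  qed
  ultimately have "br x y + br y x = 0" using antisym by blast
  then show ?thesis by (simp add: eq_neg_iff_add_eq_0)
qed

section \<open>The ring \<open>F\<close> as the dual of the vacuum module\<close>

context fd_lie
begin

primrec gact :: "complex \<Rightarrow> complex \<Rightarrow> 'g gen \<Rightarrow> ('g \<times> nat) fnl \<Rightarrow> ('g \<times> nat) fnl" where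
  "gact k l None f = smul k f"
| "gact k l (Some p) f = act l (fst p) (snd p) f"

lemma gact_add: "gact k l a (f + g) = gact k l a f + gact k l a g"
  and gact_smul: "gact k l a (smul c f) = smul c (gact k l a f)"
  by (cases a; simp add: act_add act_smul smul_add_right smul_smul mult.commute)+

lemma fold_gact_add: "fold (gact k l) w (f + g) = fold (gact k l) w f + fold (gact k l) w g"
  and fold_gact_smul: "fold (gact k l) w (smul c f) = smul c (fold (gact k l) w f)"
  by (induction w arbitrary: f g) (simp_all add: gact_add gact_smul)

lemma F_gact: "f \<in> F \<Longrightarrow> gact k l a f \<in> F"
  by (cases a) (auto intro: F_smul F_act)

lemma F_fold_gact: "f \<in> F \<Longrightarrow> fold (gact k l) w f \<in> F"
  by (induction w arbitrary: f) (auto intro: F_gact)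

text \<open>Extends \<open>f\<close> from negative modes to all words in the generators: the letters
  act from the right, first letter first, and the result is evaluated at the vacuum.\<close>

definition word_value :: "complex \<Rightarrow> complex \<Rightarrow> ('g \<times> nat) fnl \<Rightarrow> 'g gen list \<Rightarrow> complex" where
  "word_value k l f w = ev (fold (gact k l) w f) []"

lemma word_value_append: "word_value k l f (u @ w) = word_value k l (fold (gact k l) u f) w"
  by (simp add: word_value_def)

lemma word_value_Cons: "word_value k l f (a # w) = word_value k l (gact k l a f) w"
  by (simp add: word_value_def)

lemma word_value_add: "word_value k l (f + g) w = word_value k l f w + word_value k l g w"
  and word_value_smul: "word_value k l (smul c f) w = c * word_value k l f w"
  by (simp_all add: word_value_def fold_gact_add fold_gact_smul)

lemma word_value_vac:
  assumes f: "f \<in> F" and lk: "\<And>x y. l * kap x y = k * frm x y"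
  shows "vac_functional sc br frm k (word_value k l f)"
proof
  note wv = word_value_append word_value_Cons
  fix u w x y and m n :: int
  have fu: "fold (gact k l) u f \<in> F" by (rule F_fold_gact[OF f])
  show "word_value k l f (u @ Some (x + y, m) # w) =
      word_value k l f (u @ Some (x, m) # w) + word_value k l f (u @ Some (y, m) # w)"
    by (simp add: wv act_letter_add[OF fu] word_value_add)
  show "word_value k l f (u @ Some (sc c x, m) # w) = c * word_value k l f (u @ Some (x, m) # w)" for c
    by (simp add: wv act_letter_scale[OF fu] word_value_smul)
  have "cc l x m y n = (if m + n = 0 then of_int m * frm x y else 0) * k"
    using lk[of x y] by (simp add: cc_def mult_ac)
  then show "word_value k l f (u @ Some (x, m) # Some (y, n) # w) = word_value k l f (u @ Some (y, n) # Some (x, m) # w)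
      + word_value k l f (u @ Some (br x y, m + n) # w)
      + (if m + n = 0 then of_int m * frm x y else 0) * word_value k l f (u @ None # w)"
    using act_commute[OF fu, of l y n x m]
    by (simp add: wv word_value_add word_value_smul mult.assoc)
next
  note wv = word_value_append word_value_Cons
  fix u a w
  show "word_value k l f (u @ None # a # w) = word_value k l f (u @ a # None # w)"
    by (simp add: wv gact_smul)
next
  fix u x and m :: int assume "m \<ge> 0"
  then show "word_value k l f (u @ [Some (x, m)]) = 0" by (simp add: word_value_def act_Nil)
next
  fix u show "word_value k l f (u @ [None]) = k * word_value k l f u" by (simp add: word_value_def)
qed

definition neg_letter :: "'g \<times> nat \<Rightarrow> 'g gen" where
  "neg_letter p = Some (fst p, - int (snd p) - 1)"

text \<open>A functional on the vacuum module is determined by its values on words in negative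
  modes, since other modes can be commuted to the vacuum and K is a scalar.\<close>

lemma vac_functional_word_value:
  assumes G: "vac_functional sc br frm k G" and lk: "\<And>x y. l * kap x y = k * frm x y"
  obtains f where "f \<in> F" "G = word_value k l f"
proof -
  interpret vac_functional sc br frm k G by (rule G)
  \<comment> \<open>The prefix \<open>u\<close> is kept arbitrary so that inductions on the word can
    move its first letter into the prefix.\<close>
  define R where "R u = Fnl (\<lambda>w. G (u @ map neg_letter w))" for u
  have evR: "ev (R u) w = G (u @ map neg_letter w)" for u w by (simp add: R_def)
  have derR: "der p (R u) = R (u @ [neg_letter p])" for p u
    by (rule fnl_eqI) (simp add: evR)
  have frelR: "frel (R u)" for u
  proof (rule frelI)
    show "der (x + y, n) (R u) = der (x, n) (R u) + der (y, n) (R u)" for x y n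
      by (rule fnl_eqI) (simp add: evR neg_letter_def G_add)
    show "der (sc c x, n) (R u) = smul c (der (x, n) (R u))" for c x n
      by (rule fnl_eqI) (simp add: evR neg_letter_def G_scale)
    show "der (y, m) (der (x, n) (R u)) = der (x, n) (der (y, m) (R u)) + der (br x y, n + m + 1) (R u)" for x y n m
    proof (rule fnl_eqI)
      fix w
      have e: "- int n - 1 + (- int m - 1) = - int (n + m + 1) - 1" by simp
      show "ev (der (y, m) (der (x, n) (R u))) w = ev (der (x, n) (der (y, m) (R u)) + der (br x y, n + m + 1) (R u)) w"
        using G_bracket[of u x "- int n - 1" y "- int m - 1" "map neg_letter w"] unfolding e
        by (simp add: evR neg_letter_def)
    qed
  qed
  have FR: "R u \<in> F" for u
  proof -
    have "fold der w (R u) = R (u @ map neg_letter w)" for w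
      by (induction w arbitrary: u) (simp_all add: derR)
    then show ?thesis by (simp add: F_def frelR)
  qed
  have actR: "ev (act l x m (R u)) w = G (u @ Some (x, m) # map neg_letter w)" for u w x m
  proof (induction w arbitrary: u x m)
    case Nil
    show ?case
      by (cases "m < 0") (simp_all add: act_neg act_Nil evR neg_letter_def G_vac)
  next
    case (Cons p w)
    obtain y n where p: "p = (y, n)" by force
    show ?case
    proof (cases "m < 0")
      case True
      then show ?thesis using neg_letter_def[of "(x, nat (- m - 1))"] by (simp add: act_neg evR)
    next
      case False
      have "cc l x m y (- int n - 1) = (if m + (- int n - 1) = 0 then of_int m * frm x y else 0) * k"
        using lk[of x y] by (simp add: cc_def mult_ac)
      moreover have e: "m - int n - 1 = m + (- int n - 1)" by simp
      have "ev (act l x m (R u)) (p # w) = ev (act l x m (R (u @ [neg_letter p]))) w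
          + ev (act l (br x y) (m + (- int n - 1)) (R u)) w + cc l x m y (- int n - 1) * ev (R u) w"
        using act_Cons[of m l x "R u" y n w] False unfolding p derR e by simp
      moreover have np: "neg_letter p = Some (y, - int n - 1)" by (simp add: p neg_letter_def)
      ultimately show ?thesis
        using G_bracket[of u x m y "- int n - 1" "map neg_letter w"]
        unfolding Cons evR list.map np G_None append_assoc append_Cons append_Nil by simp
    qed
  qed
  have "gact k l a (R u) = R (u @ [a])" for a u
  proof (cases a)
    case None then show ?thesis by (intro fnl_eqI) (simp add: evR G_None)
  next
    case (Some p) then show ?thesis by (intro fnl_eqI) (cases p, simp add: evR actR)
  qed
  then have "fold (gact k l) w (R u) = R (u @ w)" for u w
    by (induction w arbitrary: u) simp_all
  then have "G = word_value k l (R [])" by (simp add: fun_eq_iff word_value_def evR)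
  then show ?thesis using that FR by blast
qed

text \<open>A letter x(m) shifts the weight by m, so a fixed word sees only a bounded range of
  weights of \<open>f\<close>.\<close>

lemma word_value_local:
  "\<exists>D. \<forall>f. (\<forall>u. wt u \<le> D \<longrightarrow> ev f u = 0) \<longrightarrow> (\<forall>z. wt z \<le> C \<longrightarrow> ev (fold (gact k l) w f) z = 0)"
proof (induction w)
  case Nil then show ?case by auto
next
  case (Cons a w)
  then obtain D where D: "\<And>f z. (\<And>u. wt u \<le> D \<Longrightarrow> ev f u = 0) \<Longrightarrow> wt z \<le> C \<Longrightarrow> ev (fold (gact k l) w f) z = 0"
    by blast
  define D' where "D' = D + (case a of None \<Rightarrow> 0 | Some p \<Rightarrow> nat \<bar>snd p\<bar>)"
  have "ev (fold (gact k l) (a # w) f) z = 0" if f: "\<And>u. wt u \<le> D' \<Longrightarrow> ev f u = 0" and z: "wt z \<le> C" for f z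
  proof -
    have "ev (gact k l a f) u = 0" if u: "wt u \<le> D" for u
    proof (cases a)
      case None then show ?thesis using f u by (simp add: D'_def)
    next
      case (Some p)
      have "ev (act l (fst p) (snd p) f) u = 0"
      proof (rule act_weight)
        fix v :: "('g \<times> nat) list" assume "int (wt v) = int (wt u) - snd p"
        then have "wt v \<le> D'" using u by (simp add: D'_def Some)
        then show "ev f v = 0" by (rule f)
      qed
      then show ?thesis by (simp add: Some)
    qed
    then show ?thesis using D z by simp
  qed
  then show ?case by blast
qed

end

theorem theorem1p2:
  fixes sc :: "complex \<Rightarrow> 'g::ab_group_add \<Rightarrow> 'g"
    and br :: "'g \<Rightarrow> 'g \<Rightarrow> 'g"
    and H :: "'g set"
    and P :: "('g \<Rightarrow> complex) set"
    and \<theta> :: "'g \<Rightarrow> complex"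
    and e :: "('g \<Rightarrow> complex) \<Rightarrow> 'g"
    and f\<theta> :: 'g
    and k :: complex
    and v :: "'g tens"
  assumes "lie_algebra sc br" and "fin_dim sc" and "simple_lie sc br"
    and "cartan sc br H" and "pos_system sc br H P" and "highest_root sc br H P \<theta>"
    and "\<forall>\<alpha>\<in>P. e \<alpha> \<in> root_space br sc H \<alpha> \<and> e \<alpha> \<noteq> 0"
    and "f\<theta> \<in> root_space br sc H (fneg \<theta>)" and "f\<theta> \<noteq> 0"
    and "k \<noteq> - dual_coxeter sc br H \<theta>"
    and "v \<in> fin_supp"
    and "v \<notin> vac_ideal sc br (nform sc br H \<theta>) k"
    and "\<forall>\<alpha>\<in>P. lmul [Some (e \<alpha>, 0)] v \<in> vac_ideal sc br (nform sc br H \<theta>) k"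
    and "lmul [Some (f\<theta>, 1)] v \<in> vac_ideal sc br (nform sc br H \<theta>) k"
  shows "v \<notin> c2_preimage sc br (nform sc br H \<theta>) k"
proof
  let ?frm = "nform sc br H \<theta>"
  assume c2: "v \<in> c2_preimage sc br ?frm k"
  note lie = assms(1) and simple = assms(3)
  \<comment> \<open>Chosen before any structure theory, because antisymmetry of the bracket is
    extracted from \<open>G0\<close> and \<open>c2\<close>.\<close>
  obtain G0 where G0: "vac_functional sc br ?frm k G0" "pairing G0 v \<noteq> 0"
    using separating_functional[OF assms(11,12)] by blast
  obtain Bs where "is_basis sc Bs" using assms(2) by (auto simp: fin_dim_def)
  moreover have "vector_space sc" using lie by (simp add: lie_algebra_def)
  ultimately interpret finite_dimensional_vector_space sc Bs
    by (auto simp: finite_dimensional_vector_space_def finite_dimensional_vector_space_axioms_def is_basis_def)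
  interpret fd_lie sc Bs br
    by unfold_locales (use lie c2_imp_antisymmetric[OF lie simple G0(1) c2 G0(2)] in blast)+
  have toral: "toral sc br H" using assms(4) by (simp add: cartan_def)
  have PR: "P \<subseteq> roots sc br H" and \<theta>P: "\<theta> \<in> P"
    using assms(5,6) by (simp_all add: pos_system_def highest_root_def)
  interpret kill_lie sc Bs br
  proof
    fix x assume x: "\<And>y. kap x y = 0"
    have "\<theta> \<in> roots sc br H" using PR \<theta>P by blast
    then have "\<theta> \<noteq> (\<lambda>_. 0)" and out: "\<And>h. h \<notin> H \<Longrightarrow> \<theta> h = 0" by (simp_all add: roots_def hdual_def)
    then obtain h where "\<theta> h \<noteq> 0" by blast
    then have h: "h \<in> H" "\<theta> h \<noteq> 0" using out by blast+
    have "br h (e \<theta>) = sc (\<theta> h) (e \<theta>)" "e \<theta> \<noteq> 0" using assms(7) \<theta>P h by (auto simp: root_space_def)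
    then have "br h (e \<theta>) \<noteq> 0" using h by simp
    moreover have "diagonalizable (br h)"
      using toral h unfolding toral_def ad_semisimple_def diagonalizable_def by blast
    ultimately show "x = 0" using simple_killing_nondegenerate[OF simple _ _ x] by blast
  qed
  interpret cartan_lie sc Bs br H by unfold_locales (rule assms(4))
  define hd where "hd = dual_coxeter sc br H \<theta>"
  have hd: "hd \<noteq> 0" using coroot_norm[of \<theta>] PR \<theta>P by (auto simp: hd_def dual_coxeter_def)
  \<comment> \<open>The normalized form is the Killing form over 2 h, so level k becomes k / (2 h)
    and the critical value k = -h becomes -1/2.\<close>
  define l where "l = k / (2 * hd)"
  have lk: "l * kap x y = k * ?frm x y" for x y by (simp add: l_def nform_def hd_def)
  have l: "l \<noteq> - 1 / 2"
    using assms(10) hd by (auto simp: l_def hd_def[symmetric] field_simps)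
  obtain y B d where y: "y \<in> H" "is_basis sc B" "\<And>x. (\<Sum>b\<in>B. sc (kap (d b) x) b) = x"
    "\<And>b. b \<in> B \<Longrightarrow> (b \<in> H \<and> d b \<in> H) \<or> (\<exists>z. b = br y z)"
    using regular_decomposition by blast
  interpret regular_basis sc Bs br B d H y l
    by unfold_locales (use y l H_subspace H_abelian in auto)
  \<comment> \<open>Evaluation of functionals at \<open>v\<close>.\<close>
  define E where "E f = pairing (word_value k l f) v" for f
  have vac: "f \<in> F \<Longrightarrow> vac_functional sc br ?frm k (word_value k l f)" for f
    using word_value_vac[OF _ lk] by blast
  have Elmul: "E (act l x m f) = pairing (word_value k l f) (lmul [Some (x, m)] v)" for x m f
    by (simp add: E_def pairing_lmul word_value_Cons)
  have lin: "fun_linear E"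
    by (simp add: fun_linear_def E_def pairing_def word_value_add word_value_smul distrib_left sum.distrib
      sum_distrib_left mult_ac)
  obtain D where loc: "local_at D E"
  proof -
    have "\<exists>D. \<forall>f. (\<forall>u. wt u \<le> D \<longrightarrow> ev f u = 0) \<longrightarrow> word_value k l f w = 0" for w
      using word_value_local[of 0 k l w] unfolding word_value_def by (metis le0 wt_simps(1))
    then obtain D where D: "\<And>w f. (\<And>u. wt u \<le> D w \<Longrightarrow> ev f u = 0) \<Longrightarrow> word_value k l f w = 0" by metis
    have fin: "finite {w. v w \<noteq> 0}" using assms(11) by (simp add: fin_supp_def)
    have "local_at (\<Sum>w\<in>{w. v w \<noteq> 0}. D w) E"
      unfolding local_at_def E_def pairing_def
    proof (intro allI impI sum.neutral ballI)
      fix f :: "('g \<times> nat) fnl" and w assume f: "\<forall>u. wt u \<le> (\<Sum>w\<in>{w. v w \<noteq> 0}. D w) \<longrightarrow> ev f u = 0" and w: "w \<in> {w. v w \<noteq> 0}"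
      have "D w \<le> (\<Sum>w\<in>{w. v w \<noteq> 0}. D w)" by (rule member_le_sum[OF w _ fin]) simp
      then show "v w * word_value k l f w = 0" using D[of w f] f by simp
    qed
    then show ?thesis using that by blast
  qed
  \<comment> \<open>The x with x(1) v = 0 form a subspace that contains the lowest root vector and
    is stable under all \<open>e \<alpha>\<close>, because e_\<alpha>(0) v = 0.\<close>
  have sing1: "E (act l x 1 f) = 0" if f: "f \<in> F" for x f
  proof -
    let ?A = "{x. \<forall>f\<in>F. E (act l x 1 f) = 0}"
    have e0: "E (act l (e \<alpha>) 0 f) = 0" if "\<alpha> \<in> P" "f \<in> F" for \<alpha> f
      unfolding Elmul using vac_functional_kills[OF vac[OF that(2)]] assms(13) that(1) by blast
    have "x \<in> ?A"
    proof (rule lowest_root_vector_generates[OF simple assms(5,6)])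
      show "subspace ?A"
        by (auto simp: subspace_def act_letter_zero act_letter_add act_letter_scale fun_linearD[OF lin])
      show "f\<theta> \<in> ?A" using Elmul vac_functional_kills[OF vac] assms(14) by auto
      fix \<alpha> x assume al: "\<alpha> \<in> P" and x: "x \<in> ?A"
      have "E (act l (br (e \<alpha>) x) 1 f) = 0" if f: "f \<in> F" for f
      proof -
        have "E (act l x 1 (act l (e \<alpha>) 0 f)) = E (act l (e \<alpha>) 0 (act l x 1 f)) + E (act l (br (e \<alpha>) x) 1 f)"
          using act_commute[OF f, of l x 1 "e \<alpha>" 0] by (simp add: cc_def fun_linearD[OF lin])
        then show ?thesis using x e0[OF al] F_act[OF f] by simp
      qed
      then show "br (e \<alpha>) x \<in> ?A" by blast
    qed (use assms(7,8,9) in auto)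
    then show ?thesis using f by blast
  qed
  have sing: "E (act l x m f) = 0" if f: "f \<in> F" and m: "m \<ge> 1" for f x m
  proof -
    have "\<forall>x. \<forall>f\<in>F. E (act l x m f) = 0"
      using m
    proof (induction m rule: int_ge_induct)
      case base then show ?case using sing1 by blast
    next
      case (step m)
      let ?A = "{x. \<forall>f\<in>F. E (act l x (m + 1) f) = 0}"
      have "subspace ?A"
        by (auto simp: subspace_def act_letter_zero act_letter_add act_letter_scale fun_linearD[OF lin])
      \<comment> \<open>For m >= 1 one has [a(m), b(1)] = [a, b](m + 1) without central term, and
        brackets span g.\<close>
      moreover have "{br a b | a b. True} \<subseteq> ?A"
      proof clarify
        fix a b f assume f: "f \<in> F"
        have "E (act l b 1 (act l a m f)) = E (act l a m (act l b 1 f)) + E (act l (br a b) (m + 1) f)"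
          using act_commute[OF f, of l b 1 a m] step.hyps by (simp add: cc_def fun_linearD[OF lin])
        then show "E (act l (br a b) (m + 1) f) = 0" using step.IH sing1 F_act[OF f] by simp
      qed
      ultimately show ?case using span_eqI_subspace[OF _ _ simple_perfect[OF simple]] by blast
    qed
    then show ?thesis using f by blast
  qed
  have flat: "E f = 0" if f: "pspan (UNIV \<times> {Suc 0}) s f" for s f
  proof -
    have FF: "f \<in> F" by (rule pspan_F[OF f])
    \<comment> \<open>Each factor has weight one, so a leading letter x(-n-1) with n >= 1 cannot be
      absorbed; hence \<open>f\<close> vanishes on C_2.\<close>
    have d: "der (x, n) f = 0" if "n \<ge> 1" for x n
      using f
    proof (induction rule: pspan.induct)
      case (mult s f a N)
      then show ?case using \<open>n \<ge> 1\<close> by (simp add: der_times psi_def der_trf)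
    qed (simp_all add: der_add der_smul)
    have "g \<in> fin_supp \<and> pairing (word_value k l f) g = 0" if "g \<in> c2_preimage sc br ?frm k" for g
      using that
    proof (induction rule: c2_preimage.induct)
      case (base g)
      then show ?case using vac_ideal_fin_supp vac_functional_kills[OF vac[OF FF]] by blast
    next
      case (mode n g x)
      have "act l x (- n) f = 0" using mode by (simp add: act_neg d)
      moreover have "word_value k l 0 w = 0" for w using word_value_smul[of k l 0 0 w] by simp
      ultimately have "word_value k l f ([Some (x, - n)] @ w) = 0" for w by (simp add: word_value_Cons)
      then show ?case using mode by (simp add: fin_supp_lmul pairing_lmul) (simp add: pairing_def)
    qed (auto simp: fin_supp_tadd fin_supp_tsc pairing_tadd pairing_tsc)
    then show ?thesis using c2 by (simp add: E_def)
  qed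
  \<comment> \<open>The functional separating \<open>v\<close> from the ideal is one of those on
    which \<open>E\<close> has been shown to vanish.\<close>
  obtain f0 where "f0 \<in> F" "G0 = word_value k l f0"
    using vac_functional_word_value[OF G0(1) lk] by blast
  then show False
    using singular_functional_vanishes[OF lin loc sing flat] G0(2) by (simp add: E_def)
qed

end
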